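(* Let $k$ be an algebraically closed field with $\operatorname{char}(k)\ne2$, let $A=A(\alpha,\beta,\gamma)$ be a 4-dimensional Sklyanin algebra over $k$ whose associated automorphism $\sigma$ has infinite order, and let $A^{G,\mu}$ be the cocycle twist described in the context. Then the centre of $A^{G,\mu}$ is $Z(A^{G,\mu})=k[\Theta_1,\Theta_2]$.
   Context: Write $[x,y]=xy-yx$, $[x,y]_+=xy+yx$. The parameters satisfy $\alpha+\beta+\gamma+\alpha\beta\gamma=0$, $\{\alpha,\beta,\gamma\}\cap\{0,\pm1\}=\emptyset$; $A$ is generated by $x_0,\dots,x_3$ (degree 1) with relations $[x_0,x_1]-\alpha[x_2,x_3]_+$, $[x_0,x_1]_+-[x_2,x_3]$, $[x_0,x_2]-\beta[x_3,x_1]_+$, $[x_0,x_2]_+-[x_3,x_1]$, $[x_0,x_3]-\gamma[x_1,x_2]_+$, $[x_0,x_3]_+-[x_1,x_2]$. Associated geometry: the elliptic curve $E\subset\mathbb{P}^3_k$, $y_0^2+y_1^2+y_2^2+y_3^2=0$, $y_3^2+\frac{1-\gamma}{1+\alpha}y_1^2+\frac{1+\gamma}{1-\beta}y_2^2=0$, parameterises (with four extra points) the point modules over $A$ (cyclic $\mathbb{N}$-graded right modules with Hilbert series $1/(1-t)$); $\sigma$ is the translation automorphism of $E$ with $M_p[1]_{\ge0}\cong M_{\sigma(p)}$. $G=\langle g_1,g_2\rangle\cong(C_2)^2$ acts on $A$ by $x_0^{g_1}=x_0$, $x_1^{g_1}=x_1$, $x_2^{g_1}=-x_2$, $x_3^{g_1}=-x_3$,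 $x_i^{g_2}=(-1)^ix_i$, inducing a $G$-grading with $x_0,x_1,x_2,x_3$ in degrees $e,g_1,g_2,g_1g_2$. With $\mu(g_1^pg_2^q,g_1^rg_2^s)=(-1)^{ps}$, $A^{G,\mu}$ is $A$ with multiplication $a\ast_\mu b=\mu(g,h)ab$ for $a\in A_g,b\in A_h$. Its generators corresponding to the $x_i$ are denoted $v_i$, and it is presented by the relations $[v_0,v_1]-\alpha[v_2,v_3]$, $[v_0,v_1]_+-[v_2,v_3]_+$, $[v_0,v_2]-\beta[v_3,v_1]$, $[v_0,v_2]_+-[v_3,v_1]_+$, $[v_0,v_3]+\gamma[v_1,v_2]$, $[v_0,v_3]_++[v_1,v_2]_+$. The elements $\Theta_1,\Theta_2\in A^{G,\mu}$ are $$\Theta_1=-v_0^2+v_1^2+v_2^2-v_3^2,\qquad\Theta_2=v_1^2+\tfrac{1+\alpha}{1-\beta}v_2^2-\tfrac{1-\alpha}{1+\gamma}v_3^2.$$ *)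

theory Defs
  imports
    "HOL-Algebra.Algebra"
    "HOL-Algebra.Algebraic_Closure_Type"
    "HOL-Library.Poly_Mapping"
    "HOL-Library.Z2"
begin

section \<open>Free algebra on four generators\<close>

datatype gen = X0 | X1 | X2 | X3

lemma UNIV_gen: "(UNIV :: gen set) = {X0, X1, X2, X3}"
  using gen.exhaust by blast

instance gen :: finite
  by standard (simp add: UNIV_gen)

text \<open>
  The free monoid is written additively, because \<^type>\<open>poly_mapping\<close> multiplies by convolution
  over an additive monoid; finitely supported functions on it form the free algebra.
\<close>

datatype word = Word (letters: "gen list")

instantiation word :: monoid_add
begin

definition zero_word :: word where
  "0 = Word []"

definition plus_word :: "word \<Rightarrow> word \<Rightarrow> word" where
  "u + v = Word (letters u @ letters v)"

instance
  by standard (simp_all add: zero_word_def plus_word_def)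

end

type_synonym 'k free_alg = "word \<Rightarrow>\<^sub>0 'k"

definition fconst :: "'k::field \<Rightarrow> 'k free_alg" where
  "fconst c = Poly_Mapping.single 0 c"

definition fgen :: "gen \<Rightarrow> 'k::field free_alg" where
  "fgen i = Poly_Mapping.single (Word [i]) 1"

text \<open>The endomorphism of the free algebra that fixes scalars and sends each generator \<open>i\<close> to \<open>\<phi> i\<close>.\<close>

definition fsubst :: "(gen \<Rightarrow> 'k::field free_alg) \<Rightarrow> 'k free_alg \<Rightarrow> 'k free_alg" where
  "fsubst \<phi> f = (\<Sum>w\<in>Poly_Mapping.keys f.
     fconst (Poly_Mapping.lookup f w) * prod_list (map \<phi> (letters w)))"

abbreviation free_ring :: "'k::field free_alg ring" where
  "free_ring \<equiv> ring_of_type_algebra"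


section \<open>The Sklyanin algebra\<close>

definition sklyanin_params :: "'k::field \<Rightarrow> 'k \<Rightarrow> 'k \<Rightarrow> bool" where
  "sklyanin_params \<alpha> \<beta> \<gamma> \<longleftrightarrow>
     \<alpha> + \<beta> + \<gamma> + \<alpha> * \<beta> * \<gamma> = 0 \<and> {\<alpha>, \<beta>, \<gamma>} \<inter> {0, 1, -1} = {}"

definition commutator :: "'a::ring \<Rightarrow> 'a \<Rightarrow> 'a" where
  "commutator x y = x * y - y * x"

definition anticommutator :: "'a::ring \<Rightarrow> 'a \<Rightarrow> 'a" where
  "anticommutator x y = x * y + y * x"

definition sklyanin_rels :: "'k::field \<Rightarrow> 'k \<Rightarrow> 'k \<Rightarrow> 'k free_alg set" where
  "sklyanin_rels \<alpha> \<beta> \<gamma> =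
    {commutator (fgen X0) (fgen X1) - fconst \<alpha> * anticommutator (fgen X2) (fgen X3),
     anticommutator (fgen X0) (fgen X1) - commutator (fgen X2) (fgen X3),
     commutator (fgen X0) (fgen X2) - fconst \<beta> * anticommutator (fgen X3) (fgen X1),
     anticommutator (fgen X0) (fgen X2) - commutator (fgen X3) (fgen X1),
     commutator (fgen X0) (fgen X3) - fconst \<gamma> * anticommutator (fgen X1) (fgen X2),
     anticommutator (fgen X0) (fgen X3) - commutator (fgen X1) (fgen X2)}"

definition sklyanin_ideal :: "'k::field \<Rightarrow> 'k \<Rightarrow> 'k \<Rightarrow> 'k free_alg set" where
  "sklyanin_ideal \<alpha> \<beta> \<gamma> = Idl\<^bsub>free_ring\<^esub> (sklyanin_rels \<alpha> \<beta> \<gamma>)"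

definition sklyanin :: "'k::field \<Rightarrow> 'k \<Rightarrow> 'k \<Rightarrow> 'k free_alg set ring" where
  "sklyanin \<alpha> \<beta> \<gamma> = free_ring Quot sklyanin_ideal \<alpha> \<beta> \<gamma>"

definition sk_class :: "'k::field \<Rightarrow> 'k \<Rightarrow> 'k \<Rightarrow> 'k free_alg \<Rightarrow> 'k free_alg set" where
  "sk_class \<alpha> \<beta> \<gamma> f = sklyanin_ideal \<alpha> \<beta> \<gamma> +>\<^bsub>free_ring\<^esub> f"

definition sk_scalar :: "'k::field \<Rightarrow> 'k \<Rightarrow> 'k \<Rightarrow> 'k \<Rightarrow> 'k free_alg set" where
  "sk_scalar \<alpha> \<beta> \<gamma> c = sk_class \<alpha> \<beta> \<gamma> (fconst c)"

definition sk_gen :: "'k::field \<Rightarrow> 'k \<Rightarrow> 'k \<Rightarrow> gen \<Rightarrow> 'k free_alg set" where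
  "sk_gen \<alpha> \<beta> \<gamma> i = sk_class \<alpha> \<beta> \<gamma> (fgen i)"

text \<open>The component of degree \<open>n\<close> for the grading by word length.\<close>

definition sk_piece :: "'k::field \<Rightarrow> 'k \<Rightarrow> 'k \<Rightarrow> nat \<Rightarrow> 'k free_alg set set" where
  "sk_piece \<alpha> \<beta> \<gamma> n =
     {sk_class \<alpha> \<beta> \<gamma> f | f. \<forall>w\<in>Poly_Mapping.keys f. length (letters w) = n}"


section \<open>Point modules and the associated automorphism\<close>

text \<open>
  As for the library's modules, the fields \<^const>\<open>monoid.mult\<close> and \<^const>\<open>monoid.one\<close> of the underlying
  ring record are irrelevant; \<open>ract M m a\<close> is the right action \<open>m \<cdot> a\<close>.
\<close>

record ('a, 'm) gr_rmodule = "'m ring" +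
  ract :: "'m \<Rightarrow> 'a \<Rightarrow> 'm"
  piece :: "nat \<Rightarrow> 'm set"

definition gr_rmodule_iso ::
    "('a, 'r) ring_scheme \<Rightarrow> ('a, 'm) gr_rmodule \<Rightarrow> ('a, 'n) gr_rmodule \<Rightarrow> bool" where
  "gr_rmodule_iso R M N \<longleftrightarrow>
     (\<exists>f. bij_betw f (carrier M) (carrier N) \<and>
          (\<forall>m\<in>carrier M. \<forall>m'\<in>carrier M. f (m \<oplus>\<^bsub>M\<^esub> m') = f m \<oplus>\<^bsub>N\<^esub> f m') \<and>
          (\<forall>m\<in>carrier M. \<forall>a\<in>carrier R. f (ract M m a) = ract N (f m) a) \<and>
          (\<forall>n. f ` piece M n = piece N n))"

text \<open>The graded module \<open>M[1]\<^sub>\<ge>\<^sub>0\<close>, whose component of degree \<open>n \<ge> 0\<close> is \<open>M\<^sub>n\<^sub>+\<^sub>1\<close>.\<close>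

definition shift_trunc :: "('a, 'm) gr_rmodule \<Rightarrow> ('a, 'm) gr_rmodule" where
  "shift_trunc M = M
     \<lparr>carrier := {(\<Oplus>\<^bsub>M\<^esub>n\<in>{1..N}. c n) | c N. \<forall>n. c n \<in> piece M n},
      piece := (\<lambda>n. piece M (Suc n))\<rparr>"

definition right_ideal_gen :: "('a, 'r) ring_scheme \<Rightarrow> 'a set \<Rightarrow> 'a set" where
  "right_ideal_gen R S = \<Inter>{J. additive_subgroup J R \<and> S \<subseteq> J \<and>
     (\<forall>j\<in>J. \<forall>a\<in>carrier R. j \<otimes>\<^bsub>R\<^esub> a \<in> J)}"

text \<open>
  The quotient of the right module \<open>R\<close>, graded by \<open>D\<close>, by a homogeneous right ideal \<open>J\<close>.
\<close>

definition right_quotient ::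
    "('a, 'r) ring_scheme \<Rightarrow> (nat \<Rightarrow> 'a set) \<Rightarrow> 'a set \<Rightarrow> ('a, 'a set) gr_rmodule" where
  "right_quotient R D J =
    \<lparr>carrier = a_rcosets\<^bsub>R\<^esub> J, monoid.mult = undefined, monoid.one = undefined,
     ring.zero = J, ring.add = set_add R,
     ract = (\<lambda>C a. \<Union>c\<in>C. J +>\<^bsub>R\<^esub> (c \<otimes>\<^bsub>R\<^esub> a)),
     piece = (\<lambda>n. (\<lambda>a. J +>\<^bsub>R\<^esub> a) ` D n)\<rparr>"

text \<open>A point of projective 3-space is the set of all its homogeneous coordinate vectors.\<close>

definition proj_point :: "(gen \<Rightarrow> 'k::field) \<Rightarrow> (gen \<Rightarrow> 'k) set" where
  "proj_point y = {(\<lambda>i. c * y i) | c. c \<noteq> 0}"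

definition sk_curve :: "'k::field \<Rightarrow> 'k \<Rightarrow> 'k \<Rightarrow> (gen \<Rightarrow> 'k) set set" where
  "sk_curve \<alpha> \<beta> \<gamma> = {proj_point y | y. y \<noteq> (\<lambda>_. 0) \<and>
     y X0 ^ 2 + y X1 ^ 2 + y X2 ^ 2 + y X3 ^ 2 = 0 \<and>
     y X3 ^ 2 + (1 - \<gamma>) / (1 + \<alpha>) * y X1 ^ 2 + (1 + \<gamma>) / (1 - \<beta>) * y X2 ^ 2 = 0}"

text \<open>The linear forms in degree 1 that vanish at the point \<open>P\<close>.\<close>

definition point_perp ::
    "'k::field \<Rightarrow> 'k \<Rightarrow> 'k \<Rightarrow> (gen \<Rightarrow> 'k) set \<Rightarrow> 'k free_alg set set" where
  "point_perp \<alpha> \<beta> \<gamma> P =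
     {sk_class \<alpha> \<beta> \<gamma> (\<Sum>i\<in>UNIV. fconst (c i) * fgen i) | c.
        \<forall>y\<in>P. (\<Sum>i\<in>UNIV. c i * y i) = 0}"

text \<open>
  The point module \<open>M\<^sub>P\<close> is the cyclic right module \<open>A / P\<^sup>\<bottom>A\<close>: points of projective space
  are read as points of \<open>\<P>(A\<^sub>1\<^sup>*)\<close>, and \<open>P\<^sup>\<bottom>\<close> is the annihilator in \<open>A\<^sub>1\<close> of the generator.
\<close>

definition point_module ::
    "'k::field \<Rightarrow> 'k \<Rightarrow> 'k \<Rightarrow> (gen \<Rightarrow> 'k) set \<Rightarrow> ('k free_alg set, 'k free_alg set set) gr_rmodule"
  where
  "point_module \<alpha> \<beta> \<gamma> P =
     right_quotient (sklyanin \<alpha> \<beta> \<gamma>) (sk_piece \<alpha> \<beta> \<gamma>)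
       (right_ideal_gen (sklyanin \<alpha> \<beta> \<gamma>) (point_perp \<alpha> \<beta> \<gamma> P))"

text \<open>
  A point is determined by the isomorphism class of its module, so the second condition
  pins down \<open>\<sigma>\<close> on the curve. In particular, that \<open>\<sigma>\<close> is a translation of the elliptic
  curve is a consequence and not a further requirement.
\<close>

definition associated_automorphism ::
    "'k::field \<Rightarrow> 'k \<Rightarrow> 'k \<Rightarrow> ((gen \<Rightarrow> 'k) set \<Rightarrow> (gen \<Rightarrow> 'k) set) \<Rightarrow> bool" where
  "associated_automorphism \<alpha> \<beta> \<gamma> \<sigma> \<longleftrightarrow>
     bij_betw \<sigma> (sk_curve \<alpha> \<beta> \<gamma>) (sk_curve \<alpha> \<beta> \<gamma>) \<and>
     (\<forall>P\<in>sk_curve \<alpha> \<beta> \<gamma>.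
        gr_rmodule_iso (sklyanin \<alpha> \<beta> \<gamma>)
          (shift_trunc (point_module \<alpha> \<beta> \<gamma> P)) (point_module \<alpha> \<beta> \<gamma> (\<sigma> P)))"

definition infinite_order_on :: "'p set \<Rightarrow> ('p \<Rightarrow> 'p) \<Rightarrow> bool" where
  "infinite_order_on S \<sigma> \<longleftrightarrow> (\<forall>n>0. \<exists>p\<in>S. (\<sigma> ^^ n) p \<noteq> p)"


section \<open>The cocycle twist\<close>

text \<open>The group element \<open>g\<^sub>1\<^sup>p g\<^sub>2\<^sup>q\<close> of \<open>G = (C\<^sub>2)\<^sup>2\<close> is represented by \<open>(p, q)\<close>.\<close>

type_synonym klein4 = "bit \<times> bit"

definition bsign :: "bit \<Rightarrow> 'k::field" where
  "bsign b = (if b = 0 then 1 else -1)"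

fun gen_sign :: "klein4 \<Rightarrow> gen \<Rightarrow> 'k::field" where
  "gen_sign (p, q) X0 = 1"
| "gen_sign (p, q) X1 = bsign q"
| "gen_sign (p, q) X2 = bsign p"
| "gen_sign (p, q) X3 = bsign p * bsign q"

text \<open>
  Since \<open>g\<close> maps the defining ideal onto itself, the image of a coset is again a coset.
\<close>

definition sk_act :: "klein4 \<Rightarrow> 'k::field free_alg set \<Rightarrow> 'k free_alg set" where
  "sk_act g a = fsubst (\<lambda>i. fconst (gen_sign g i) * fgen i) ` a"

text \<open>
  The identification of \<open>G\<close> with its character group for which the isotypic component of the
  character \<open>\<lambda>h. klein_char h g\<close> is the component of degree \<open>g\<close>; it puts the generators
  in degrees \<open>e\<close>, \<open>g\<^sub>1\<close>, \<open>g\<^sub>2\<close>, \<open>g\<^sub>1g\<^sub>2\<close>.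
\<close>

fun klein_char :: "klein4 \<Rightarrow> klein4 \<Rightarrow> 'k::field" where
  "klein_char (p, q) (r, s) = bsign (p * s + q * r)"

lemma gen_sign_eq_klein_char:
  "gen_sign h X0 = klein_char h (0, 0)"
  "gen_sign h X1 = klein_char h (1, 0)"
  "gen_sign h X2 = klein_char h (0, 1)"
  "gen_sign h X3 = klein_char h (1, 1)"
  by (cases h; cases "fst h"; cases "snd h"; simp add: bsign_def)+

definition sk_G_piece :: "'k::field \<Rightarrow> 'k \<Rightarrow> 'k \<Rightarrow> klein4 \<Rightarrow> 'k free_alg set set" where
  "sk_G_piece \<alpha> \<beta> \<gamma> g = {a \<in> carrier (sklyanin \<alpha> \<beta> \<gamma>).
     \<forall>h. sk_act h a = sk_scalar \<alpha> \<beta> \<gamma> (klein_char h g) \<otimes>\<^bsub>sklyanin \<alpha> \<beta> \<gamma>\<^esub> a}"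

definition sk_G_part ::
    "'k::field \<Rightarrow> 'k \<Rightarrow> 'k \<Rightarrow> 'k free_alg set \<Rightarrow> klein4 \<Rightarrow> 'k free_alg set" where
  "sk_G_part \<alpha> \<beta> \<gamma> a = (THE c. (\<forall>g. c g \<in> sk_G_piece \<alpha> \<beta> \<gamma> g) \<and>
     a = (\<Oplus>\<^bsub>sklyanin \<alpha> \<beta> \<gamma>\<^esub>g\<in>UNIV. c g))"

fun klein_cocycle :: "klein4 \<Rightarrow> klein4 \<Rightarrow> 'k::field" where
  "klein_cocycle (p, q) (r, s) = bsign (p * s)"

definition twist_mult ::
    "'k::field \<Rightarrow> 'k \<Rightarrow> 'k \<Rightarrow> 'k free_alg set \<Rightarrow> 'k free_alg set \<Rightarrow> 'k free_alg set" where
  "twist_mult \<alpha> \<beta> \<gamma> a b =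
     (\<Oplus>\<^bsub>sklyanin \<alpha> \<beta> \<gamma>\<^esub>g\<in>UNIV. \<Oplus>\<^bsub>sklyanin \<alpha> \<beta> \<gamma>\<^esub>h\<in>UNIV.
        sk_scalar \<alpha> \<beta> \<gamma> (klein_cocycle g h) \<otimes>\<^bsub>sklyanin \<alpha> \<beta> \<gamma>\<^esub>
          (sk_G_part \<alpha> \<beta> \<gamma> a g \<otimes>\<^bsub>sklyanin \<alpha> \<beta> \<gamma>\<^esub> sk_G_part \<alpha> \<beta> \<gamma> b h))"

text \<open>
  The twist has the same underlying set as the Sklyanin algebra, so its generators \<open>v\<^sub>i\<close> are
  the elements \<^term>\<open>sk_gen \<alpha> \<beta> \<gamma> i\<close> and its scalars are \<^term>\<open>sk_scalar \<alpha> \<beta> \<gamma> c\<close>.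
\<close>

definition sklyanin_twist :: "'k::field \<Rightarrow> 'k \<Rightarrow> 'k \<Rightarrow> 'k free_alg set ring" where
  "sklyanin_twist \<alpha> \<beta> \<gamma> = (sklyanin \<alpha> \<beta> \<gamma>)\<lparr>monoid.mult := twist_mult \<alpha> \<beta> \<gamma>\<rparr>"

definition Theta1 :: "'k::field \<Rightarrow> 'k \<Rightarrow> 'k \<Rightarrow> 'k free_alg set" where
  "Theta1 \<alpha> \<beta> \<gamma> = (let B = sklyanin_twist \<alpha> \<beta> \<gamma>; v = sk_gen \<alpha> \<beta> \<gamma> in
     \<ominus>\<^bsub>B\<^esub> (v X0 [^]\<^bsub>B\<^esub> (2::nat)) \<oplus>\<^bsub>B\<^esub> v X1 [^]\<^bsub>B\<^esub> (2::nat)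
       \<oplus>\<^bsub>B\<^esub> v X2 [^]\<^bsub>B\<^esub> (2::nat) \<ominus>\<^bsub>B\<^esub> v X3 [^]\<^bsub>B\<^esub> (2::nat))"

definition Theta2 :: "'k::field \<Rightarrow> 'k \<Rightarrow> 'k \<Rightarrow> 'k free_alg set" where
  "Theta2 \<alpha> \<beta> \<gamma> = (let B = sklyanin_twist \<alpha> \<beta> \<gamma>; v = sk_gen \<alpha> \<beta> \<gamma>; s = sk_scalar \<alpha> \<beta> \<gamma> in
     v X1 [^]\<^bsub>B\<^esub> (2::nat)
       \<oplus>\<^bsub>B\<^esub> s ((1 + \<alpha>) / (1 - \<beta>)) \<otimes>\<^bsub>B\<^esub> v X2 [^]\<^bsub>B\<^esub> (2::nat)
       \<ominus>\<^bsub>B\<^esub> s ((1 - \<alpha>) / (1 + \<gamma>)) \<otimes>\<^bsub>B\<^esub> v X3 [^]\<^bsub>B\<^esub> (2::nat))"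

definition twist_subalgebra_gen ::
    "'k::field \<Rightarrow> 'k \<Rightarrow> 'k \<Rightarrow> 'k free_alg set set \<Rightarrow> 'k free_alg set set" where
  "twist_subalgebra_gen \<alpha> \<beta> \<gamma> S =
     generate_ring (sklyanin_twist \<alpha> \<beta> \<gamma>) (range (sk_scalar \<alpha> \<beta> \<gamma>) \<union> S)"

definition ring_centre :: "('a, 'r) ring_scheme \<Rightarrow> 'a set" where
  "ring_centre R = {z \<in> carrier R. \<forall>a\<in>carrier R. z \<otimes>\<^bsub>R\<^esub> a = a \<otimes>\<^bsub>R\<^esub> z}"

end

theory Submission imports Defs "HOL-Library.Product_Plus" begin

text \<open>
  A homogeneous element \<open>z\<close> of degree \<open>g\<close> in the grading by \<open>G\<close> is central in the twist iff in the
  Sklyanin algebra \<open>A\<close> it commutes with each generator up to the sign by which \<open>g\<close> acts on that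
  generator. So it suffices to show that such an element is a polynomial in the two central quadrics
  \<open>W1\<close>, \<open>W2\<close> of \<open>A\<close>, whose classes are combinations of \<open>\<Theta>\<^sub>1\<close> and \<open>\<Theta>\<^sub>2\<close>.

  Write \<open>z\<close> as a form of degree \<open>r\<close> in \<open>W1\<close>, \<open>W2\<close> with coefficients \<open>b\<^sub>k\<close> in \<open>A\<close> of degree \<open>m\<close>.
  If some \<open>b\<^sub>k\<close> with \<open>m > 0\<close> does not vanish on the elliptic curve, then the action of \<open>z\<close> on truncated line
  modules shows that \<open>\<sigma>\<^sup>m\<close> agrees with a translation by a 2-torsion point, so \<open>\<sigma>\<^sup>2\<^sup>m = 1\<close>, which contradicts
  the infinite order of \<open>\<sigma>\<close>. Hence all \<open>b\<^sub>k\<close> vanish on the curve. Forms vanishing there lie in the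
  ideal generated by \<open>W1\<close> and \<open>W2\<close>, and \<open>r\<close> can be increased until the coefficients are scalars.

  No geometry of elliptic curves is needed: the curve is used through the points of a plane model outside finite
  sets, and the automorphism is recovered there from the action on point modules.
\<close>

section \<open>Linear maps on the free algebra\<close>

text \<open>Two obstacles shape the proof. No basis of \<open>A\<close> is at hand: membership in
  the ideal \<open>J\<close> of relations is shown by explicit combinations and refuted by an action
  on a concrete module. And \<open>W1\<close>, \<open>W2\<close> annihilate the point modules of the
  curve, which therefore cannot see coefficients multiplied by them. On a line module the two
  quadrics act by scalars whose ratio varies with the line, and this separates the coefficients.

  The coordinates \<open>eA\<close>, \<open>eB\<close>, \<open>eC\<close>, \<open>eD\<close> turn
  the quadric y0^2 + y1^2 + y2^2 + y3^2 = 0 into the Segre quadric eA eD = eB eC. The elliptic curve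
  becomes a symmetric biquadratic curve in (u, v), and the translation becomes (u, v) -> (w, u),
  where w is the other root over u. The coefficients involve only \<alpha> and one further constant
  \<nu>, so every identity is polynomial and no theta functions occur.

  That forms vanishing on the curve lie in the ideal of \<open>W1\<close>, \<open>W2\<close> is
  classically a comparison of Hilbert series. Here it is a division argument: by the two linear
  forms through P and -P, and then by the single form through four points.\<close>

lemma Word_add: "Word u + Word v = Word (u @ v)"
  by (simp add: plus_word_def)

lemma single_Word_mult:
  "Poly_Mapping.single (Word u) a * Poly_Mapping.single (Word v) b
    = Poly_Mapping.single (Word (u @ v)) (a * b)"
  by (simp add: mult_single Word_add)

lemma fconst_single: "fconst c = Poly_Mapping.single (Word []) c"
  by (simp add: fconst_def zero_word_def)

lemma fconst_0 [simp]: "fconst 0 = 0"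
  by (simp add: fconst_def)

lemma fconst_1 [simp]: "fconst 1 = 1"
  by (simp add: fconst_def)

lemma fconst_add: "fconst (a + b) = fconst a + fconst b"
  by (simp add: fconst_def single_add)

lemma fconst_diff: "fconst (a - b) = fconst a - fconst b"
  by (simp add: fconst_def single_diff)

lemma fconst_uminus: "fconst (- a) = - fconst a"
  by (simp add: fconst_def single_uminus)

lemma fconst_mult: "fconst (a * b) = fconst a * fconst b"
  by (simp add: fconst_def mult_single)

lemma fconst_mult_single:
  "fconst c * Poly_Mapping.single (Word w) a = Poly_Mapping.single (Word w) (c * a)"
  by (simp add: fconst_single single_Word_mult)

lemma free_alg_sum_single:
  "f = (\<Sum>w\<in>Poly_Mapping.keys f. Poly_Mapping.single w (Poly_Mapping.lookup f w))"
proof (rule poly_mapping_eqI)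
  fix v
  have "Poly_Mapping.lookup (\<Sum>w\<in>Poly_Mapping.keys f. Poly_Mapping.single w (Poly_Mapping.lookup f w)) v
     = (\<Sum>w\<in>Poly_Mapping.keys f. if w = v then Poly_Mapping.lookup f w else 0)"
    unfolding lookup_sum by (intro sum.cong refl) (auto simp: lookup_single when_def)
  also have "\<dots> = Poly_Mapping.lookup f v"
    by (simp add: in_keys_iff)
  finally show "Poly_Mapping.lookup f v = Poly_Mapping.lookup (\<Sum>w\<in>Poly_Mapping.keys f. Poly_Mapping.single w (Poly_Mapping.lookup f w)) v"
    by simp
qed

lemma free_alg_induct [case_names zero add single]:
  assumes "P 0" and "\<And>f g. P f \<Longrightarrow> P g \<Longrightarrow> P (f + g)"
    and "\<And>c w. P (Poly_Mapping.single (Word w) c)"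
  shows "P (f :: 'k::field free_alg)"
proof -
  have "P (\<Sum>w\<in>W. Poly_Mapping.single w (Poly_Mapping.lookup f w))" if "finite W" for W
    using that
  proof (induction W)
    case (insert w W)
    then show ?case
      using assms(2)[OF assms(3)[of "letters w" "Poly_Mapping.lookup f w"] insert.IH] by simp
  qed (simp add: assms(1))
  then show ?thesis
    by (subst free_alg_sum_single) simp
qed

lemma fconst_commute: "f * fconst c = fconst c * f" for f :: "'k::field free_alg"
  by (induction f rule: free_alg_induct)
    (simp_all add: distrib_left distrib_right fconst_single single_Word_mult mult.commute)

lemma fconst_left_commute: "f * (fconst c * g) = fconst c * (f * g)" for f :: "'k::field free_alg"
  by (metis fconst_commute mult.assoc)

text \<open>Values at points and matrix coefficients of modules are all functionals of this kind, so
  their linearity is proved once.\<close>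

definition lin_fun :: "(gen list \<Rightarrow> 'k) \<Rightarrow> 'k::field free_alg \<Rightarrow> 'k" where
  "lin_fun \<phi> f = (\<Sum>w\<in>Poly_Mapping.keys f. Poly_Mapping.lookup f w * \<phi> (letters w))"

lemma lin_fun_superset:
  assumes "finite W" "Poly_Mapping.keys f \<subseteq> W"
  shows "lin_fun \<phi> f = (\<Sum>w\<in>W. Poly_Mapping.lookup f w * \<phi> (letters w))"
  unfolding lin_fun_def using assms
  by (intro sum.mono_neutral_left) (auto simp: in_keys_iff)

lemma lin_fun_0 [simp]: "lin_fun \<phi> 0 = 0"
  by (simp add: lin_fun_def)

lemma lin_fun_add: "lin_fun \<phi> (f + g) = lin_fun \<phi> f + lin_fun \<phi> g"
proof -
  let ?W = "Poly_Mapping.keys f \<union> Poly_Mapping.keys g"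
  have "Poly_Mapping.keys (f + g) \<subseteq> ?W" by (rule keys_add)
  then show ?thesis
    by (subst (1 2 3) lin_fun_superset[of ?W])
      (auto simp: lookup_add distrib_right sum.distrib)
qed

lemma lin_fun_single [simp]: "lin_fun \<phi> (Poly_Mapping.single (Word w) c) = c * \<phi> w"
  by (cases "c = 0") (simp_all add: lin_fun_def)

lemma lin_fun_fconst_mult: "lin_fun \<phi> (fconst c * f) = c * lin_fun \<phi> f"
  by (induction f rule: free_alg_induct)
    (simp_all add: distrib_left lin_fun_add fconst_mult_single)

lemma lin_fun_uminus: "lin_fun \<phi> (- f) = - lin_fun \<phi> f"
  using lin_fun_add[of \<phi> f "- f"] by (simp add: eq_neg_iff_add_eq_0 add.commute)

lemma lin_fun_diff: "lin_fun \<phi> (f - g) = lin_fun \<phi> f - lin_fun \<phi> g"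
  using lin_fun_add[of \<phi> f "- g"] by (simp add: lin_fun_uminus)

lemma lin_fun_sum: "lin_fun \<phi> (\<Sum>i\<in>S. f i) = (\<Sum>i\<in>S. lin_fun \<phi> (f i))"
  by (induction S rule: infinite_finite_induct) (simp_all add: lin_fun_add)

lemma lin_fun_lincomb:
  "lin_fun (\<lambda>w. c * \<phi> w + d * \<psi> w) f = c * lin_fun \<phi> f + d * lin_fun \<psi> f"
  by (simp add: lin_fun_def sum.distrib algebra_simps sum_distrib_left)

text \<open>The operator that multiplies the coefficient of each word \<open>w\<close> by \<open>q w\<close>: both the projections
  onto homogeneous components and the sign automorphisms are of this form.\<close>

definition diag_op :: "(gen list \<Rightarrow> 'k) \<Rightarrow> 'k::field free_alg \<Rightarrow> 'k free_alg" where
  "diag_op q f = Poly_Mapping.mapp (\<lambda>w c. q (letters w) * c) f"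

lemma lookup_diag_op: "Poly_Mapping.lookup (diag_op q f) w = q (letters w) * Poly_Mapping.lookup f w"
  by (auto simp: diag_op_def lookup_mapp when_def in_keys_iff)

lemma diag_op_0 [simp]: "diag_op q 0 = 0"
  by (rule poly_mapping_eqI) (simp add: lookup_diag_op)

lemma diag_op_add: "diag_op q (f + g) = diag_op q f + diag_op q g"
  by (rule poly_mapping_eqI) (simp add: lookup_diag_op lookup_add distrib_left)

lemma diag_op_diff: "diag_op q (f - g) = diag_op q f - diag_op q g"
  by (rule poly_mapping_eqI) (simp add: lookup_diag_op lookup_minus right_diff_distrib)

lemma diag_op_sum: "diag_op q (\<Sum>i\<in>S. f i) = (\<Sum>i\<in>S. diag_op q (f i))"
  by (induction S rule: infinite_finite_induct) (simp_all add: diag_op_add)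

lemma diag_op_single:
  "diag_op q (Poly_Mapping.single (Word w) c) = Poly_Mapping.single (Word w) (q w * c)"
  by (rule poly_mapping_eqI) (auto simp: lookup_diag_op lookup_single when_def)

lemma diag_op_fconst_mult: "diag_op q (fconst c * f) = fconst c * diag_op q f"
  by (induction f rule: free_alg_induct)
    (simp_all add: distrib_left diag_op_add fconst_mult_single diag_op_single mult.left_commute)

lemma diag_op_comp: "diag_op p (diag_op q f) = diag_op (\<lambda>w. p w * q w) f"
  by (rule poly_mapping_eqI) (simp add: lookup_diag_op mult.assoc)

lemma keys_diag_op: "Poly_Mapping.keys (diag_op q f) = {w \<in> Poly_Mapping.keys f. q (letters w) \<noteq> 0}"
  by (auto simp: in_keys_iff lookup_diag_op)

lemma diag_op_cong_on:
  "(\<And>w. w \<in> Poly_Mapping.keys f \<Longrightarrow> p (letters w) = q (letters w)) \<Longrightarrow> diag_op p f = diag_op q f"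
  by (rule poly_mapping_eqI) (metis lookup_diag_op in_keys_iff mult_zero_right)

lemma diag_op_ident_on:
  "(\<And>w. w \<in> Poly_Mapping.keys f \<Longrightarrow> q (letters w) = c) \<Longrightarrow> diag_op q f = fconst c * f"
proof -
  assume a: "\<And>w. w \<in> Poly_Mapping.keys f \<Longrightarrow> q (letters w) = c"
  have "diag_op (\<lambda>_. c) f = fconst c * f"
    by (induction f rule: free_alg_induct)
      (simp_all add: distrib_left diag_op_add fconst_mult_single diag_op_single)
  with diag_op_cong_on[of f q "\<lambda>_. c"] a show ?thesis by simp
qed

lemma diag_op_single_mult:
  "diag_op q (Poly_Mapping.single (Word u) a * f)
    = Poly_Mapping.single (Word u) a * diag_op (\<lambda>v. q (u @ v)) f"
  by (induction f rule: free_alg_induct)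
    (simp_all add: distrib_left diag_op_add single_Word_mult diag_op_single mult_ac)

lemma diag_op_mult_single:
  "diag_op q (f * Poly_Mapping.single (Word v) a)
    = diag_op (\<lambda>u. q (u @ v)) f * Poly_Mapping.single (Word v) a"
  by (induction f rule: free_alg_induct)
    (simp_all add: distrib_right diag_op_add single_Word_mult diag_op_single mult_ac)

lemma diag_op_mult_left:
  assumes "\<And>u v. u \<in> Poly_Mapping.keys x \<Longrightarrow> q (letters u @ v) = q' v"
  shows "diag_op q (x * f) = x * diag_op q' f"
proof -
  let ?K = "Poly_Mapping.keys x"
  have "diag_op q ((\<Sum>u\<in>?K. Poly_Mapping.single u (Poly_Mapping.lookup x u)) * f)
      = (\<Sum>u\<in>?K. Poly_Mapping.single u (Poly_Mapping.lookup x u)) * diag_op q' f"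
    unfolding sum_distrib_right diag_op_sum
  proof (intro sum.cong refl)
    fix u assume "u \<in> ?K"
    then have "(\<lambda>v. q (letters u @ v)) = q'" using assms by auto
    then show "diag_op q (Poly_Mapping.single u (Poly_Mapping.lookup x u) * f)
        = Poly_Mapping.single u (Poly_Mapping.lookup x u) * diag_op q' f"
      using diag_op_single_mult[of q "letters u" "Poly_Mapping.lookup x u" f] by simp
  qed
  then show ?thesis
    using free_alg_sum_single[of x] by simp
qed

lemma diag_op_mult_right:
  assumes "\<And>u v. v \<in> Poly_Mapping.keys x \<Longrightarrow> q (u @ letters v) = q' u"
  shows "diag_op q (f * x) = diag_op q' f * x"
proof -
  let ?K = "Poly_Mapping.keys x"
  have "diag_op q (f * (\<Sum>u\<in>?K. Poly_Mapping.single u (Poly_Mapping.lookup x u)))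
      = diag_op q' f * (\<Sum>u\<in>?K. Poly_Mapping.single u (Poly_Mapping.lookup x u))"
    unfolding sum_distrib_left diag_op_sum
  proof (intro sum.cong refl)
    fix u assume "u \<in> ?K"
    then have "(\<lambda>v. q (v @ letters u)) = q'" using assms by auto
    then show "diag_op q (f * Poly_Mapping.single u (Poly_Mapping.lookup x u))
        = diag_op q' f * Poly_Mapping.single u (Poly_Mapping.lookup x u)"
      using diag_op_mult_single[of q f "letters u" "Poly_Mapping.lookup x u"] by simp
  qed
  then show ?thesis
    using free_alg_sum_single[of x] by simp
qed

lemma diag_op_scale: "diag_op (\<lambda>v. c * q v) f = fconst c * diag_op q f"
  by (induction f rule: free_alg_induct)
    (simp_all add: distrib_left diag_op_add fconst_mult_single diag_op_single mult.assoc)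

lemma diag_op_mult_char:
  assumes "\<And>u v. q (u @ v) = q u * q v"
  shows "diag_op q (f * g) = diag_op q f * diag_op q g"
proof (induction f rule: free_alg_induct)
  case (single c w)
  then show ?case
    by (simp add: diag_op_single_mult assms diag_op_single diag_op_scale fconst_left_commute mult.assoc
        flip: fconst_mult_single)
qed (simp_all add: distrib_right diag_op_add)

section \<open>Homogeneous components\<close>

definition hom_alg :: "nat \<Rightarrow> 'k::field free_alg set" where
  "hom_alg n = {f. \<forall>w\<in>Poly_Mapping.keys f. length (letters w) = n}"

definition len_part :: "nat \<Rightarrow> 'k::field free_alg \<Rightarrow> 'k free_alg" where
  "len_part n = diag_op (\<lambda>w. if length w = n then 1 else 0)"

lemma len_part_in: "len_part n f \<in> hom_alg n"
  by (auto simp: hom_alg_def len_part_def keys_diag_op split: if_splits)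

lemma len_part_id: "f \<in> hom_alg n \<Longrightarrow> len_part n f = f"
  using diag_op_ident_on[of f "\<lambda>w. if length w = n then 1 else 0" 1]
  by (auto simp: hom_alg_def len_part_def)

lemmas len_part_linear = diag_op_add diag_op_diff diag_op_sum diag_op_fconst_mult

lemma len_part_add: "len_part n (f + g) = len_part n f + len_part n g"
  and len_part_diff: "len_part n (f - g) = len_part n f - len_part n g"
  and len_part_sum: "len_part n (\<Sum>i\<in>S. h i) = (\<Sum>i\<in>S. len_part n (h i))"
  and len_part_fconst_mult: "len_part n (fconst c * f) = fconst c * len_part n f"
  by (simp_all add: len_part_def len_part_linear)

lemma len_part_mult_left: "x \<in> hom_alg m \<Longrightarrow> len_part n (x * f) = (if m \<le> n then x * len_part (n - m) f else 0)"
proof (cases "m \<le> n")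
  case True
  assume "x \<in> hom_alg m"
  then have "len_part n (x * f) = x * len_part (n - m) f"
    unfolding len_part_def using True by (intro diag_op_mult_left) (auto simp: hom_alg_def)
  then show ?thesis using True by simp
next
  case False
  assume "x \<in> hom_alg m"
  then have "len_part n (x * f) = x * diag_op (\<lambda>_. 0) f"
    unfolding len_part_def using False by (intro diag_op_mult_left) (auto simp: hom_alg_def)
  then show ?thesis using False diag_op_ident_on[of f "\<lambda>_. 0" 0] by simp
qed

lemma len_part_mult_right: "x \<in> hom_alg m \<Longrightarrow> len_part n (f * x) = (if m \<le> n then len_part (n - m) f * x else 0)"
proof (cases "m \<le> n")
  case True
  assume "x \<in> hom_alg m"
  then have "len_part n (f * x) = len_part (n - m) f * x"
    unfolding len_part_def using True by (intro diag_op_mult_right) (auto simp: hom_alg_def)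
  then show ?thesis using True by simp
next
  case False
  assume "x \<in> hom_alg m"
  then have "len_part n (f * x) = diag_op (\<lambda>_. 0) f * x"
    unfolding len_part_def using False by (intro diag_op_mult_right) (auto simp: hom_alg_def)
  then show ?thesis using False diag_op_ident_on[of f "\<lambda>_. 0" 0] by simp
qed

lemma len_part_sum_all:
  assumes "\<And>w. w \<in> Poly_Mapping.keys f \<Longrightarrow> length (letters w) \<le> N"
  shows "f = (\<Sum>n\<le>N. len_part n f)"
proof (rule poly_mapping_eqI)
  fix w
  show "Poly_Mapping.lookup f w = Poly_Mapping.lookup (\<Sum>n\<le>N. len_part n f) w"
    using assms[of w]
    by (cases "w \<in> Poly_Mapping.keys f")
      (auto simp: lookup_sum len_part_def lookup_diag_op if_distrib[of "\<lambda>x. x * _"] in_keys_iff cong: if_cong)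
qed

lemma hom_alg_0 [simp]: "0 \<in> hom_alg n"
  by (simp add: hom_alg_def)

lemma hom_alg_add: "f \<in> hom_alg n \<Longrightarrow> g \<in> hom_alg n \<Longrightarrow> f + g \<in> hom_alg n"
  using keys_add[of f g] by (fastforce simp: hom_alg_def)

lemma hom_alg_uminus: "f \<in> hom_alg n \<Longrightarrow> - f \<in> hom_alg n"
  by (simp add: hom_alg_def in_keys_iff)

lemma hom_alg_diff: "f \<in> hom_alg n \<Longrightarrow> g \<in> hom_alg n \<Longrightarrow> f - g \<in> hom_alg n"
  using hom_alg_add[of f n "- g"] by (simp add: hom_alg_uminus)

lemma hom_alg_sum: "(\<And>i. i \<in> S \<Longrightarrow> f i \<in> hom_alg n) \<Longrightarrow> (\<Sum>i\<in>S. f i) \<in> hom_alg n"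
  by (induction S rule: infinite_finite_induct) (simp_all add: hom_alg_add)

lemma hom_alg_mult: "f \<in> hom_alg m \<Longrightarrow> g \<in> hom_alg n \<Longrightarrow> f * g \<in> hom_alg (m + n)"
  using keys_mult[of f g] by (fastforce simp: hom_alg_def plus_word_def)

lemma hom_alg_mult': "f \<in> hom_alg m \<Longrightarrow> g \<in> hom_alg n \<Longrightarrow> l = m + n \<Longrightarrow> f * g \<in> hom_alg l"
  using hom_alg_mult by blast

lemma hom_alg_fconst: "fconst c \<in> hom_alg 0"
  by (simp add: hom_alg_def fconst_single)

lemma hom_alg_fgen: "fgen i \<in> hom_alg 1"
  by (simp add: hom_alg_def fgen_def)

lemma hom_alg_fconst_mult: "f \<in> hom_alg n \<Longrightarrow> fconst c * f \<in> hom_alg n"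
  using hom_alg_mult[OF hom_alg_fconst, of f n c] by simp

lemma hom_alg_single: "length w = n \<Longrightarrow> Poly_Mapping.single (Word w) c \<in> hom_alg n"
  by (simp add: hom_alg_def)

lemma hom_alg_induct [consumes 1, case_names zero add single]:
  assumes "f \<in> hom_alg n" "P 0"
    and "\<And>f g. f \<in> hom_alg n \<Longrightarrow> g \<in> hom_alg n \<Longrightarrow> P f \<Longrightarrow> P g \<Longrightarrow> P (f + g)"
    and "\<And>c w. length w = n \<Longrightarrow> P (Poly_Mapping.single (Word w) c)"
  shows "P f"
proof -
  have "P (len_part n f)"
  proof (induction f rule: free_alg_induct)
    case zero
    then show ?case using assms(2) by (simp add: len_part_def)
  next
    case (add f g)
    then show ?case by (auto simp: len_part_add intro: assms(3) len_part_in)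
  next
    case (single c w)
    then show ?case
      using assms(2) assms(4)[of w c] by (auto simp: len_part_def diag_op_single)
  qed
  then show ?thesis
    using assms(1) by (simp add: len_part_id)
qed

lemma hom_alg_0_fconst: "f \<in> hom_alg 0 \<Longrightarrow> \<exists>c. f = fconst c"
proof (induction rule: hom_alg_induct)
  case zero
  show ?case by (metis fconst_0)
next
  case (add f g)
  then show ?case by (metis fconst_add)
next
  case (single c w)
  then show ?case by (metis fconst_single length_0_conv)
qed

lemma UNIV_gen_sum: "(\<Sum>i\<in>UNIV. f i) = f X0 + f X1 + f X2 + f X3"
  by (simp add: UNIV_gen add.assoc)

lemma hom_alg_Suc_left:
  assumes "f \<in> hom_alg (Suc n)"
  shows "\<exists>h. (\<forall>i. h i \<in> hom_alg n) \<and> f = (\<Sum>i\<in>UNIV. fgen i * h i)"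
  using assms
proof (induction rule: hom_alg_induct)
  case zero
  show ?case by (rule exI[of _ "\<lambda>_. 0"]) simp
next
  case (add f g)
  then obtain h h' where "\<forall>i. h i \<in> hom_alg n" "f = (\<Sum>i\<in>UNIV. fgen i * h i)"
     "\<forall>i. h' i \<in> hom_alg n" "g = (\<Sum>i\<in>UNIV. fgen i * h' i)" by blast
  then show ?case
    by (intro exI[of _ "\<lambda>i. h i + h' i"]) (auto simp: hom_alg_add distrib_left sum.distrib)
next
  case (single c w)
  then obtain x v where w: "w = x # v" "length v = n" by (cases w) auto
  have "Poly_Mapping.single (Word w) c = fgen x * Poly_Mapping.single (Word v) c"
    by (simp add: fgen_def single_Word_mult w)
  also have "\<dots> = (\<Sum>i\<in>UNIV. fgen i * (if i = x then Poly_Mapping.single (Word v) c else 0))"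
    by (simp add: if_distrib cong: if_cong)
  finally show ?case
    using w by (intro exI[of _ "\<lambda>i. if i = x then Poly_Mapping.single (Word v) c else 0"])
      (auto simp: hom_alg_single)
qed

section \<open>Two-sided ideals\<close>

text \<open>Adding one summand \<open>a * s * b\<close> at a time gives an induction on membership
  with a single step, in which \<open>s\<close> is still an original generator.\<close>

inductive_set ideal_gen :: "'a::ring_1 set \<Rightarrow> 'a set" for S where
  zero: "0 \<in> ideal_gen S"
| add: "s \<in> S \<Longrightarrow> x \<in> ideal_gen S \<Longrightarrow> a * s * b + x \<in> ideal_gen S"

lemma ideal_gen_add: "x \<in> ideal_gen S \<Longrightarrow> y \<in> ideal_gen S \<Longrightarrow> x + y \<in> ideal_gen S"
  by (induction rule: ideal_gen.induct) (auto simp: add.assoc intro: ideal_gen.intros)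

lemma ideal_gen_lmult: "x \<in> ideal_gen S \<Longrightarrow> y * x \<in> ideal_gen S"
  by (induction rule: ideal_gen.induct)
    (auto simp: distrib_left mult.assoc[symmetric] intro: ideal_gen.intros)

lemma ideal_gen_rmult: "x \<in> ideal_gen S \<Longrightarrow> x * y \<in> ideal_gen S"
proof (induction rule: ideal_gen.induct)
  case (add s x a b)
  then show ?case
    using ideal_gen.add[of s S "x * y" a "b * y"] by (simp add: distrib_right mult.assoc)
qed (simp add: ideal_gen.zero)

lemma ideal_gen_uminus: "x \<in> ideal_gen S \<Longrightarrow> - x \<in> ideal_gen S"
  using ideal_gen_lmult[of x S "-1"] by simp

lemma ideal_gen_diff: "x \<in> ideal_gen S \<Longrightarrow> y \<in> ideal_gen S \<Longrightarrow> x - y \<in> ideal_gen S"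
  using ideal_gen_add[of x S "- y"] by (simp add: ideal_gen_uminus)

lemma ideal_gen_incl: "x \<in> S \<Longrightarrow> x \<in> ideal_gen S"
  using ideal_gen.add[of x S 0 1 1] by (simp add: ideal_gen.zero)

lemma ideal_gen_sum: "(\<And>i. i \<in> T \<Longrightarrow> f i \<in> ideal_gen S) \<Longrightarrow> (\<Sum>i\<in>T. f i) \<in> ideal_gen S"
  by (induction T rule: infinite_finite_induct) (simp_all add: ideal_gen_add ideal_gen.zero)

section \<open>Comparison with the ideals of the ring record\<close>

lemma ring_ring_of_type_algebra: "ring (ring_of_type_algebra :: 'a::ring_1 ring)"
proof -
  have "\<exists>y. x + y = 0" for x :: 'a
    using add.right_inverse by blast
  then show ?thesis
    unfolding ring_of_type_algebra_def using add.right_inverse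
    by unfold_locales (auto simp: algebra_simps Units_def)
qed

lemma ring_of_type_algebra_simps [simp]:
  "carrier ring_of_type_algebra = UNIV" "monoid.mult ring_of_type_algebra = (*)"
  "monoid.one ring_of_type_algebra = 1" "ring.zero ring_of_type_algebra = 0"
  "ring.add ring_of_type_algebra = (+)"
  by (simp_all add: ring_of_type_algebra_def)

lemma a_inv_ring_of_type_algebra [simp]:
  "a_inv (ring_of_type_algebra :: 'a::ring_1 ring) x = - x"
proof -
  interpret ring "ring_of_type_algebra :: 'a ring" by (rule ring_ring_of_type_algebra)
  show ?thesis
    by (rule minus_equality) simp_all
qed

lemma ideal_ideal_gen: "ideal (ideal_gen S) (ring_of_type_algebra :: 'a::ring_1 ring)"
proof (rule idealI)
  show "ring (ring_of_type_algebra :: 'a::ring_1 ring)"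
    by (rule ring_ring_of_type_algebra)
  then interpret ring "ring_of_type_algebra :: 'a ring" .
  show "subgroup (ideal_gen S) (add_monoid (ring_of_type_algebra :: 'a ring))"
    by (rule add.subgroupI) 
      (auto intro: ideal_gen.zero ideal_gen_add ideal_gen_uminus simp flip: a_inv_def)
qed (auto intro: ideal_gen_lmult ideal_gen_rmult)

lemma genideal_eq_ideal_gen: "Idl\<^bsub>ring_of_type_algebra\<^esub> S = ideal_gen S"
proof
  show "Idl\<^bsub>ring_of_type_algebra\<^esub> S \<subseteq> ideal_gen S"
    unfolding genideal_def using ideal_ideal_gen[of S] ideal_gen_incl[of _ S] by blast
next
  have "x \<in> I" if "ideal I ring_of_type_algebra" "S \<subseteq> I" "x \<in> ideal_gen S" for I x
  proof -
    interpret ideal I ring_of_type_algebra by fact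
    from that(3) show ?thesis
    proof induction
      case zero
      show ?case using additive_subgroup.zero_closed[OF is_additive_subgroup] by simp
    next
      case (add s x a b)
      have "a * s * b \<in> I"
        using I_r_closed[OF I_l_closed[of s a], of b] add that(2) by auto
      then show ?case
        using additive_subgroup.a_closed[OF is_additive_subgroup, of "a * s * b" x] add by simp
    qed
  qed
  then show "ideal_gen S \<subseteq> Idl\<^bsub>ring_of_type_algebra\<^esub> S"
    by (auto simp: genideal_def)
qed

section \<open>Representations on function spaces\<close>

definition op_linear :: "('g \<Rightarrow> ('s \<Rightarrow> 'k::field) \<Rightarrow> 's \<Rightarrow> 'k) \<Rightarrow> bool" where
  "op_linear T \<longleftrightarrow> (\<forall>x F G c d. T x (\<lambda>s. c * F s + d * G s) = (\<lambda>s. c * T x F s + d * T x G s))"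

text \<open>With \<open>foldr\<close> the first letter acts last, so products become compositions of
  operators. Evaluation at a base state then gives the transpose of a right module: reading a word
  from left to right follows a path of states.\<close>

definition act :: "(gen \<Rightarrow> ('s \<Rightarrow> 'k) \<Rightarrow> 's \<Rightarrow> 'k) \<Rightarrow> 'k::field free_alg \<Rightarrow> ('s \<Rightarrow> 'k) \<Rightarrow> 's \<Rightarrow> 'k" where
  "act T f F s = lin_fun (\<lambda>w. foldr T w F s) f"

lemma foldr_op_linear:
  assumes "op_linear T"
  shows "foldr T w (\<lambda>s. c * F s + d * G s) = (\<lambda>s. c * foldr T w F s + d * foldr T w G s)"
  using assms by (induction w) (simp_all add: op_linear_def)

lemma foldr_op_scale:
  assumes "op_linear T"
  shows "foldr T w (\<lambda>s. c * F s) = (\<lambda>s. c * foldr T w F s)"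
  using foldr_op_linear[OF assms, of w c F 0 F] by simp

lemma act_add: "act T (f + g) F s = act T f F s + act T g F s"
  by (simp add: act_def lin_fun_add)

lemma act_diff: "act T (f - g) F s = act T f F s - act T g F s"
  by (simp add: act_def lin_fun_diff)

lemma act_0: "act T 0 F s = 0"
  by (simp add: act_def)

lemma act_sum: "act T (\<Sum>i\<in>S. f i) F s = (\<Sum>i\<in>S. act T (f i) F s)"
  by (simp add: act_def lin_fun_sum)

lemma act_fconst_mult: "act T (fconst c * f) F s = c * act T f F s"
  by (simp add: act_def lin_fun_fconst_mult)

lemma act_single: "act T (Poly_Mapping.single (Word w) c) F = (\<lambda>s. c * foldr T w F s)"
  by (rule ext) (simp add: act_def)

lemma act_fgen: "act T (fgen x) F = T x F"
  by (simp add: fgen_def act_single)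

lemma act_fun_linear:
  assumes "op_linear T"
  shows "act T f (\<lambda>s. c * F s + d * G s) = (\<lambda>s. c * act T f F s + d * act T f G s)"
  by (rule ext) (simp add: act_def foldr_op_linear[OF assms] lin_fun_lincomb)

lemma act_fun_zero:
  assumes "op_linear T"
  shows "act T f (\<lambda>_. 0) = (\<lambda>_. 0)"
  using act_fun_linear[OF assms, of f 0 "\<lambda>_. 0" 0 "\<lambda>_. 0"] by simp

lemma act_mult:
  assumes "op_linear T"
  shows "act T (f * g) F = act T f (act T g F)"
proof (induction f rule: free_alg_induct)
  case zero
  show ?case by (simp add: act_def)
next
  case (add f h)
  show ?case by (rule ext) (simp add: distrib_right act_add add.IH)
next
  case (single c u)
  show ?case
  proof (induction g rule: free_alg_induct)
    case zero
    have "act T 0 F = (\<lambda>_. 0)" by (rule ext) (simp add: act_0)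
    then show ?case by (simp add: act_fun_zero[OF assms])
  next
    case (add f h)
    have "act T (f + h) F = (\<lambda>s. 1 * act T f F s + 1 * act T h F s)"
      by (rule ext) (simp add: act_add)
    then have eq: "act T (Poly_Mapping.single (Word u) c) (act T (f + h) F)
      = (\<lambda>s. 1 * act T (Poly_Mapping.single (Word u) c) (act T f F) s
           + 1 * act T (Poly_Mapping.single (Word u) c) (act T h F) s)"
      by (simp only: act_fun_linear[OF assms])
    show ?case
      unfolding eq by (rule ext) (simp add: distrib_left act_add add.IH)
  next
    case (single d v)
    show ?case
      by (rule ext) (simp add: single_Word_mult act_single foldr_op_scale[OF assms] mult_ac)
  qed
qed

lemma act_ideal_gen:
  assumes "op_linear T" "\<And>r F. r \<in> S \<Longrightarrow> act T r F = (\<lambda>_. 0)" "x \<in> ideal_gen S"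
  shows "act T x F = (\<lambda>_. 0)"
  using assms(3)
proof induction
  case zero
  show ?case by (simp add: act_def)
next
  case (add s x a b)
  then show ?case
    by (intro ext) (simp add: act_add act_mult[OF assms(1)] assms(2) act_fun_zero[OF assms(1)])
qed

section \<open>Evaluation of forms of degree one and two\<close>

definition lin_val :: "(gen \<Rightarrow> 'k) \<Rightarrow> 'k::field free_alg \<Rightarrow> 'k" where
  "lin_val y f = lin_fun (\<lambda>w. case w of [x] \<Rightarrow> y x | _ \<Rightarrow> 0) f"

definition quad_val :: "(gen \<Rightarrow> 'k) \<Rightarrow> (gen \<Rightarrow> 'k) \<Rightarrow> 'k::field free_alg \<Rightarrow> 'k" where
  "quad_val y y' f = lin_fun (\<lambda>w. case w of [x, x'] \<Rightarrow> y x * y' x' | _ \<Rightarrow> 0) f"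

lemma lin_val_linear:
  "lin_val y (f + g) = lin_val y f + lin_val y g"
  "lin_val y (f - g) = lin_val y f - lin_val y g"
  "lin_val y (- f) = - lin_val y f"
  "lin_val y (fconst c * f) = c * lin_val y f"
  "lin_val y 0 = 0"
  by (simp_all add: lin_val_def lin_fun_add lin_fun_diff lin_fun_uminus lin_fun_fconst_mult)

lemma lin_val_sum: "lin_val y (\<Sum>i\<in>S. f i) = (\<Sum>i\<in>S. lin_val y (f i))"
  by (simp add: lin_val_def lin_fun_sum)

lemma quad_val_linear:
  "quad_val y y' (f + g) = quad_val y y' f + quad_val y y' g"
  "quad_val y y' (f - g) = quad_val y y' f - quad_val y y' g"
  "quad_val y y' (- f) = - quad_val y y' f"
  "quad_val y y' (fconst c * f) = c * quad_val y y' f"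
  by (simp_all add: quad_val_def lin_fun_add lin_fun_diff lin_fun_uminus lin_fun_fconst_mult)

lemma lin_val_fgen: "lin_val y (fgen x) = y x"
  by (simp add: lin_val_def fgen_def)

lemma hom_alg_1_cases:
  assumes "f \<in> hom_alg 1"
  obtains c where "f = (\<Sum>i\<in>UNIV. fconst (c i) * fgen i)"
proof -
  obtain h where h: "\<And>i. h i \<in> hom_alg 0" "f = (\<Sum>i\<in>UNIV. fgen i * h i)"
    using hom_alg_Suc_left[of f 0] assms by auto
  have "\<forall>i. \<exists>c. h i = fconst c"
    using h(1) hom_alg_0_fconst by blast
  then obtain c where "\<forall>i. h i = fconst (c i)" by (rule choice[THEN exE])
  with h(2) have "f = (\<Sum>i\<in>UNIV. fconst (c i) * fgen i)" by (simp add: fconst_commute)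
  then show ?thesis by (rule that)
qed

lemma quad_val_mult:
  assumes "f \<in> hom_alg 1" "g \<in> hom_alg 1"
  shows "quad_val y y' (f * g) = lin_val y f * lin_val y' g"
  using assms(1)
proof (induction f rule: hom_alg_induct)
  case zero
  show ?case by (simp add: lin_val_def quad_val_def)
next
  case (add f h)
  then show ?case by (simp add: distrib_right quad_val_linear lin_val_linear)
next
  case (single c u)
  from assms(2) show ?case
  proof (induction g rule: hom_alg_induct)
    case zero
    show ?case by (simp add: lin_val_def quad_val_def)
  next
    case (add f h)
    then show ?case by (simp add: distrib_left quad_val_linear lin_val_linear)
  next
    case (single d v)
    obtain x x' where "u = [x]" "v = [x']"
      using \<open>length u = 1\<close> \<open>length v = 1\<close> by (auto simp: length_Suc_conv)
    then show ?case by (simp add: single_Word_mult lin_val_def quad_val_def)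
  qed
qed

text \<open>Two letters lead from \<open>s\<close> to \<open>s11\<close>, \<open>s12\<close> or
  \<open>s22\<close>, and \<open>s12\<close> is reached by two routes whose contributions add up. On
  line modules this middle coefficient is the one that needs a cancellation.\<close>

lemma act_quad:
  assumes "op_linear T" "f \<in> hom_alg 2"
    and "\<And>x F. T x F s = y x * F s1 + z x * F s2"
    and "\<And>x F. T x F s1 = y1 x * F s11 + z1 x * F s12"
    and "\<And>x F. T x F s2 = y2 x * F s12 + z2 x * F s22"
  shows "act T f F s = quad_val y y1 f * F s11
     + (quad_val y z1 f + quad_val z y2 f) * F s12 + quad_val z z2 f * F s22"
  using assms(2)
proof (induction f rule: hom_alg_induct)
  case zero
  show ?case by (simp add: act_def quad_val_def)
next
  case (add f g)
  then show ?case by (simp add: act_add quad_val_linear algebra_simps)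
next
  case (single c w)
  then obtain x x' where w: "w = [x, x']"
    using \<open>length w = 2\<close> by (auto simp: length_Suc_conv numeral_2_eq_2)
  show ?case
    by (simp add: w act_single quad_val_def assms(3-5) algebra_simps)
qed

text \<open>Indicator vectors recover the coefficients, so an identity between noncommutative
  quadratic forms is reduced to a commutative polynomial identity in the entries of \<open>y\<close>
  and \<open>y'\<close>.\<close>

lemma quad_ext:
  assumes "f \<in> hom_alg 2" "g \<in> hom_alg 2" "\<And>y y'. quad_val y y' f = quad_val y y' g"
  shows "f = g"
proof (rule poly_mapping_eqI)
  have *: "quad_val (\<lambda>i. if i = x then 1 else 0) (\<lambda>i. if i = x' then 1 else 0) h
      = Poly_Mapping.lookup h (Word [x, x'])" if "h \<in> hom_alg 2" for h :: "'a free_alg" and x x'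
    using that
  proof (induction h rule: hom_alg_induct)
    case zero
    show ?case by (simp add: quad_val_def)
  next
    case (add f g)
    then show ?case by (simp add: quad_val_linear lookup_add)
  next
    case (single c w)
    obtain i j where "w = [i, j]"
      using \<open>length w = 2\<close> by (auto simp: length_Suc_conv numeral_2_eq_2)
    then show ?case by (auto simp: quad_val_def lookup_single when_def)
  qed
  fix w
  show "Poly_Mapping.lookup f w = Poly_Mapping.lookup g w"
  proof (cases "length (letters w) = 2")
    case True
    then obtain x x' where "letters w = [x, x']"
      by (auto simp: length_Suc_conv numeral_2_eq_2)
    then have "w = Word [x, x']" by (cases w) simp
    then show ?thesis using *[OF assms(1)] *[OF assms(2)] assms(3) by metis
  next
    case False
    then have "w \<notin> Poly_Mapping.keys f" "w \<notin> Poly_Mapping.keys g"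
      using assms(1,2) by (auto simp: hom_alg_def)
    then show ?thesis by (simp add: in_keys_iff)
  qed
qed

section \<open>The Sklyanin algebra in matrix coordinates\<close>

text \<open>The relations of x0, x2 and of x0, x3 enter through the ratios 2(1 - \<beta>)/(1 +
  \<beta>) and 2(1 + \<gamma>)/(1 - \<gamma>). The constant \<nu> writes them as \<nu>(1 + \<alpha>)
  and \<nu>(1 - \<alpha>). One \<nu> serves both because the equation between the parameters is
  equivalent to (1 + \<alpha>)(1 + \<beta>)(1 + \<gamma>) = (1 - \<alpha>)(1 - \<beta>)(1 -
  \<gamma>), as 2 is invertible.\<close>

locale sklyanin_setup =
  fixes \<alpha> \<beta> \<gamma> \<nu> \<iota> :: "'k::alg_closed_field"
  assumes two_neq_0: "(2::'k) \<noteq> 0"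
    and params: "\<alpha> + \<beta> + \<gamma> + \<alpha> * \<beta> * \<gamma> = 0"
    and \<alpha>_neq: "\<alpha> \<noteq> 0" "1 - \<alpha> \<noteq> 0" "1 + \<alpha> \<noteq> 0"
    and \<beta>_neq: "\<beta> \<noteq> 0" "1 - \<beta> \<noteq> 0" "1 + \<beta> \<noteq> 0"
    and \<gamma>_neq: "\<gamma> \<noteq> 0" "1 - \<gamma> \<noteq> 0" "1 + \<gamma> \<noteq> 0"
    and i_square: "\<iota> * \<iota> = - 1"
    and \<nu>_eq: "\<nu> * ((1 + \<alpha>) * (1 + \<beta>)) = 2 * (1 - \<beta>)"
begin

lemma \<nu>_eq': "\<nu> * ((1 - \<alpha>) * (1 - \<gamma>)) = 2 * (1 + \<gamma>)"
proof -
  have "(1 + \<alpha>) * (1 + \<beta>) * (\<nu> * ((1 - \<alpha>) * (1 - \<gamma>))) = (1 - \<alpha>) * (1 - \<gamma>) * (\<nu> * ((1 + \<alpha>) * (1 + \<beta>)))"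
    by (simp add: mult_ac)
  also have "\<dots> = (1 - \<alpha>) * (1 - \<gamma>) * (2 * (1 - \<beta>))"
    by (simp only: \<nu>_eq)
  also have "\<dots> = (1 + \<alpha>) * (1 + \<beta>) * (2 * (1 + \<gamma>)) - 4 * (\<alpha> + \<beta> + \<gamma> + \<alpha> * \<beta> * \<gamma>)"
    by (simp add: algebra_simps)
  also have "\<dots> = (1 + \<alpha>) * (1 + \<beta>) * (2 * (1 + \<gamma>))"
    by (simp add: params)
  finally show ?thesis
    using \<alpha>_neq \<beta>_neq by simp
qed

lemma \<nu>_neq: "\<nu> \<noteq> 0"
  using \<nu>_eq \<beta>_neq two_neq_0 by auto

lemma i_square': "\<iota> * (\<iota> * x) = - x"
  by (simp add: i_square flip: mult.assoc)

lemmas i_simps = algebra_simps i_square i_square'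

abbreviation J :: "'k free_alg set" where
  "J \<equiv> ideal_gen (sklyanin_rels \<alpha> \<beta> \<gamma>)"

text \<open>For commuting coordinates \<open>eA * eD - eB * eC\<close> is the sum of the four
  squares. The first quadric through the curve is thus a determinant and has two rulings, whose
  parameters are the coordinates u and v of \<open>pt\<close>.\<close>

definition eA :: "'k free_alg" where "eA = fgen X0 + fconst \<iota> * fgen X1"
definition eB :: "'k free_alg" where "eB = fgen X2 + fconst \<iota> * fgen X3"
definition eC :: "'k free_alg" where "eC = fconst \<iota> * fgen X3 - fgen X2"
definition eD :: "'k free_alg" where "eD = fgen X0 - fconst \<iota> * fgen X1"

lemmas e_defs = eA_def eB_def eC_def eD_def

lemma e_hom [simp, intro]: "eA \<in> hom_alg 1" "eB \<in> hom_alg 1" "eC \<in> hom_alg 1" "eD \<in> hom_alg 1"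
  unfolding e_defs
  by (intro hom_alg_add hom_alg_diff hom_alg_fconst_mult hom_alg_fgen)+

lemma e_mult_hom [simp, intro]: "f \<in> hom_alg 1 \<Longrightarrow> g \<in> hom_alg 1 \<Longrightarrow> f * g \<in> hom_alg 2"
  using hom_alg_mult'[of f 1 g 1 2] by simp

lemma sum_fgen_eq:
  "(\<Sum>i\<in>UNIV. fconst (c i) * fgen i) = fconst ((c X0 - \<iota> * c X1) / 2) * eA
     + fconst ((c X2 - \<iota> * c X3) / 2) * eB + fconst (- (c X2 + \<iota> * c X3) / 2) * eC
     + fconst ((c X0 + \<iota> * c X1) / 2) * eD"
proof -
  have 0: "fconst ((c X0 - \<iota> * c X1) / 2) + fconst ((c X0 + \<iota> * c X1) / 2) = fconst (c X0)"
    using two_neq_0 by (simp flip: fconst_add add: field_simps)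
  have 1: "fconst ((c X0 - \<iota> * c X1) / 2) * fconst \<iota> - fconst ((c X0 + \<iota> * c X1) / 2) * fconst \<iota> = fconst (c X1)"
  proof -
    have "(c X0 - \<iota> * c X1) / 2 * \<iota> - (c X0 + \<iota> * c X1) / 2 * \<iota> = - (\<iota> * \<iota>) * c X1"
      using two_neq_0 by (simp add: divide_simps) (simp add: algebra_simps)
    then show ?thesis
      by (simp add: i_square flip: fconst_diff fconst_mult)
  qed
  have 2: "fconst ((c X2 - \<iota> * c X3) / 2) - fconst (- (c X2 + \<iota> * c X3) / 2) = fconst (c X2)"
    using two_neq_0 by (simp flip: fconst_diff add: field_simps)
  have 3: "fconst ((c X2 - \<iota> * c X3) / 2) * fconst \<iota> + fconst (- (c X2 + \<iota> * c X3) / 2) * fconst \<iota> = fconst (c X3)"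
  proof -
    have "(c X2 - \<iota> * c X3) / 2 * \<iota> + - (c X2 + \<iota> * c X3) / 2 * \<iota> = - (\<iota> * \<iota>) * c X3"
      using two_neq_0 by (simp add: divide_simps) (simp add: algebra_simps)
    then show ?thesis
      by (simp add: i_square flip: fconst_add fconst_mult)
  qed
  show ?thesis
    unfolding UNIV_gen_sum 0[symmetric] 1[symmetric] 2[symmetric] 3[symmetric] e_defs
    by (simp add: algebra_simps)
qed

lemma hom_alg_1_e_cases:
  assumes "f \<in> hom_alg 1"
  obtains p q r s where "f = fconst p * eA + fconst q * eB + fconst r * eC + fconst s * eD"
proof -
  obtain c where "f = (\<Sum>i\<in>UNIV. fconst (c i) * fgen i)"
    by (rule hom_alg_1_cases[OF assms])
  then show ?thesis
    by (intro that) (simp only: sum_fgen_eq)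
qed

lemma lin_val_e:
  "lin_val y eA = y X0 + \<iota> * y X1" "lin_val y eB = y X2 + \<iota> * y X3"
  "lin_val y eC = \<iota> * y X3 - y X2" "lin_val y eD = y X0 - \<iota> * y X1"
  by (simp_all add: e_defs lin_val_linear lin_val_fgen)

lemma quad_val_e:
  "f \<in> {eA, eB, eC, eD} \<Longrightarrow> g \<in> {eA, eB, eC, eD} \<Longrightarrow>
    quad_val y y' (f * g) = lin_val y f * lin_val y' g"
  using quad_val_mult[OF e_hom(1)] quad_val_mult[OF e_hom(2)] quad_val_mult[OF e_hom(3)] quad_val_mult[OF e_hom(4)] e_hom
  by blast

section \<open>The defining relations in the new coordinates\<close>

lemmas rel_vals = quad_val_linear quad_val_mult[OF hom_alg_fgen hom_alg_fgen] lin_val_fgen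
  commutator_def anticommutator_def

lemma rels_hom: "r \<in> sklyanin_rels \<alpha> \<beta> \<gamma> \<Longrightarrow> r \<in> hom_alg 2"
  by (auto simp: sklyanin_rels_def commutator_def anticommutator_def
      intro!: hom_alg_add hom_alg_diff hom_alg_fconst_mult hom_alg_fgen)

lemma rels_in_J:
  "commutator (fgen X0) (fgen X1) - fconst \<alpha> * anticommutator (fgen X2) (fgen X3) \<in> J"
  "anticommutator (fgen X0) (fgen X1) - commutator (fgen X2) (fgen X3) \<in> J"
  "commutator (fgen X0) (fgen X2) - fconst \<beta> * anticommutator (fgen X3) (fgen X1) \<in> J"
  "anticommutator (fgen X0) (fgen X2) - commutator (fgen X3) (fgen X1) \<in> J"
  "commutator (fgen X0) (fgen X3) - fconst \<gamma> * anticommutator (fgen X1) (fgen X2) \<in> J"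
  "anticommutator (fgen X0) (fgen X3) - commutator (fgen X1) (fgen X2) \<in> J"
  by (rule ideal_gen_incl, simp add: sklyanin_rels_def)+

lemma rel_1: "eB * eA + eD * eB \<in> J"
proof -
  have "eB * eA + eD * eB =
     (anticommutator (fgen X0) (fgen X2) - commutator (fgen X3) (fgen X1))
     + fconst \<iota> * (anticommutator (fgen X0) (fgen X3) - commutator (fgen X1) (fgen X2))" (is "_ = ?r")
  proof (rule quad_ext)
    show "?r \<in> hom_alg 2"
      by (intro hom_alg_add hom_alg_fconst_mult rels_hom) (simp_all add: sklyanin_rels_def)
    show "quad_val y y' (eB * eA + eD * eB) = quad_val y y' ?r" for y y'
      by (simp add: rel_vals quad_val_e lin_val_e i_simps)
  qed (intro hom_alg_add e_mult_hom e_hom)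
  then show ?thesis
    by (simp only:) (intro ideal_gen_add ideal_gen_lmult rels_in_J)
qed

lemma rel_2: "eA * eC + eC * eD \<in> J"
proof -
  have "eA * eC + eC * eD =
     fconst \<iota> * (anticommutator (fgen X0) (fgen X3) - commutator (fgen X1) (fgen X2))
    - (anticommutator (fgen X0) (fgen X2) - commutator (fgen X3) (fgen X1))" (is "_ = ?r")
  proof (rule quad_ext)
    show "?r \<in> hom_alg 2"
      by (intro hom_alg_diff hom_alg_fconst_mult rels_hom) (simp_all add: sklyanin_rels_def)
    show "quad_val y y' (eA * eC + eC * eD) = quad_val y y' ?r" for y y'
      by (simp add: rel_vals quad_val_e lin_val_e i_simps)
  qed (intro hom_alg_add e_mult_hom e_hom)
  then show ?thesis
    by (simp only:) (intro ideal_gen_diff ideal_gen_lmult rels_in_J)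
qed

lemma rel_3: "eA * eA + eC * eB - eB * eC - eD * eD \<in> J"
proof -
  have "eA * eA + eC * eB - eB * eC - eD * eD =
     fconst (2 * \<iota>) * (anticommutator (fgen X0) (fgen X1) - commutator (fgen X2) (fgen X3))" (is "_ = ?r")
  proof (rule quad_ext)
    show "?r \<in> hom_alg 2"
      by (intro hom_alg_fconst_mult rels_hom) (simp_all add: sklyanin_rels_def)
    show "quad_val y y' (eA * eA + eC * eB - eB * eC - eD * eD) = quad_val y y' ?r" for y y'
      by (simp add: rel_vals quad_val_e lin_val_e i_simps)
  qed (intro hom_alg_add hom_alg_diff e_mult_hom e_hom)
  then show ?thesis
    by (simp only:) (intro ideal_gen_lmult rels_in_J)
qed

lemma rel_4: "eD * eA - eA * eD - fconst \<alpha> * (eB * eB - eC * eC) \<in> J"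
proof -
  have "eD * eA - eA * eD - fconst \<alpha> * (eB * eB - eC * eC) =
     fconst (2 * \<iota>) * (commutator (fgen X0) (fgen X1) - fconst \<alpha> * anticommutator (fgen X2) (fgen X3))" (is "?l = ?r")
  proof (rule quad_ext)
    show "?r \<in> hom_alg 2"
      by (intro hom_alg_fconst_mult rels_hom) (simp_all add: sklyanin_rels_def)
    show "quad_val y y' ?l = quad_val y y' ?r" for y y'
      by (simp add: rel_vals quad_val_e lin_val_e i_simps)
  qed (intro hom_alg_add hom_alg_diff hom_alg_fconst_mult e_mult_hom e_hom)
  then show ?thesis
    by (simp only:) (intro ideal_gen_lmult rels_in_J)
qed

text \<open>One calculation with free weights yields both remaining relations: \<open>p + q\<close>
  weights the relation of x0, x2 and \<open>p - q\<close> that of x0, x3. \<open>rel_5\<close> and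
  \<open>rel_6\<close> are the cases (1, 0) and (0, 1).\<close>

lemma mixed_rels:
  fixes p q
  assumes l: "l = fconst p * (eA * eB - eB * eD) + fconst q * (eC * eA - eD * eC)
    - fconst (\<nu> * (p + \<alpha> * q)) * (eB * eA) - fconst (\<nu> * (\<alpha> * p + q)) * (eA * eC)"
  shows "l \<in> J"
proof -
  let ?R2 = "commutator (fgen X0) (fgen X2) - fconst \<beta> * anticommutator (fgen X3) (fgen X1)"
  let ?R3 = "commutator (fgen X0) (fgen X3) - fconst \<gamma> * anticommutator (fgen X1) (fgen X2)"
  \<comment> \<open>This factor clears the denominators of the two ratios expressed by \<nu>, so
    that \<open>N2\<close> and \<open>N3\<close> are polynomial identities; it is divided out at the
    end.\<close>
  let ?m = "(1 + \<beta>) * (1 - \<gamma>)"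
  have "fconst ?m * l
    = fconst (2 * (p + q) * (1 - \<gamma>)) * ?R2 + fconst (2 * \<iota> * (p - q) * (1 + \<beta>)) * ?R3
      - fconst (?m * \<nu> * (p + \<alpha> * q) / 2) * (eB * eA + eD * eB)
      - fconst (?m * \<nu> * (\<alpha> * p + q) / 2) * (eA * eC + eC * eD)" (is "?l = ?r")
  proof (rule quad_ext)
    show "?l \<in> hom_alg 2"
      unfolding l by (intro hom_alg_add hom_alg_diff hom_alg_fconst_mult e_mult_hom e_hom)
    show "?r \<in> hom_alg 2"
      by (intro hom_alg_add hom_alg_diff hom_alg_fconst_mult e_mult_hom e_hom rels_hom)
        (simp_all add: sklyanin_rels_def)
    fix y y'
    let ?a = "y X0 + \<iota> * y X1" and ?d = "y X0 - \<iota> * y X1" and ?b = "y X2 + \<iota> * y X3" and ?c = "\<iota> * y X3 - y X2"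
    let ?a' = "y' X0 + \<iota> * y' X1" and ?d' = "y' X0 - \<iota> * y' X1" and ?b' = "y' X2 + \<iota> * y' X3" and ?c' = "\<iota> * y' X3 - y' X2"
    have R2: "4 * quad_val y y' ?R2 = (1 + \<beta>) * (?a * ?b' + ?c * ?a' - ?b * ?d' - ?d * ?c')
        - (1 - \<beta>) * (?b * ?a' + ?a * ?c' - ?d * ?b' - ?c * ?d')"
      by (simp add: rel_vals i_simps)
    have R3: "4 * \<iota> * quad_val y y' ?R3 = (1 - \<gamma>) * (?a * ?b' - ?c * ?a' - ?b * ?d' + ?d * ?c')
        - (1 + \<gamma>) * (?b * ?a' - ?a * ?c' - ?d * ?b' + ?c * ?d')"
      by (simp add: rel_vals i_simps)
    have N2: "2 * ((1 - \<beta>) * (1 - \<gamma>)) = ?m * (\<nu> * (1 + \<alpha>))" 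
    proof -
      have "?m * (\<nu> * (1 + \<alpha>)) = (1 - \<gamma>) * (\<nu> * ((1 + \<alpha>) * (1 + \<beta>)))" by (simp add: mult_ac)
      then show ?thesis by (simp add: \<nu>_eq) (simp add: algebra_simps)
    qed
    have N3: "2 * ((1 + \<beta>) * (1 + \<gamma>)) = ?m * (\<nu> * (1 - \<alpha>))"
    proof -
      have "?m * (\<nu> * (1 - \<alpha>)) = (1 + \<beta>) * (\<nu> * ((1 - \<alpha>) * (1 - \<gamma>)))" by (simp add: mult_ac)
      then show ?thesis by (simp only: \<nu>_eq' mult.left_commute)
    qed
    have half: "2 * (2 * (x + x' - z / 2 * t - z' / 2 * t')) = 4 * x + 4 * x' - 2 * (z * t) - 2 * (z' * t')"
      for x x' z t z' t' :: 'k
      using two_neq_0 by (simp add: algebra_simps)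
    have ring1: "2 * (p + q) * (1 - \<gamma>) * ((1 + \<beta>) * u - (1 - \<beta>) * v)
        = (p + q) * (2 * ?m * u - 2 * ((1 - \<beta>) * (1 - \<gamma>)) * v)" for u v
      by (simp add: algebra_simps)
    have ring2: "2 * (p - q) * (1 + \<beta>) * ((1 - \<gamma>) * u - (1 + \<gamma>) * v)
        = (p - q) * (2 * ?m * u - 2 * ((1 + \<beta>) * (1 + \<gamma>)) * v)" for u v
      by (simp add: algebra_simps)
    have S2: "4 * (2 * (p + q) * (1 - \<gamma>) * quad_val y y' ?R2)
        = (p + q) * (2 * ?m * (?a * ?b' + ?c * ?a' - ?b * ?d' - ?d * ?c')
           - ?m * (\<nu> * (1 + \<alpha>)) * (?b * ?a' + ?a * ?c' - ?d * ?b' - ?c * ?d'))" (is "_ = (p + q) * (2 * ?m * ?Y - _ * ?Z)")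
    proof -
      have "4 * (2 * (p + q) * (1 - \<gamma>) * quad_val y y' ?R2) = 2 * (p + q) * (1 - \<gamma>) * (4 * quad_val y y' ?R2)"
        by (simp only: mult_ac)
      also have "\<dots> = (p + q) * (2 * ?m * ?Y - 2 * ((1 - \<beta>) * (1 - \<gamma>)) * ?Z)"
        unfolding R2 by (rule ring1)
      finally show ?thesis unfolding N2 .
    qed
    have S3: "4 * (2 * \<iota> * (p - q) * (1 + \<beta>) * quad_val y y' ?R3)
        = (p - q) * (2 * ?m * (?a * ?b' - ?c * ?a' - ?b * ?d' + ?d * ?c')
           - ?m * (\<nu> * (1 - \<alpha>)) * (?b * ?a' - ?a * ?c' - ?d * ?b' + ?c * ?d'))" (is "_ = (p - q) * (2 * ?m * ?Y - _ * ?Z)")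
    proof -
      have "4 * (2 * \<iota> * (p - q) * (1 + \<beta>) * quad_val y y' ?R3) = 2 * (p - q) * (1 + \<beta>) * (4 * \<iota> * quad_val y y' ?R3)"
        by (simp only: mult_ac)
      also have "\<dots> = (p - q) * (2 * ?m * ?Y - 2 * ((1 + \<beta>) * (1 + \<gamma>)) * ?Z)"
        unfolding R3 by (rule ring2)
      finally show ?thesis unfolding N3 .
    qed
    have final: "(p + q) * (2 * m * (a * b' + c * a' - b * d' - d * c') - m * (\<nu> * (1 + \<alpha>)) * (b * a' + a * c' - d * b' - c * d'))
       + (p - q) * (2 * m * (a * b' - c * a' - b * d' + d * c') - m * (\<nu> * (1 - \<alpha>)) * (b * a' - a * c' - d * b' + c * d'))
       - 2 * (m * \<nu> * (p + \<alpha> * q) * (b * a' + d * b')) - 2 * (m * \<nu> * (\<alpha> * p + q) * (a * c' + c * d'))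
      = 4 * (m * (p * (a * b' - b * d') + q * (c * a' - d * c')
         - \<nu> * (p + \<alpha> * q) * (b * a') - \<nu> * (\<alpha> * p + q) * (a * c')))"
      for m a b c d a' b' c' d' :: 'k
      by (simp add: algebra_simps)
    have "2 * (2 * quad_val y y' ?r) = 2 * (2 * quad_val y y' ?l)"
    proof -
      have r: "quad_val y y' ?r = 2 * (p + q) * (1 - \<gamma>) * quad_val y y' ?R2
          + 2 * \<iota> * (p - q) * (1 + \<beta>) * quad_val y y' ?R3
          - ?m * \<nu> * (p + \<alpha> * q) / 2 * (?b * ?a' + ?d * ?b')
          - ?m * \<nu> * (\<alpha> * p + q) / 2 * (?a * ?c' + ?c * ?d')"
        by (simp add: quad_val_linear quad_val_e lin_val_e)
      have l': "quad_val y y' ?l = ?m * (p * (?a * ?b' - ?b * ?d') + q * (?c * ?a' - ?d * ?c')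
         - \<nu> * (p + \<alpha> * q) * (?b * ?a') - \<nu> * (\<alpha> * p + q) * (?a * ?c'))"
        by (simp add: l quad_val_linear quad_val_e lin_val_e)
      have four: "2 * (2 * x) = 4 * x" for x :: 'k by simp
      show ?thesis
        unfolding r half S2 S3 final l' by (rule four[symmetric])
    qed
    then show "quad_val y y' ?l = quad_val y y' ?r"
      by (metis mult_left_cancel two_neq_0)
  qed
  then have "fconst ?m * l \<in> J"
    by (simp only:) (intro ideal_gen_add ideal_gen_diff ideal_gen_lmult rel_1 rel_2 rels_in_J)
  then have "fconst (1 / ?m) * (fconst ?m * l) \<in> J"
    by (rule ideal_gen_lmult)
  moreover have "fconst (1 / ?m) * (fconst ?m * l) = l"
    using \<beta>_neq \<gamma>_neq by (simp flip: mult.assoc fconst_mult)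
  ultimately show ?thesis by simp
qed

lemma rel_5: "eA * eB - eB * eD - fconst \<nu> * (eB * eA + fconst \<alpha> * (eA * eC)) \<in> J"
  by (rule mixed_rels[of _ 1 0]) (simp add: fconst_mult algebra_simps fconst_left_commute[of "fconst \<alpha>" \<nu>])

lemma rel_6: "eC * eA - eD * eC - fconst \<nu> * (eA * eC + fconst \<alpha> * (eB * eA)) \<in> J"
  by (rule mixed_rels[of _ 0 1]) (simp add: fconst_mult algebra_simps fconst_left_commute[of "fconst \<alpha>" \<nu>])

definition W1 :: "'k free_alg" where "W1 = eA * eA + eC * eB"

definition W2 :: "'k free_alg" where
  "W2 = eA * eD + fconst \<alpha> * (eB * eB) + fconst (1 / \<nu>) * (eA * eA - eB * eC)"

lemma W_hom [simp]: "W1 \<in> hom_alg 2" "W2 \<in> hom_alg 2"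
  unfolding W1_def W2_def
  by (intro hom_alg_add hom_alg_diff hom_alg_fconst_mult e_mult_hom e_hom)+

definition commJ :: "'k free_alg \<Rightarrow> 'k free_alg \<Rightarrow> bool" where
  "commJ x y \<longleftrightarrow> x * y - y * x \<in> J"

lemma commJ_add_left: "commJ x z \<Longrightarrow> commJ y z \<Longrightarrow> commJ (x + y) z"
  unfolding commJ_def by (drule (1) ideal_gen_add) (simp add: algebra_simps)

lemma commJ_fconst_left: "commJ x z \<Longrightarrow> commJ (fconst c * x) z"
  unfolding commJ_def
  by (drule ideal_gen_lmult[of _ _ "fconst c"]) (simp add: algebra_simps fconst_left_commute)

lemma commJ_sym: "commJ x y \<Longrightarrow> commJ y x"
  unfolding commJ_def by (drule ideal_gen_uminus) simp

lemma commJ_mult_left: "commJ x z \<Longrightarrow> commJ y z \<Longrightarrow> commJ (x * y) z"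
proof -
  assume "commJ x z" "commJ y z"
  then have "x * (y * z - z * y) + (x * z - z * x) * y \<in> J"
    unfolding commJ_def by (intro ideal_gen_add ideal_gen_lmult ideal_gen_rmult)
  then show ?thesis unfolding commJ_def by (simp add: algebra_simps)
qed

lemma commJ_fconst: "commJ (fconst c) z"
  unfolding commJ_def by (simp add: fconst_commute ideal_gen.zero)

lemma commJ_fgen_all:
  assumes "\<And>i. commJ (fgen i) z"
  shows "commJ x z"
proof (induction x rule: free_alg_induct)
  case zero
  show ?case unfolding commJ_def by (simp add: ideal_gen.zero)
next
  case (add f g)
  then show ?case by (rule commJ_add_left)
next
  case (single c w)
  show ?case
  proof (induction w)
    case Nil
    show ?case using commJ_fconst[of c z] by (simp add: fconst_single)
  next
    case (Cons i w)
    have "Poly_Mapping.single (Word (i # w)) c = fgen i * Poly_Mapping.single (Word w) c"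
      by (simp add: fgen_def single_Word_mult)
    then show ?case using commJ_mult_left[OF assms Cons] by simp
  qed
qed

lemma commJ_from_e:
  assumes "commJ eA z" "commJ eB z" "commJ eC z" "commJ eD z"
  shows "commJ x z"
proof (rule commJ_fgen_all)
  fix i
  obtain p q r s where "fgen i = fconst p * eA + fconst q * eB + fconst r * eC + fconst s * eD"
    by (rule hom_alg_1_e_cases[OF hom_alg_fgen])
  then show "commJ (fgen i) z"
    by (simp add: commJ_add_left commJ_fconst_left assms)
qed

abbreviation "r1 \<equiv> eB * eA + eD * eB"
abbreviation "r2 \<equiv> eA * eC + eC * eD"
abbreviation "r3 \<equiv> eA * eA + eC * eB - eB * eC - eD * eD"
abbreviation "r4 \<equiv> eD * eA - eA * eD - fconst \<alpha> * (eB * eB - eC * eC)"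
abbreviation "r5 \<equiv> eA * eB - eB * eD - fconst \<nu> * (eB * eA + fconst \<alpha> * (eA * eC))"
abbreviation "r6 \<equiv> eC * eA - eD * eC - fconst \<nu> * (eA * eC + fconst \<alpha> * (eB * eA))"

lemmas rels_e = rel_1 rel_2 rel_3 rel_4 rel_5 rel_6

lemmas in_J_intros = ideal_gen_add ideal_gen_diff ideal_gen_uminus

lemmas in_J_rels = rels_e rels_e[THEN ideal_gen_rmult] rels_e[THEN ideal_gen_lmult]

lemma in_J_scale: "x \<in> J \<Longrightarrow> fconst c * x \<in> J"
  by (rule ideal_gen_lmult)

text \<open>Each commutator equals, in the free algebra itself, a sum of relations multiplied by one
  coordinate. The displayed equations are these certificates; centrality follows from the closure
  rules of \<open>J\<close>.\<close>

lemma commJ_W1: "commJ x W1"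
proof (rule commJ_from_e)
  have "eA * W1 - W1 * eA = r2 * eB - eC * r1"
    by (simp add: W1_def algebra_simps)
  then show "commJ eA W1"
    unfolding commJ_def by (simp only:) (intro in_J_intros in_J_rels in_J_scale)
  have "eB * W1 - W1 * eB = r1 * eA - eD * r1 - r3 * eB"
    by (simp add: W1_def algebra_simps)
  then show "commJ eB W1"
    unfolding commJ_def by (simp only:) (intro in_J_intros in_J_rels in_J_scale)
  have "eC * W1 - W1 * eC = r2 * eD - eA * r2 + eC * r3"
    by (simp add: W1_def algebra_simps)
  then show "commJ eC W1"
    unfolding commJ_def by (simp only:) (intro in_J_intros in_J_rels in_J_scale)
  have "eD * W1 - W1 * eD = r1 * eC - eB * r2 + eD * r3 - r3 * eD"
    by (simp add: W1_def algebra_simps)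
  then show "commJ eD W1"
    unfolding commJ_def by (simp only:) (intro in_J_intros in_J_rels in_J_scale)
qed

lemmas e_commute = fconst_commute[of eA] fconst_commute[of eB] fconst_commute[of eC] fconst_commute[of eD]
  fconst_left_commute[of eA] fconst_left_commute[of eB] fconst_left_commute[of eC] fconst_left_commute[of eD]

lemma fconst_mult_mult: "fconst a * (fconst b * x) = fconst (a * b) * x"
  by (simp add: fconst_mult mult.assoc)

lemmas e_simps = algebra_simps e_commute fconst_mult_mult

lemma commJ_W2: "commJ x W2"
proof -
  \<comment> \<open>Subtracting the central multiple of \<open>W1\<close> by 1/\<nu> removes
    \<open>eA * eA\<close> from \<open>W2\<close> and makes the term in \<open>eB\<close>,
    \<open>eC\<close> symmetric.\<close>
  define V where "V = eA * eD + fconst \<alpha> * (eB * eB) - fconst (1 / \<nu>) * (eB * eC + eC * eB)"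
  let ?m = "fconst (1 / \<nu>)" and ?s = "fconst \<alpha>"
  have "commJ y V" for y
  proof (rule commJ_from_e)
    have "eA * V - V * eA = - (eA * r4) - ?m * (r5 * eC + r2 * eB - eC * r1 - eB * r6)"
      using \<nu>_neq by (simp add: V_def e_simps)
    then show "commJ eA V"
      unfolding commJ_def by (simp only:) (intro in_J_intros in_J_rels in_J_scale)
    have "eB * V - V * eB = - (eA * r1) - ?s * (eA * r2)
        - ?m * (eA * r5 + r5 * eD - eD * r1 + r1 * eA - eB * r3 - r3 * eB)"
      using \<nu>_neq by (simp add: V_def e_simps)
    then show "commJ eB V"
      unfolding commJ_def by (simp only:) (intro in_J_intros in_J_rels in_J_scale)
    have "eC * V - V * eC = r2 * eA + ?s * (r1 * eA) - eC * r4 + r4 * eC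
        - ?m * (eC * r3 + r3 * eC + r2 * eD - eA * r2 - r6 * eA - eD * r6)"
      using \<nu>_neq by (simp add: V_def e_simps)
    then show "commJ eC V"
      unfolding commJ_def by (simp only:) (intro in_J_intros in_J_rels in_J_scale)
    have "eD * V - V * eD = r4 * eD - ?m * (r1 * eC - eB * r2 - r6 * eB + eC * r5)
       + ?s * (r1 * eB) - ?s * (eC * r2) + r2 * eB - eC * r1"
      using \<nu>_neq by (simp add: V_def e_simps)
    then show "commJ eD V"
      unfolding commJ_def by (simp only:) (intro in_J_intros in_J_rels in_J_scale)
  qed
  moreover have "W2 = V + ?m * W1"
    by (simp add: W2_def V_def W1_def e_simps)
  ultimately show ?thesis
    using commJ_W1 by (metis commJ_add_left commJ_fconst_left commJ_sym)
qed

text \<open>The map \<open>pt\<close> parametrises the elliptic curve, up to finitely many points, by the plane curve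
  \<open>curve\<close> below. The latter is quadratic in each coordinate, and \<open>nxt\<close>, which turns out to be the
  translation \<open>\<sigma>\<close>, replaces a root of one quadratic by the other root. Where \<open>den\<close> vanishes the value of
  \<open>nxt\<close> is meaningless.\<close>

definition pt :: "'k \<times> 'k \<Rightarrow> gen \<Rightarrow> 'k" where
  "pt P i = (case P of (u, v) \<Rightarrow> (case i of
     X0 \<Rightarrow> u - v | X1 \<Rightarrow> - \<iota> * (u + v) | X2 \<Rightarrow> - (1 + u * v) | X3 \<Rightarrow> - \<iota> * (1 - u * v)))"

lemma pt_simps:
  "pt (u, v) X0 = u - v" "pt (u, v) X1 = - \<iota> * (u + v)"
  "pt (u, v) X2 = - (1 + u * v)" "pt (u, v) X3 = - \<iota> * (1 - u * v)"
  by (simp_all add: pt_def)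

lemma lin_val_pt:
  "lin_val (pt (u, v)) eA = 2 * u" "lin_val (pt (u, v)) eB = - 2 * (u * v)"
  "lin_val (pt (u, v)) eC = 2" "lin_val (pt (u, v)) eD = - 2 * v"
  by (simp_all add: lin_val_e pt_simps i_simps)

text \<open>The two equations express that \<open>r6\<close> and, up to a factor \<open>u\<close>,
  \<open>r5\<close> vanish at the pair of points \<open>pt (u, v)\<close>, \<open>pt (w, u)\<close>.
  They are symmetric in \<open>v\<close> and \<open>w\<close>.\<close>

definition consec :: "'k \<Rightarrow> 'k \<Rightarrow> 'k \<Rightarrow> bool" where
  "consec v u w \<longleftrightarrow> v + w + \<alpha> * \<nu> * u * v * w = \<nu> * u \<and> \<nu> * v * w = \<alpha> * \<nu> + u * (v + w)"

definition \<kappa> :: 'k where "\<kappa> = \<nu> * (1 - \<alpha> * \<alpha>)"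

definition den :: "'k \<Rightarrow> 'k" where "den u = 1 + \<alpha> * u * u"

definition curve :: "('k \<times> 'k) set" where
  "curve = {(u, v). \<alpha> * (1 + u * u * v * v) + u * u + v * v = \<kappa> * u * v}"

definition nxt :: "'k \<times> 'k \<Rightarrow> 'k \<times> 'k" where
  "nxt P = (\<kappa> * fst P / den (fst P) - snd P, fst P)"

lemma consec_sym: "consec v u w \<Longrightarrow> consec w u v"
  by (simp add: consec_def algebra_simps)

text \<open>Eliminating the product of \<open>v\<close> and \<open>w\<close> gives their sum.
  Together with \<open>consec_prod\<close> this is Vieta for the quadratic den(u) X^2 - \<kappa> u X
  + (u^2 + \<alpha>), the equation of \<open>curve\<close> in its second coordinate:
  \<open>v\<close> and \<open>w\<close> are its two roots.\<close>

lemma consec_sum: "consec v u w \<Longrightarrow> den u * (v + w) = \<kappa> * u"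
proof -
  assume "consec v u w"
  then have 1: "v + w + \<alpha> * \<nu> * u * v * w = \<nu> * u" and 2: "\<nu> * v * w = \<alpha> * \<nu> + u * (v + w)"
    by (auto simp: consec_def)
  have "den u * (v + w) - \<kappa> * u = (v + w + \<alpha> * \<nu> * u * v * w - \<nu> * u)
      - \<alpha> * u * (\<nu> * v * w - (\<alpha> * \<nu> + u * (v + w)))"
    by (simp add: den_def \<kappa>_def algebra_simps)
  then show ?thesis using 1 2 by simp
qed

lemma consec_prod: "consec v u w \<Longrightarrow> den u * (v * w) = u * u + \<alpha>"
proof -
  assume c: "consec v u w"
  then have 2: "\<nu> * v * w = \<alpha> * \<nu> + u * (v + w)"
    by (auto simp: consec_def)
  have "\<nu> * (den u * (v * w)) - \<nu> * (u * u + \<alpha>) = den u * (\<nu> * v * w - (\<alpha> * \<nu> + u * (v + w)))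
      + u * (den u * (v + w) - \<kappa> * u)"
    by (simp add: den_def \<kappa>_def algebra_simps)
  then show ?thesis using 2 consec_sum[OF c] \<nu>_neq by simp
qed

lemma consecI:
  assumes "den u \<noteq> 0" "den u * (v + w) = \<kappa> * u" "den u * (v * w) = u * u + \<alpha>"
  shows "consec v u w"
proof -
  have "den u * (v + w + \<alpha> * \<nu> * u * v * w - \<nu> * u)
     = (den u * (v + w) - \<kappa> * u) + \<alpha> * \<nu> * u * (den u * (v * w) - (u * u + \<alpha>))"
    by (simp add: den_def \<kappa>_def algebra_simps)
  moreover have "den u * (\<nu> * v * w - (\<alpha> * \<nu> + u * (v + w)))
     = \<nu> * (den u * (v * w) - (u * u + \<alpha>)) - u * (den u * (v + w) - \<kappa> * u)"
    by (simp add: den_def \<kappa>_def algebra_simps)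
  ultimately show ?thesis
    using assms by (simp add: consec_def)
qed

lemma curve_iff: "(u, v) \<in> curve \<longleftrightarrow> \<kappa> * u * v - den u * v * v = u * u + \<alpha>"
proof -
  have "\<alpha> * (1 + u * u * v * v) + u * u + v * v - \<kappa> * u * v = u * u + \<alpha> - (\<kappa> * u * v - den u * v * v)"
    by (simp add: den_def algebra_simps)
  then show ?thesis unfolding curve_def by (simp, metis eq_iff_diff_eq_0)
qed

lemma curve_swap: "(u, v) \<in> curve \<longleftrightarrow> (v, u) \<in> curve"
  by (simp add: curve_def algebra_simps)

lemma curve_minus: "(- u, - v) \<in> curve \<longleftrightarrow> (u, v) \<in> curve"
  by (simp add: curve_def)

lemma consec_curve: "consec v u w \<Longrightarrow> (u, v) \<in> curve"
proof -
  assume c: "consec v u w"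
  have "\<kappa> * u * v - den u * v * v = v * (\<kappa> * u - den u * (v + w)) + den u * (v * w)"
    by (simp add: algebra_simps)
  then show ?thesis
    using consec_sum[OF c] consec_prod[OF c] by (simp add: curve_iff)
qed

lemma consec_nxt:
  assumes "(u, v) \<in> curve" "den u \<noteq> 0"
  shows "consec v u (fst (nxt (u, v)))"
proof (rule consecI[OF assms(2)])
  show "den u * (v + fst (nxt (u, v))) = \<kappa> * u"
    using assms(2) by (simp add: nxt_def)
  have "den u * (v * fst (nxt (u, v))) = \<kappa> * u * v - den u * v * v"
    using assms(2) by (simp add: nxt_def field_simps)
  then show "den u * (v * fst (nxt (u, v))) = u * u + \<alpha>"
    using assms(1) by (simp add: curve_iff)
qed

lemma nxt_curve:
  assumes "P \<in> curve" "den (fst P) \<noteq> 0"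
  shows "nxt P \<in> curve"
proof -
  have "consec (snd P) (fst P) (fst (nxt P))"
    using consec_nxt[of "fst P" "snd P"] assms by simp
  then have "(fst P, fst (nxt P)) \<in> curve"
    using consec_curve consec_sym by blast
  then have "(fst (nxt P), fst P) \<in> curve"
    using curve_swap by blast
  then show ?thesis by (simp add: nxt_def)
qed

lemma consec_unique:
  assumes "consec v u w" "den u \<noteq> 0"
  shows "w = fst (nxt (u, v))"
proof -
  have "w = \<kappa> * u / den u - v"
    using consec_sum[OF assms(1)] assms(2) by (simp add: field_simps)
  then show ?thesis by (simp add: nxt_def)
qed

section \<open>Values of the relations\<close>

lemma four_neq_0: "(4::'k) \<noteq> 0"
  using two_neq_0 by (metis mult_eq_0_iff mult_2 numeral_Bit0)

text \<open>The converse of \<open>rel_1\<close> to \<open>rel_6\<close>. An action has to be tested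
  on the original relations, whereas only \<open>r1\<close> to \<open>r6\<close> have short values
  at points. The quarters arise because each generator is half a sum or difference of two new
  coordinates, up to a factor \<iota>.\<close>

lemma rels_span:
  assumes "r \<in> sklyanin_rels \<alpha> \<beta> \<gamma>"
  obtains c1 c2 c3 c4 c5 c6 where "r = fconst c1 * r1 + fconst c2 * r2 + fconst c3 * r3
    + fconst c4 * r4 + fconst c5 * r5 + fconst c6 * r6"
proof -
  define comb where "comb c1 c2 c3 c4 c5 c6 = fconst c1 * r1 + fconst c2 * r2 + fconst c3 * r3
    + fconst c4 * r4 + fconst c5 * r5 + fconst c6 * r6" for c1 c2 c3 c4 c5 c6
  have hom: "comb c1 c2 c3 c4 c5 c6 \<in> hom_alg 2" for c1 c2 c3 c4 c5 c6
    unfolding comb_def by (intro hom_alg_add hom_alg_diff hom_alg_fconst_mult e_mult_hom e_hom)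
  have eqI: "r = comb c1 c2 c3 c4 c5 c6"
    if "r \<in> hom_alg 2" "\<And>y y'. 4 * quad_val y y' r = 4 * quad_val y y' (comb c1 c2 c3 c4 c5 c6)"
    for r c1 c2 c3 c4 c5 c6
    by (rule quad_ext[OF that(1) hom]) (metis that(2) mult_left_cancel four_neq_0)
  have q: "4 * (c / 4 * x) = c * x" for c x :: 'k
    using four_neq_0 by (simp add: field_simps)
  have q_comb: "4 * quad_val y y' (comb (c1 / 4) (c2 / 4) (c3 / 4) (c4 / 4) (c5 / 4) (c6 / 4))
      = c1 * quad_val y y' r1 + c2 * quad_val y y' r2 + c3 * quad_val y y' r3
       + c4 * quad_val y y' r4 + c5 * quad_val y y' r5 + c6 * quad_val y y' r6" for c1 c2 c3 c4 c5 c6 y y'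
  proof -
    have "4 * quad_val y y' (fconst (c1 / 4) * R1 + fconst (c2 / 4) * R2 + fconst (c3 / 4) * R3
        + fconst (c4 / 4) * R4 + fconst (c5 / 4) * R5 + fconst (c6 / 4) * R6)
      = c1 * quad_val y y' R1 + c2 * quad_val y y' R2 + c3 * quad_val y y' R3
       + c4 * quad_val y y' R4 + c5 * quad_val y y' R5 + c6 * quad_val y y' R6" for R1 R2 R3 R4 R5 R6
      by (simp only: quad_val_linear distrib_left q)
    then show ?thesis unfolding comb_def .
  qed
  have ex: "\<exists>c1 c2 c3 c4 c5 c6. r = comb c1 c2 c3 c4 c5 c6"
  proof -
    from assms consider
      "r = commutator (fgen X0) (fgen X1) - fconst \<alpha> * anticommutator (fgen X2) (fgen X3)"
    | "r = anticommutator (fgen X0) (fgen X1) - commutator (fgen X2) (fgen X3)"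
    | "r = commutator (fgen X0) (fgen X2) - fconst \<beta> * anticommutator (fgen X3) (fgen X1)"
    | "r = anticommutator (fgen X0) (fgen X2) - commutator (fgen X3) (fgen X1)"
    | "r = commutator (fgen X0) (fgen X3) - fconst \<gamma> * anticommutator (fgen X1) (fgen X2)"
    | "r = anticommutator (fgen X0) (fgen X3) - commutator (fgen X1) (fgen X2)"
      unfolding sklyanin_rels_def by blast
    then show ?thesis
    proof cases
      case 1
      have "r = comb (0 / 4) (0 / 4) (0 / 4) ((- 2 * \<iota>) / 4) (0 / 4) (0 / 4)"
        by (rule eqI[OF rels_hom[OF assms]], unfold q_comb)
          (simp add: 1 rel_vals quad_val_e lin_val_e, simp add: i_simps)
      then show ?thesis by blast
    next
      case 2
      have "r = comb (0 / 4) (0 / 4) ((- 2 * \<iota>) / 4) (0 / 4) (0 / 4) (0 / 4)"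
        by (rule eqI[OF rels_hom[OF assms]], unfold q_comb)
          (simp add: 2 rel_vals quad_val_e lin_val_e, simp add: i_simps)
      then show ?thesis by blast
    next
      case 4
      have "r = comb (2 / 4) (- 2 / 4) (0 / 4) (0 / 4) (0 / 4) (0 / 4)"
        by (rule eqI[OF rels_hom[OF assms]], unfold q_comb)
          (simp add: 4 rel_vals quad_val_e lin_val_e, simp add: i_simps)
      then show ?thesis by blast
    next
      case 6
      have "r = comb ((- 2 * \<iota>) / 4) ((- 2 * \<iota>) / 4) (0 / 4) (0 / 4) (0 / 4) (0 / 4)"
        by (rule eqI[OF rels_hom[OF assms]], unfold q_comb)
          (simp add: 6 rel_vals quad_val_e lin_val_e, simp add: i_simps)
      then show ?thesis by blast
    next
      case 3
      have N: "\<nu> * (1 + \<beta>) * x + \<nu> * \<alpha> * (1 + \<beta>) * x = 2 * (1 - \<beta>) * x" for x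
        unfolding \<nu>_eq[symmetric] by (simp add: algebra_simps)
      have "r = comb ((1 - \<beta>) / 4) ((1 - \<beta>) / 4) (0 / 4) (0 / 4) ((1 + \<beta>) / 4) ((1 + \<beta>) / 4)"
      proof (rule eqI[OF rels_hom[OF assms]])
        fix y y' :: "gen \<Rightarrow> 'k"
        let ?q = "quad_val y y'"
        have "4 * ?q (comb ((1 - \<beta>) / 4) ((1 - \<beta>) / 4) (0 / 4) (0 / 4) ((1 + \<beta>) / 4) ((1 + \<beta>) / 4))
          = (1 - \<beta>) * (?q r1) + (1 - \<beta>) * (?q r2) + (1 + \<beta>) * ?q r5 + (1 + \<beta>) * ?q r6"
          unfolding q_comb by simp
        also have "\<dots> = (1 - \<beta>) * (?q (eB * eA) + ?q (eD * eB) + ?q (eA * eC) + ?q (eC * eD))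
            + (1 + \<beta>) * (?q (eA * eB) - ?q (eB * eD) + ?q (eC * eA) - ?q (eD * eC))
            - (\<nu> * (1 + \<beta>) * (?q (eB * eA) + ?q (eA * eC)) + \<nu> * \<alpha> * (1 + \<beta>) * (?q (eB * eA) + ?q (eA * eC)))"
          by (simp add: quad_val_linear algebra_simps)
        also have "\<dots> = (1 - \<beta>) * (?q (eD * eB) - ?q (eB * eA) - ?q (eA * eC) + ?q (eC * eD))
            + (1 + \<beta>) * (?q (eA * eB) - ?q (eB * eD) + ?q (eC * eA) - ?q (eD * eC))"
          unfolding N by (simp add: algebra_simps)
        also have "\<dots> = 4 * ?q r"
          by (simp add: 3 rel_vals quad_val_e lin_val_e, simp add: i_simps)
        finally show "4 * ?q r = 4 * ?q (comb ((1 - \<beta>) / 4) ((1 - \<beta>) / 4) (0 / 4) (0 / 4) ((1 + \<beta>) / 4) ((1 + \<beta>) / 4))" ..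
      qed
      then show ?thesis by blast
    next
      case 5
      have N: "\<nu> * (1 - \<gamma>) * x - \<nu> * \<alpha> * (1 - \<gamma>) * x = 2 * (1 + \<gamma>) * x" for x
        unfolding \<nu>_eq'[symmetric] by (simp add: algebra_simps)
      let ?g = "- \<iota> * (1 + \<gamma>)" and ?h = "- \<iota> * (1 - \<gamma>)"
      have "r = comb (?g / 4) (- ?g / 4) (0 / 4) (0 / 4) (?h / 4) (- ?h / 4)"
      proof (rule eqI[OF rels_hom[OF assms]])
        fix y y' :: "gen \<Rightarrow> 'k"
        let ?q = "quad_val y y'"
        have "4 * ?q (comb (?g / 4) (- ?g / 4) (0 / 4) (0 / 4) (?h / 4) (- ?h / 4))
          = ?g * (?q r1) + - ?g * (?q r2) + ?h * ?q r5 + - ?h * ?q r6"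
          unfolding q_comb by simp
        also have "\<dots> = - \<iota> * ((1 + \<gamma>) * (?q (eB * eA) + ?q (eD * eB) - ?q (eA * eC) - ?q (eC * eD))
            + (1 - \<gamma>) * (?q (eA * eB) - ?q (eB * eD) - ?q (eC * eA) + ?q (eD * eC))
            - (\<nu> * (1 - \<gamma>) * (?q (eB * eA) - ?q (eA * eC)) - \<nu> * \<alpha> * (1 - \<gamma>) * (?q (eB * eA) - ?q (eA * eC))))"
          by (simp add: quad_val_linear algebra_simps)
        also have "\<dots> = - \<iota> * ((1 + \<gamma>) * (?q (eD * eB) - ?q (eB * eA) + ?q (eA * eC) - ?q (eC * eD))
            + (1 - \<gamma>) * (?q (eA * eB) - ?q (eB * eD) - ?q (eC * eA) + ?q (eD * eC)))"
          unfolding N by (simp add: algebra_simps)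
        also have "\<dots> = 4 * ?q r"
          by (simp add: 5 rel_vals quad_val_e lin_val_e, simp add: i_simps)
        finally show "4 * ?q r = 4 * ?q (comb (?g / 4) (- ?g / 4) (0 / 4) (0 / 4) (?h / 4) (- ?h / 4))" ..
      qed
      then show ?thesis by blast
    qed
  qed
  then show ?thesis using that unfolding comb_def by blast
qed

lemma quad_val_rels_eq_0I:
  assumes "r \<in> sklyanin_rels \<alpha> \<beta> \<gamma>"
    and "\<And>r. r \<in> {r1, r2, r3, r4, r5, r6} \<Longrightarrow> p * quad_val y y' r + q * quad_val z z' r = 0"
  shows "p * quad_val y y' r + q * quad_val z z' r = 0"
proof -
  obtain c1 c2 c3 c4 c5 c6 where r: "r = fconst c1 * r1 + fconst c2 * r2 + fconst c3 * r3
    + fconst c4 * r4 + fconst c5 * r5 + fconst c6 * r6"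
    by (rule rels_span[OF assms(1)])
  define L where "L = (\<lambda>f. p * quad_val y y' f + q * quad_val z z' f)"
  have lin: "L (f + g) = L f + L g" "L (fconst c * f) = c * L f" for f g c
    by (simp_all add: L_def quad_val_linear algebra_simps)
  have comb: "L (fconst c1 * R1 + fconst c2 * R2 + fconst c3 * R3 + fconst c4 * R4 + fconst c5 * R5 + fconst c6 * R6) = 0"
    if "L R1 = 0" "L R2 = 0" "L R3 = 0" "L R4 = 0" "L R5 = 0" "L R6 = 0" for R1 R2 R3 R4 R5 R6
    by (simp add: lin that)
  have "L r = 0"
    unfolding r by (rule comb; unfold L_def, rule assms(2), blast)
  then show ?thesis by (simp add: L_def)
qed

lemmas quad_val_pt = quad_val_linear quad_val_e lin_val_pt

lemma quad_val_rels_point: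
  assumes "consec v u w" "r \<in> sklyanin_rels \<alpha> \<beta> \<gamma>"
  shows "quad_val (pt (u, v)) (pt (w, u)) r = 0"
proof -
  from assms(1) have 1: "v + w + \<alpha> * \<nu> * u * v * w = \<nu> * u" and 2: "\<nu> * v * w = \<alpha> * \<nu> + u * (v + w)"
    by (auto simp: consec_def)
  have "\<nu> * (u * u - v * w - \<alpha> * (u * u * v * w - 1))
    = u * (\<nu> * u - (v + w + \<alpha> * \<nu> * u * v * w)) + (\<alpha> * \<nu> + u * (v + w) - \<nu> * v * w)"
    by (simp add: algebra_simps)
  then have 4: "u * u - v * w - \<alpha> * (u * u * v * w - 1) = 0"
    using 1 2 \<nu>_neq by simp
  have q4: "quad_val (pt (u, v)) (pt (w, u)) r4 = 4 * (u * u - v * w - \<alpha> * (u * u * v * w - 1))"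
    by (simp add: quad_val_pt algebra_simps)
  have q5: "quad_val (pt (u, v)) (pt (w, u)) r5 = 4 * (u * (\<nu> * v * w - (\<alpha> * \<nu> + u * (v + w))))"
    by (simp add: quad_val_pt algebra_simps)
  have q6: "quad_val (pt (u, v)) (pt (w, u)) r6 = 4 * (v + w + \<alpha> * \<nu> * u * v * w - \<nu> * u)"
    by (simp add: quad_val_pt algebra_simps)
  have q: "quad_val (pt (u, v)) (pt (w, u)) r1 = 0" "quad_val (pt (u, v)) (pt (w, u)) r2 = 0"
    "quad_val (pt (u, v)) (pt (w, u)) r3 = 0"
    by (simp_all add: quad_val_pt algebra_simps)
  have "1 * quad_val (pt (u, v)) (pt (w, u)) r + 0 * quad_val (pt (u, v)) (pt (w, u)) r = 0"
    by (rule quad_val_rels_eq_0I[OF assms(2)]) (use q q4 q5 q6 1 2 4 in auto)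
  then show ?thesis by simp
qed

lemma quad_val_W_point:
  assumes "consec v u w"
  shows "quad_val (pt (u, v)) (pt (w, u)) W1 = 0" "quad_val (pt (u, v)) (pt (w, u)) W2 = 0"
proof -
  show "quad_val (pt (u, v)) (pt (w, u)) W1 = 0"
    by (simp add: W1_def quad_val_pt)
  have "quad_val (pt (u, v)) (pt (w, u)) W2 = 4 * (u * ((v + w) * inverse \<nu> - u + \<alpha> * u * v * w))"
    by (simp add: W2_def quad_val_pt divide_inverse) (simp add: algebra_simps)
  also have "(v + w) * inverse \<nu> - u + \<alpha> * u * v * w = inverse \<nu> * (v + w + \<alpha> * \<nu> * u * v * w - \<nu> * u)"
    using \<nu>_neq by (simp add: field_simps)
  finally show "quad_val (pt (u, v)) (pt (w, u)) W2 = 0"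
    using assms by (simp add: consec_def)
qed

text \<open>Here \<open>v, u, w\<close> and \<open>z, x, y\<close> are consecutive coordinates along two orbits of \<open>nxt\<close>.\<close>

definition slope :: "'k \<Rightarrow> 'k \<Rightarrow> 'k" where
  "slope u x = (x - u) * (1 - \<alpha> * \<alpha>) / (den u * den x)"

text \<open>Sum and product of the two neighbours are rational functions of the middle coordinate,
  so each difference is divisible by \<open>x - u\<close>. All three share the factor
  \<open>slope u x\<close>, and this is why the relations cancel on a line.\<close>

lemma line_identities:
  assumes "consec v u w" "consec z x y" "den u \<noteq> 0" "den x \<noteq> 0"
  shows "y + z - (v + w) = \<nu> * slope u x * (1 - \<alpha> * u * x)"
    and "y * z - v * w = slope u x * (x + u)"
    and "y * z * (v + w) - v * w * (y + z) = \<nu> * slope u x * (x * u - \<alpha>)"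
proof -
  have s: "v + w = \<kappa> * u / den u" "y + z = \<kappa> * x / den x"
    using consec_sum[OF assms(1)] consec_sum[OF assms(2)] assms(3,4) by (simp_all add: field_simps)
  have m: "v * w = (u * u + \<alpha>) / den u" "y * z = (x * x + \<alpha>) / den x"
    using consec_prod[OF assms(1)] consec_prod[OF assms(2)] assms(3,4) by (simp_all add: field_simps)
  have n: "den u * den x \<noteq> 0" using assms by simp
  show "y + z - (v + w) = \<nu> * slope u x * (1 - \<alpha> * u * x)"
    unfolding s slope_def using assms(3,4)
    by (simp add: divide_simps) (simp add: den_def \<kappa>_def algebra_simps)
  show "y * z - v * w = slope u x * (x + u)"
    unfolding m slope_def using assms(3,4)
    by (simp add: divide_simps) (simp add: den_def \<kappa>_def algebra_simps)
  show "y * z * (v + w) - v * w * (y + z) = \<nu> * slope u x * (x * u - \<alpha>)"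
    unfolding m s slope_def using assms(3,4)
    by (simp add: divide_simps) (simp add: den_def \<kappa>_def algebra_simps)
qed

text \<open>The condition at one square of the lattice that carries a line module: a step along one
  orbit and a backward step along the other, in either order. The factors \<open>v - z\<close> and
  \<open>w - y\<close> are the reciprocals of the weights \<open>wt\<close> at the opposite ends,
  after clearing denominators.\<close>

lemma quad_val_rels_line:
  assumes "consec v u w" "consec z x y" "den u \<noteq> 0" "den x \<noteq> 0" "r \<in> sklyanin_rels \<alpha> \<beta> \<gamma>"
  shows "(v - z) * quad_val (pt (w, u)) (pt (x, y)) r + (w - y) * quad_val (pt (z, x)) (pt (u, v)) r = 0"
proof (rule quad_val_rels_eq_0I[OF assms(5)])
  fix r assume "r \<in> {r1, r2, r3, r4, r5, r6}"
  note id = line_identities[OF assms(1-4)]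
  let ?L = "\<lambda>r. (v - z) * quad_val (pt (w, u)) (pt (x, y)) r + (w - y) * quad_val (pt (z, x)) (pt (u, v)) r"
  have "?L r1 = 0" "?L r2 = 0" "?L r3 = 0"
    by (simp_all add: quad_val_pt algebra_simps)
  moreover have "?L r4 = - 4 * ((1 - \<alpha> * u * x) * (y * z * (v + w) - v * w * (y + z))
      + (\<alpha> - x * u) * (y + z - (v + w)))"
    by (simp add: quad_val_pt algebra_simps)
  then have "?L r4 = 0"
    unfolding id by (simp add: algebra_simps)
  moreover have "?L r5 = - 4 * (\<nu> * (x * u - \<alpha>) * (y * z - v * w)
      - (x + u) * (y * z * (v + w) - v * w * (y + z)))"
    by (simp add: quad_val_pt algebra_simps)
  then have "?L r5 = 0"
    unfolding id by (simp add: algebra_simps)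
  moreover have "?L r6 = - 4 * ((x + u) * (y + z - (v + w)) - \<nu> * (1 - \<alpha> * u * x) * (y * z - v * w))"
    by (simp add: quad_val_pt algebra_simps)
  then have "?L r6 = 0"
    unfolding id by (simp add: algebra_simps)
  ultimately show "?L r = 0"
    using \<open>r \<in> _\<close> by auto
qed

text \<open>Unlike at points, the quadrics need not vanish on a line. The explicit values serve to
  show that their ratio varies with the second point.\<close>

lemma quad_val_W_line:
  assumes "consec v u w" "consec z x y" "den u \<noteq> 0" "den x \<noteq> 0"
  shows "(v - z) * quad_val (pt (w, u)) (pt (x, y)) W1 + (w - y) * quad_val (pt (z, x)) (pt (u, v)) W1
      = - 4 * ((x - u) * ((w - y) * (z - v)))"
    and "(v - z) * quad_val (pt (w, u)) (pt (x, y)) W2 + (w - y) * quad_val (pt (z, x)) (pt (u, v)) W2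
      = - 4 * (slope u x * ((x + u) * (x + u) * inverse \<nu> - \<nu> * (1 - \<alpha> * u * x) * (x * u - \<alpha>)))"
proof -
  note id = line_identities[OF assms(1-4)]
  show "(v - z) * quad_val (pt (w, u)) (pt (x, y)) W1 + (w - y) * quad_val (pt (z, x)) (pt (u, v)) W1
      = - 4 * ((x - u) * ((w - y) * (z - v)))"
    by (simp add: W1_def quad_val_pt algebra_simps)
  have "(v - z) * quad_val (pt (w, u)) (pt (x, y)) W2 + (w - y) * quad_val (pt (z, x)) (pt (u, v)) W2
    = - 4 * ((x + u) * inverse \<nu> * (y * z - v * w)
       - (1 - \<alpha> * u * x) * (y * z * (v + w) - v * w * (y + z)))"
    by (simp add: W2_def quad_val_pt divide_inverse) (simp add: algebra_simps)
  then show "(v - z) * quad_val (pt (w, u)) (pt (x, y)) W2 + (w - y) * quad_val (pt (z, x)) (pt (u, v)) W2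
      = - 4 * (slope u x * ((x + u) * (x + u) * inverse \<nu> - \<nu> * (1 - \<alpha> * u * x) * (x * u - \<alpha>)))"
    unfolding id by (simp add: algebra_simps)
qed

end

lemma infinite_UNIV_alg_closed: "infinite (UNIV :: 'k::alg_closed_field set)"
proof
  assume fin: "finite (UNIV :: 'k set)"
  define p :: "'k poly" where "p = (\<Prod>a\<in>UNIV. [:- a, 1:]) + 1"
  have "degree (\<Prod>a\<in>UNIV. [:- a, 1:] :: 'k poly) = card (UNIV :: 'k set)"
    by (subst degree_prod_eq_sum_degree) auto
  moreover have "card (UNIV :: 'k set) > 0"
    using fin by (simp add: card_gt_0_iff)
  ultimately have "degree p > 0"
    unfolding p_def by (subst degree_add_eq_left) auto
  then obtain x where "poly p x = 0"
    using alg_closed_imp_poly_has_root by blast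
  moreover have "poly p x = 1"
    using fin by (auto simp: p_def poly_prod)
  ultimately show False by simp
qed

text \<open>The order of vanishing at \<open>r\<close> is even on the left of the equation and odd
  on the right.\<close>

lemma not_square_times_simple_root:
  fixes s q d :: "'a::idom poly"
  assumes "s * s = q * q * d" "q \<noteq> 0" "d = [:- r, 1:] * g" "poly g r \<noteq> 0"
  shows False
proof -
  have g: "g \<noteq> 0" using assms(4) by auto
  then have d: "d \<noteq> 0" unfolding assms(3) using no_zero_divisors[of "[:- r, 1:]" g] by simp
  then have s: "s \<noteq> 0" using assms(1,2) by auto
  have "order r [:- r, 1:] = 1"
    using order_power_n_n[of r 1] by simp
  moreover have "order r g = 0"
    using assms(4) g by (simp add: order_eq_0_iff)
  ultimately have "order r d = 1"
    using d unfolding assms(3) by (subst order_mult) auto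
  moreover have "order r (s * s) = order r s + order r s"
    using s by (simp add: order_mult)
  moreover have "order r (q * q * d) = order r q + order r q + order r d"
    using assms(2) d by (simp add: order_mult)
  ultimately have "2 * order r s = 2 * order r q + 1"
    using assms(1) by simp
  then show False by presburger
qed

context sklyanin_setup
begin

section \<open>Finiteness on the curve\<close>

lemma \<kappa>_neq: "\<kappa> \<noteq> 0"
proof -
  have "1 - \<alpha> * \<alpha> = (1 - \<alpha>) * (1 + \<alpha>)" by (simp add: algebra_simps)
  then show ?thesis using \<alpha>_neq \<nu>_neq by (simp add: \<kappa>_def)
qed

text \<open>Smoothness of the curve. Equality would make (1 - \<alpha>)\<nu> or (1 + \<alpha>)\<nu>
  equal to 2 or -2, and the equations for \<nu> would then force \<gamma> = 0 or \<beta> = 0, or 4 =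
  0.\<close>

lemma \<kappa>_square_neq: "\<kappa> * \<kappa> \<noteq> 4 * (1 + \<alpha>) * (1 + \<alpha>)" "\<kappa> * \<kappa> \<noteq> 4 * (1 - \<alpha>) * (1 - \<alpha>)"
proof -
  have sq: False if "c * \<nu> * (c * \<nu>) = 4" "c * \<nu> * (1 + s) = 2 * (1 - s)" "s \<noteq> 0" for c s
  proof -
    have "(c * \<nu> - 2) * (c * \<nu> + 2) = 0"
      using that(1) by (simp add: algebra_simps)
    then have "c * \<nu> = 2 \<or> c * \<nu> = - 2"
      by (auto simp: eq_neg_iff_add_eq_0)
    then have "2 * (2 * s) = 0 \<or> 2 * 2 = (0::'k)"
    proof
      assume "c * \<nu> = 2"
      with that(2) have "2 * (1 + s) - 2 * (1 - s) = 0" by simp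
      then show ?thesis by (simp add: algebra_simps)
    next
      assume "c * \<nu> = - 2"
      with that(2) have "2 * (1 - s) + 2 * (1 + s) = 0" by simp
      then show ?thesis by (simp add: algebra_simps)
    qed
    then show False using two_neq_0 that(3) by (metis mult_eq_0_iff)
  qed
  have k: "\<kappa> = (1 + \<alpha>) * ((1 - \<alpha>) * \<nu>)" "\<kappa> = (1 - \<alpha>) * ((1 + \<alpha>) * \<nu>)"
    by (simp_all add: \<kappa>_def algebra_simps)
  show "\<kappa> * \<kappa> \<noteq> 4 * (1 + \<alpha>) * (1 + \<alpha>)"
  proof
    assume "\<kappa> * \<kappa> = 4 * (1 + \<alpha>) * (1 + \<alpha>)"
    then have "(1 + \<alpha>) * ((1 + \<alpha>) * ((1 - \<alpha>) * \<nu> * ((1 - \<alpha>) * \<nu>))) = (1 + \<alpha>) * ((1 + \<alpha>) * 4)"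
      unfolding k(1) by (simp only: mult_ac)
    then have "(1 - \<alpha>) * \<nu> * ((1 - \<alpha>) * \<nu>) = 4"
      using \<alpha>_neq by (metis mult_left_cancel)
    then show False
      by (rule sq[of _ "- \<gamma>"]) (use \<nu>_eq' \<gamma>_neq in \<open>simp_all add: mult_ac\<close>)
  qed
  show "\<kappa> * \<kappa> \<noteq> 4 * (1 - \<alpha>) * (1 - \<alpha>)"
  proof
    assume "\<kappa> * \<kappa> = 4 * (1 - \<alpha>) * (1 - \<alpha>)"
    then have "(1 - \<alpha>) * ((1 - \<alpha>) * ((1 + \<alpha>) * \<nu> * ((1 + \<alpha>) * \<nu>))) = (1 - \<alpha>) * ((1 - \<alpha>) * 4)"
      unfolding k(2) by (simp only: mult_ac)
    then have "(1 + \<alpha>) * \<nu> * ((1 + \<alpha>) * \<nu>) = 4"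
      using \<alpha>_neq by (metis mult_left_cancel)
    then show False
      by (rule sq[of _ "\<beta>"]) (use \<nu>_eq \<beta>_neq in \<open>simp_all add: mult_ac\<close>)
  qed
qed

definition den_poly :: "'k poly" where "den_poly = [:1, 0, \<alpha>:]"

lemma poly_den_poly [simp]: "poly den_poly u = den u"
  by (simp add: den_poly_def den_def algebra_simps)

lemma den_poly_neq [simp]: "den_poly \<noteq> 0"
  by (simp add: den_poly_def)

lemma finite_den_zeros: "finite {u. den u = 0}"
  using poly_roots_finite[OF den_poly_neq] by simp

lemma finite_fibre: "finite {v. (u, v) \<in> curve}"
proof -
  let ?p = "[:u * u + \<alpha>, - (\<kappa> * u), den u:]"
  have "?p \<noteq> 0"
    using \<kappa>_neq by (auto simp: den_def)
  moreover have "{v. (u, v) \<in> curve} \<subseteq> {v. poly ?p v = 0}"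
    by (auto simp: curve_iff algebra_simps)
  ultimately show ?thesis
    using poly_roots_finite finite_subset by blast
qed

lemma finite_curve_fst: "finite U \<Longrightarrow> finite {P \<in> curve. fst P \<in> U}"
  by (rule finite_subset[of _ "\<Union>u\<in>U. Pair u ` {v. (u, v) \<in> curve}"]) (auto simp: finite_fibre)

text \<open>This is \<open>den_poly\<close> times the norm of p + q v. The conjugate of v is the
  other root over u, so sum and product of the conjugates are \<kappa> u / den(u) and (u^2 +
  \<alpha>) / den(u).\<close>

definition norm_poly :: "'k poly \<Rightarrow> 'k poly \<Rightarrow> 'k poly" where
  "norm_poly p q = den_poly * p * p + [:0, \<kappa>:] * p * q + [:\<alpha>, 0, 1:] * q * q"

text \<open>The norm form of the quadratic extension \<open>k(u)(v)\<close> is anisotropic, because its discriminant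
  has a simple root.\<close>

lemma norm_poly_neq_0:
  assumes "p \<noteq> 0 \<or> q \<noteq> 0"
  shows "norm_poly p q \<noteq> 0"
proof
  assume N: "norm_poly p q = 0"
  define b where "b = \<kappa> * \<kappa> - 4 - 4 * \<alpha> * \<alpha>"
  define e where "e = - 4 * \<alpha>"
  define d where "d = [:e, 0, b, 0, e:]"
  have e: "e \<noteq> 0" using four_neq_0 \<alpha>_neq by (simp add: e_def)
  have q: "q \<noteq> 0"
  proof
    assume "q = 0"
    with N have "den_poly * p * p = 0" by (simp add: norm_poly_def)
    with \<open>q = 0\<close> assms show False by simp
  qed
  have d_eq: "d = [:0, \<kappa>:] * [:0, \<kappa>:] - smult 4 (den_poly * [:\<alpha>, 0, 1:])"
    by (simp add: d_def den_poly_def e_def b_def algebra_simps)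
  \<comment> \<open>Completing the square: \<open>d\<close> is the discriminant of the quadratic
    satisfied by v, and a vanishing norm would make \<open>d\<close> times a nonzero square again a
    square.\<close>
  define s where "s = smult 2 (den_poly * p) + [:0, \<kappa>:] * q"
  have "s * s = smult 4 (den_poly * norm_poly p q) + q * q * d"
    unfolding s_def d_eq norm_poly_def by (simp add: algebra_simps smult_add_right numeral_poly)
  then have s: "s * s = q * q * d" using N by simp
  have "degree d > 0"
    using e by (simp add: d_def)
  then obtain r where r: "poly d r = 0"
    using alg_closed_imp_poly_has_root by blast
  then have r': "e + r * (r * (b + r * (r * e))) = 0"
    by (simp add: d_def)
  then have r0: "r \<noteq> 0" using e by auto
  define g where "g = [:b * r + e * r * r * r, b + e * r * r, e * r, e:]"
  have dg: "d = [:- r, 1:] * g"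
    using r' by (simp add: d_def g_def algebra_simps eq_neg_iff_add_eq_0)
  \<comment> \<open>A double root \<open>r\<close> of e X^4 + b X^2 + e satisfies r^4 = 1, since the
    first and last coefficients agree. Then b = -2e or b = 2e, which are the two values excluded by
    smoothness.\<close>
  have "poly g r \<noteq> 0"
  proof
    assume "poly g r = 0"
    then have "2 * (r * (b + 2 * e * r * r)) = 0"
      by (simp add: g_def algebra_simps)
    then have b: "b = - 2 * e * r * r"
      using two_neq_0 r0 by (simp add: eq_neg_iff_add_eq_0)
    have "e * ((1 - r * r) * (1 + r * r)) = e + r * (r * (b + r * (r * e)))"
      unfolding b by (simp add: algebra_simps)
    then have "(1 - r * r) * (1 + r * r) = 0"
      using r' e by simp
    then have "r * r = 1 \<or> r * r = - 1"
      by (auto simp: eq_neg_iff_add_eq_0 add.commute)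
    moreover have "b = - 2 * e * (r * r)" using b by (simp add: mult.assoc)
    ultimately have "b = - 2 * e \<or> b = 2 * e" by auto
    then have "\<kappa> * \<kappa> = 4 * (1 + \<alpha>) * (1 + \<alpha>) \<or> \<kappa> * \<kappa> = 4 * (1 - \<alpha>) * (1 - \<alpha>)"
      by (auto simp: b_def e_def algebra_simps)
    then show False using \<kappa>_square_neq by blast
  qed
  then show False
    using not_square_times_simple_root[OF s q dg] by blast
qed

lemma norm_poly_eval:
  assumes "(u, v) \<in> curve"
  shows "(poly p u + poly q u * v) * (poly (den_poly * p + [:0, \<kappa>:] * q) u - poly (den_poly * q) u * v)
    = poly (norm_poly p q) u"
proof -
  have "(poly p u + poly q u * v) * (poly (den_poly * p + [:0, \<kappa>:] * q) u - poly (den_poly * q) u * v)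
    - poly (norm_poly p q) u = poly q u * poly q u * (\<kappa> * u * v - den u * v * v - (u * u + \<alpha>))"
    by (simp add: norm_poly_def algebra_simps)
  then show ?thesis using assms by (simp add: curve_iff)
qed

lemma finite_zeros:
  assumes "p \<noteq> 0 \<or> q \<noteq> 0"
  shows "finite {P \<in> curve. poly p (fst P) + poly q (fst P) * snd P = 0}"
proof (rule finite_subset)
  show "{P \<in> curve. poly p (fst P) + poly q (fst P) * snd P = 0}
     \<subseteq> {P \<in> curve. fst P \<in> {u. poly (norm_poly p q) u = 0}}"
  proof safe
    fix u v assume "(u, v) \<in> curve" "poly p (fst (u, v)) + poly q (fst (u, v)) * snd (u, v) = 0"
    then show "poly (norm_poly p q) (fst (u, v)) = 0"
      using norm_poly_eval[of u v p q] by simp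
  qed
  show "finite {P \<in> curve. fst P \<in> {u. poly (norm_poly p q) u = 0}}"
    using poly_roots_finite[OF norm_poly_neq_0[OF assms]] by (rule finite_curve_fst)
qed

lemma infinite_curve: "infinite curve"
proof
  assume "finite curve"
  then have "finite (fst ` curve \<union> {u. den u = 0})"
    using finite_den_zeros by simp
  then obtain u where "u \<notin> fst ` curve \<union> {u. den u = 0}"
    using ex_new_if_finite[OF infinite_UNIV_alg_closed] by blast
  then have u: "u \<notin> fst ` curve" "den u \<noteq> 0" by auto
  have "degree [:u * u + \<alpha>, - (\<kappa> * u), den u:] > 0"
    using u(2) by simp
  then obtain v where "poly [:u * u + \<alpha>, - (\<kappa> * u), den u:] v = 0"
    using alg_closed_imp_poly_has_root by blast
  then have "(u, v) \<in> curve"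
    by (simp add: curve_iff algebra_simps)
  then show False using u(1) by force
qed

section \<open>Properties of all but finitely many points of the curve\<close>

definition ae :: "('k \<times> 'k \<Rightarrow> bool) \<Rightarrow> bool" where
  "ae \<Phi> \<longleftrightarrow> finite {P \<in> curve. \<not> \<Phi> P}"

lemma ae_mono: "ae \<Phi> \<Longrightarrow> (\<And>P. P \<in> curve \<Longrightarrow> \<Phi> P \<Longrightarrow> \<Psi> P) \<Longrightarrow> ae \<Psi>"
  unfolding ae_def by (rule finite_subset) auto

lemma ae_all: "(\<And>P. P \<in> curve \<Longrightarrow> \<Phi> P) \<Longrightarrow> ae \<Phi>"
  unfolding ae_def by (metis (mono_tags, lifting) empty_Collect_eq finite.emptyI)

lemma ae_conj: "ae \<Phi> \<Longrightarrow> ae \<Psi> \<Longrightarrow> ae (\<lambda>P. \<Phi> P \<and> \<Psi> P)"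
proof -
  assume "ae \<Phi>" "ae \<Psi>"
  then have "finite ({P \<in> curve. \<not> \<Phi> P} \<union> {P \<in> curve. \<not> \<Psi> P})"
    by (simp add: ae_def)
  then show ?thesis
    unfolding ae_def by (rule rev_finite_subset) auto
qed

lemma ae_ball: "finite S \<Longrightarrow> (\<And>s. s \<in> S \<Longrightarrow> ae (\<Phi> s)) \<Longrightarrow> ae (\<lambda>P. \<forall>s\<in>S. \<Phi> s P)"
proof (induction S rule: finite_induct)
  case (insert s S)
  then have "ae (\<lambda>P. \<Phi> s P \<and> (\<forall>s\<in>S. \<Phi> s P))" by (intro ae_conj) auto
  then show ?case by (rule ae_mono) auto
qed (simp add: ae_all)

lemma ae_ex: "ae \<Phi> \<Longrightarrow> \<exists>P\<in>curve. \<Phi> P"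
  unfolding ae_def using infinite_curve by (metis (mono_tags, lifting) Collect_mem_eq Collect_mono finite_subset mem_Collect_eq)

lemma ae_neq_0: "p \<noteq> 0 \<or> q \<noteq> 0 \<Longrightarrow> ae (\<lambda>P. poly p (fst P) + poly q (fst P) * snd P \<noteq> 0)"
  unfolding ae_def using finite_zeros by simp

lemma ae_fst_notin: "finite U \<Longrightarrow> ae (\<lambda>P. fst P \<notin> U)"
  unfolding ae_def using finite_curve_fst by simp

lemma ae_den: "ae (\<lambda>P. den (fst P) \<noteq> 0)"
  using ae_fst_notin[OF finite_den_zeros] by simp

lemma ae_inj:
  assumes "ae \<Phi>" "inj f" "\<And>P. P \<in> curve \<Longrightarrow> f P \<in> curve"
  shows "ae (\<lambda>P. \<Phi> (f P))"
proof -
  have "finite (f -` {P \<in> curve. \<not> \<Phi> P})"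
    using assms(1,2) by (intro finite_vimageI) (auto simp: ae_def)
  then show ?thesis
    unfolding ae_def by (rule rev_finite_subset) (use assms(3) in auto)
qed

definition swp :: "'k \<times> 'k \<Rightarrow> 'k \<times> 'k" where "swp P = (snd P, fst P)"

definition neg :: "'k \<times> 'k \<Rightarrow> 'k \<times> 'k" where "neg P = (- fst P, - snd P)"

lemma swp_curve: "P \<in> curve \<Longrightarrow> swp P \<in> curve"
  using curve_swap by (cases P) (auto simp: swp_def)

lemma neg_curve: "P \<in> curve \<Longrightarrow> neg P \<in> curve"
  using curve_minus by (cases P) (auto simp: neg_def)

lemma ae_swp: "ae \<Phi> \<Longrightarrow> ae (\<lambda>P. \<Phi> (swp P))"
  by (rule ae_inj) (auto simp: swp_def swp_curve[unfolded swp_def] inj_on_def prod_eq_iff)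

lemma ae_neg: "ae \<Phi> \<Longrightarrow> ae (\<lambda>P. \<Phi> (neg P))"
  by (rule ae_inj) (auto simp: neg_def neg_curve[unfolded neg_def] inj_on_def prod_eq_iff)

text \<open>The second coordinate of \<open>nxt P\<close> is the first coordinate of
  \<open>P\<close>. A point mapped into a finite set therefore has its first coordinate in a finite
  set, and the fibres over it are finite.\<close>

lemma ae_nxt:
  assumes "ae \<Phi>"
  shows "ae (\<lambda>P. \<Phi> (nxt P))"
proof -
  have "finite {P \<in> curve. fst P \<in> snd ` {P \<in> curve. \<not> \<Phi> P}}"
    using assms by (intro finite_curve_fst) (simp add: ae_def)
  then have "ae (\<lambda>P. fst P \<notin> snd ` {P \<in> curve. \<not> \<Phi> P})"
    by (simp add: ae_def)
  then have "ae (\<lambda>P. fst P \<notin> snd ` {P \<in> curve. \<not> \<Phi> P} \<and> den (fst P) \<noteq> 0)"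
    using ae_den by (rule ae_conj)
  then show ?thesis
  proof (rule ae_mono)
    fix P assume P: "P \<in> curve" "fst P \<notin> snd ` {P \<in> curve. \<not> \<Phi> P} \<and> den (fst P) \<noteq> 0"
    have "snd (nxt P) = fst P" by (simp add: nxt_def)
    then show "\<Phi> (nxt P)"
      using P nxt_curve[of P] by (metis (mono_tags, lifting) imageI mem_Collect_eq)
  qed
qed

text \<open>The swap conjugates \<open>nxt\<close> into its inverse. This is true even where
  \<open>den\<close> vanishes, because the quotient cancels whatever its value.\<close>

lemma nxt_swp_nxt: "nxt (swp (nxt (swp P))) = P"
  by (simp add: nxt_def swp_def prod_eq_iff)

lemma ae_nxt_rev:
  assumes "ae (\<lambda>P. \<Phi> (nxt P))"
  shows "ae \<Phi>"
proof -
  have "ae (\<lambda>P. \<Phi> (nxt (swp (nxt (swp P)))))"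
    using ae_swp[OF ae_nxt[OF ae_swp[OF assms]]] by simp
  then show ?thesis unfolding nxt_swp_nxt .
qed

definition orb :: "nat \<Rightarrow> 'k \<times> 'k \<Rightarrow> 'k \<times> 'k" where "orb n = nxt ^^ n"

lemma orb_0 [simp]: "orb 0 P = P" and orb_Suc: "orb (Suc n) P = nxt (orb n P)"
  and orb_Suc': "orb (Suc n) P = orb n (nxt P)" and orb_add: "orb (m + n) P = orb m (orb n P)"
  by (simp_all add: orb_def funpow_swap1 funpow_add)

lemma ae_orb: "ae \<Phi> \<Longrightarrow> ae (\<lambda>P. \<Phi> (orb n P))"
proof (induction n arbitrary: \<Phi>)
  case (Suc n)
  then show ?case using ae_nxt[OF Suc.IH[of \<Phi>]] by (simp add: orb_Suc')
qed simp

lemma ae_orb_le: "ae \<Phi> \<Longrightarrow> ae (\<lambda>P. \<forall>j\<le>n. \<Phi> (orb j P))"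
  using ae_ball[of "{..n}" "\<lambda>j P. \<Phi> (orb j P)"] ae_orb[of \<Phi>] by (simp add: Ball_def)

section \<open>Rational functions on the curve\<close>

definition ratl :: "('k \<times> 'k \<Rightarrow> 'k) \<Rightarrow> bool" where
  "ratl \<phi> \<longleftrightarrow> (\<exists>p q d. d \<noteq> 0 \<and>
     ae (\<lambda>P. poly d (fst P) * \<phi> P = poly p (fst P) + poly q (fst P) * snd P))"

text \<open>The substitute for irreducibility of the curve: a nonzero element of the field k(u)(v)
  has finitely many zeros, by the norm. It turns "not almost everywhere" into "almost nowhere" for
  identities between rational functions.\<close>

lemma ratl_dichotomy: "ratl \<phi> \<Longrightarrow> ae (\<lambda>P. \<phi> P = 0) \<or> ae (\<lambda>P. \<phi> P \<noteq> 0)"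
proof -
  assume "ratl \<phi>"
  then obtain p q d where d: "d \<noteq> 0"
    and eq: "ae (\<lambda>P. poly d (fst P) * \<phi> P = poly p (fst P) + poly q (fst P) * snd P)"
    unfolding ratl_def by blast
  show ?thesis
  proof (cases "p \<noteq> 0 \<or> q \<noteq> 0")
    case True
    have "ae (\<lambda>P. \<phi> P \<noteq> 0)"
      using ae_conj[OF eq ae_neq_0[OF True]] by (rule ae_mono) auto
    then show ?thesis ..
  next
    case False
    have "ae (\<lambda>P. \<phi> P = 0)"
      using ae_conj[OF eq ae_neq_0[of d 0]] d False by (auto intro: ae_mono)
    then show ?thesis ..
  qed
qed

lemma ratl_const: "ratl (\<lambda>_. c)"
  unfolding ratl_def by (intro exI[of _ "[:c:]"] exI[of _ 0] exI[of _ 1] conjI ae_all) auto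

lemma ratl_fst: "ratl fst"
  unfolding ratl_def by (intro exI[of _ "[:0, 1:]"] exI[of _ 0] exI[of _ 1] conjI ae_all) auto

lemma ratl_snd: "ratl snd"
  unfolding ratl_def by (intro exI[of _ 0] exI[of _ 1] exI[of _ 1] conjI ae_all) auto

lemma ratl_add:
  assumes "ratl \<phi>" "ratl \<psi>"
  shows "ratl (\<lambda>P. \<phi> P + \<psi> P)"
proof -
  obtain p q d p' q' d' where d: "d \<noteq> 0" "d' \<noteq> 0"
    and 1: "ae (\<lambda>P. poly d (fst P) * \<phi> P = poly p (fst P) + poly q (fst P) * snd P)"
    and 2: "ae (\<lambda>P. poly d' (fst P) * \<psi> P = poly p' (fst P) + poly q' (fst P) * snd P)"
    using assms unfolding ratl_def by blast
  have "ae (\<lambda>P. poly (d * d') (fst P) * (\<phi> P + \<psi> P)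
      = poly (d' * p + d * p') (fst P) + poly (d' * q + d * q') (fst P) * snd P)"
    using ae_conj[OF 1 2]
  proof (rule ae_mono)
    fix P
    assume e: "poly d (fst P) * \<phi> P = poly p (fst P) + poly q (fst P) * snd P \<and>
         poly d' (fst P) * \<psi> P = poly p' (fst P) + poly q' (fst P) * snd P"
    have "poly (d * d') (fst P) * (\<phi> P + \<psi> P)
      = poly d' (fst P) * (poly d (fst P) * \<phi> P) + poly d (fst P) * (poly d' (fst P) * \<psi> P)"
      by (simp add: algebra_simps)
    also have "\<dots> = poly d' (fst P) * (poly p (fst P) + poly q (fst P) * snd P)
        + poly d (fst P) * (poly p' (fst P) + poly q' (fst P) * snd P)"
      using e by simp
    finally show "poly (d * d') (fst P) * (\<phi> P + \<psi> P)
      = poly (d' * p + d * p') (fst P) + poly (d' * q + d * q') (fst P) * snd P"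
      by (simp add: algebra_simps)
  qed
  moreover have "d * d' \<noteq> 0" using d by simp
  ultimately show ?thesis unfolding ratl_def by blast
qed

lemma ratl_mult:
  assumes "ratl \<phi>" "ratl \<psi>"
  shows "ratl (\<lambda>P. \<phi> P * \<psi> P)"
proof -
  obtain p q d p' q' d' where d: "d \<noteq> 0" "d' \<noteq> 0"
    and 1: "ae (\<lambda>P. poly d (fst P) * \<phi> P = poly p (fst P) + poly q (fst P) * snd P)"
    and 2: "ae (\<lambda>P. poly d' (fst P) * \<psi> P = poly p' (fst P) + poly q' (fst P) * snd P)"
    using assms unfolding ratl_def by blast
  \<comment> \<open>The product contains v^2, which the equation of the curve replaces by \<kappa> u
    v - (u^2 + \<alpha>) over den(u); hence the extra factor \<open>den_poly\<close>.\<close>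
  have "ae (\<lambda>P. poly (den_poly * (d * d')) (fst P) * (\<phi> P * \<psi> P)
      = poly (den_poly * (p * p') - [:\<alpha>, 0, 1:] * (q * q')) (fst P)
        + poly (den_poly * (p * q' + q * p') + [:0, \<kappa>:] * (q * q')) (fst P) * snd P)"
    using ae_conj[OF 1 2]
  proof (rule ae_mono)
    fix P
    assume P: "P \<in> curve"
    assume e: "poly d (fst P) * \<phi> P = poly p (fst P) + poly q (fst P) * snd P \<and>
         poly d' (fst P) * \<psi> P = poly p' (fst P) + poly q' (fst P) * snd P"
    obtain u v where uv: "P = (u, v)" by (cases P)
    have c: "\<kappa> * u * v - den u * v * v = u * u + \<alpha>"
      using P by (simp add: uv curve_iff)
    have "poly (den_poly * (d * d')) (fst P) * (\<phi> P * \<psi> P)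
      = den u * ((poly d (fst P) * \<phi> P) * (poly d' (fst P) * \<psi> P))"
      by (simp add: uv algebra_simps)
    also have "\<dots> = den u * ((poly p u + poly q u * v) * (poly p' u + poly q' u * v))"
      using e by (simp add: uv)
    also have "\<dots> = poly (den_poly * (p * p') - [:\<alpha>, 0, 1:] * (q * q')) u
        + poly (den_poly * (p * q' + q * p') + [:0, \<kappa>:] * (q * q')) u * v
        - poly q u * poly q' u * ((\<kappa> * u * v - den u * v * v) - (u * u + \<alpha>))"
      by (simp add: algebra_simps)
    finally show "poly (den_poly * (d * d')) (fst P) * (\<phi> P * \<psi> P)
      = poly (den_poly * (p * p') - [:\<alpha>, 0, 1:] * (q * q')) (fst P)
        + poly (den_poly * (p * q' + q * p') + [:0, \<kappa>:] * (q * q')) (fst P) * snd P"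
      by (simp add: uv c)
  qed
  moreover have "den_poly * (d * d') \<noteq> 0" using d by simp
  ultimately show ?thesis unfolding ratl_def by blast
qed

lemma ratl_inverse:
  assumes "ratl \<phi>"
  shows "ratl (\<lambda>P. inverse (\<phi> P))"
proof -
  obtain p q d where d: "d \<noteq> 0"
    and 1: "ae (\<lambda>P. poly d (fst P) * \<phi> P = poly p (fst P) + poly q (fst P) * snd P)"
    using assms unfolding ratl_def by blast
  show ?thesis
  proof (cases "p \<noteq> 0 \<or> q \<noteq> 0")
    case True
    have "ae (\<lambda>P. poly (norm_poly p q) (fst P) * inverse (\<phi> P)
      = poly (d * (den_poly * p + [:0, \<kappa>:] * q)) (fst P) + poly (- (d * den_poly * q)) (fst P) * snd P)"
      using ae_conj[OF 1 ae_neq_0[OF True]]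
    proof (rule ae_mono)
      fix P
      assume P: "P \<in> curve"
      assume e: "poly d (fst P) * \<phi> P = poly p (fst P) + poly q (fst P) * snd P \<and>
         poly p (fst P) + poly q (fst P) * snd P \<noteq> 0"
      obtain u v where uv: "P = (u, v)" by (cases P)
      have "\<phi> P \<noteq> 0" using e by auto
      moreover have "poly (norm_poly p q) u = poly d u * \<phi> P * (poly (den_poly * p + [:0, \<kappa>:] * q) u - poly (den_poly * q) u * v)"
        using norm_poly_eval[of u v p q] P e by (simp add: uv)
      ultimately have "poly (norm_poly p q) u * inverse (\<phi> P)
          = poly d u * (poly (den_poly * p + [:0, \<kappa>:] * q) u - poly (den_poly * q) u * v)"
        by (simp add: mult_ac)
      then show "poly (norm_poly p q) (fst P) * inverse (\<phi> P)
        = poly (d * (den_poly * p + [:0, \<kappa>:] * q)) (fst P) + poly (- (d * den_poly * q)) (fst P) * snd P"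
        by (simp add: uv algebra_simps)
    qed
    then show ?thesis
      unfolding ratl_def using norm_poly_neq_0[OF True] by blast
  next
    case False
    have "ae (\<lambda>P. poly 1 (fst P) * inverse (\<phi> P) = poly 0 (fst P) + poly 0 (fst P) * snd P)"
      using ae_conj[OF 1 ae_neq_0[of d 0]] d False by (auto intro: ae_mono)
    then show ?thesis unfolding ratl_def using one_neq_zero by blast
  qed
qed

lemma ratl_diff: "ratl \<phi> \<Longrightarrow> ratl \<psi> \<Longrightarrow> ratl (\<lambda>P. \<phi> P - \<psi> P)"
  using ratl_add[OF _ ratl_mult[OF ratl_const[of "- 1"]], of \<phi> \<psi>] by simp

lemma ratl_orb: "ratl (\<lambda>P. fst (orb n P)) \<and> ratl (\<lambda>P. snd (orb n P))"
proof (induction n)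
  case 0
  show ?case using ratl_fst ratl_snd by (simp add: eta_contract_eq)
next
  case (Suc n)
  have "ratl (\<lambda>P. \<kappa> * fst (orb n P) * inverse (1 + \<alpha> * fst (orb n P) * fst (orb n P)) - snd (orb n P))"
    using Suc by (intro ratl_diff ratl_mult ratl_inverse ratl_add ratl_const) auto
  then show ?case
    using Suc by (simp add: orb_Suc nxt_def den_def divide_inverse)
qed

lemma orb_dichotomy: "ae (\<lambda>P. orb n P = P) \<or> ae (\<lambda>P. orb n P \<noteq> P)"
proof -
  have "ae (\<lambda>P. fst (orb n P) - fst P = 0) \<or> ae (\<lambda>P. fst (orb n P) - fst P \<noteq> 0)"
    using ratl_orb[of n] ratl_fst by (intro ratl_dichotomy ratl_diff) auto
  moreover have "ae (\<lambda>P. snd (orb n P) - snd P = 0) \<or> ae (\<lambda>P. snd (orb n P) - snd P \<noteq> 0)"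
    using ratl_orb[of n] ratl_snd by (intro ratl_dichotomy ratl_diff) auto
  ultimately consider "ae (\<lambda>P. fst (orb n P) - fst P \<noteq> 0)" | "ae (\<lambda>P. snd (orb n P) - snd P \<noteq> 0)"
    | "ae (\<lambda>P. fst (orb n P) - fst P = 0)" "ae (\<lambda>P. snd (orb n P) - snd P = 0)"
    by blast
  then show ?thesis
  proof cases
    case 3
    then have "ae (\<lambda>P. fst (orb n P) - fst P = 0 \<and> snd (orb n P) - snd P = 0)" by (rule ae_conj)
    then have "ae (\<lambda>P. orb n P = P)" by (rule ae_mono) (simp add: prod_eq_iff)
    then show ?thesis ..
  qed (auto intro: ae_mono)
qed

section \<open>Evaluation along orbits\<close>

primrec word_val :: "gen list \<Rightarrow> 'k \<times> 'k \<Rightarrow> 'k" where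
  "word_val [] P = 1"
| "word_val (x # w) P = pt P x * word_val w (nxt P)"

text \<open>The value in the twisted homogeneous coordinate ring of the curve: the successive
  letters of a word are evaluated at the successive points of the orbit of \<open>P\<close>. Hence
  the shift by \<open>orb m\<close> in \<open>ev_mult\<close>.\<close>

definition ev :: "'k \<times> 'k \<Rightarrow> 'k free_alg \<Rightarrow> 'k" where
  "ev P f = lin_fun (\<lambda>w. word_val w P) f"

lemma ev_linear:
  "ev P 0 = 0" "ev P (f + g) = ev P f + ev P g" "ev P (f - g) = ev P f - ev P g"
  "ev P (fconst c * f) = c * ev P f" "ev P (\<Sum>i\<in>S. F i) = (\<Sum>i\<in>S. ev P (F i))"
  by (simp_all add: ev_def lin_fun_add lin_fun_diff lin_fun_fconst_mult lin_fun_sum)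

lemma ev_fconst: "ev P (fconst c) = c"
  by (simp add: ev_def fconst_single)

lemma word_val_append: "word_val (w @ w') P = word_val w P * word_val w' (orb (length w) P)"
  by (induction w arbitrary: P) (simp_all add: orb_Suc')

lemma ev_mult:
  assumes "f \<in> hom_alg m"
  shows "ev P (f * g) = ev P f * ev (orb m P) g"
  using assms
proof (induction f rule: hom_alg_induct)
  case zero
  show ?case by (simp add: ev_linear)
next
  case (add f h)
  then show ?case by (simp add: ev_linear distrib_right)
next
  case (single c w)
  show ?case
    by (induction g rule: free_alg_induct)
      (simp_all add: ev_linear distrib_left ev_def[where f = "Poly_Mapping.single _ _"]
        single_Word_mult word_val_append single)
qed

lemma ev_hom_1: "f \<in> hom_alg 1 \<Longrightarrow> ev P f = lin_val (pt P) f"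
proof (induction f rule: hom_alg_induct)
  case (single c w)
  then show ?case
    by (cases w) (auto simp: ev_def lin_val_def)
qed (simp_all add: ev_linear lin_val_linear)

lemma ev_hom_2: "f \<in> hom_alg 2 \<Longrightarrow> ev P f = quad_val (pt P) (pt (nxt P)) f"
proof (induction f rule: hom_alg_induct)
  case (single c w)
  then obtain x x' where "w = [x, x']"
    by (auto simp: length_Suc_conv numeral_2_eq_2)
  then show ?case by (simp add: ev_def quad_val_def)
next
  case zero
  show ?case by (simp add: ev_linear quad_val_def)
qed (simp_all add: ev_linear quad_val_linear)

text \<open>Lying on the curve is demanded of \<open>P\<close> alone: as long as \<open>den\<close>
  does not vanish, \<open>nxt\<close> stays on it (\<open>regular_curve\<close>), and neighbours in
  the orbit are related by \<open>consec\<close>.\<close>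

definition regular :: "nat \<Rightarrow> 'k \<times> 'k \<Rightarrow> bool" where
  "regular n P \<longleftrightarrow> P \<in> curve \<and> (\<forall>j<n. den (fst (orb j P)) \<noteq> 0)"

lemma regular_curve: "regular n P \<Longrightarrow> j \<le> n \<Longrightarrow> orb j P \<in> curve"
  by (induction j) (auto simp: regular_def orb_Suc nxt_curve)

lemma regular_mono: "regular n P \<Longrightarrow> m \<le> n \<Longrightarrow> regular m P"
  by (auto simp: regular_def)

lemma regular_consec:
  assumes "regular n P" "j < n"
  shows "consec (snd (orb j P)) (fst (orb j P)) (fst (orb (Suc j) P))"
  using consec_nxt[of "fst (orb j P)" "snd (orb j P)"] regular_curve[OF assms(1), of j] assms
  by (simp add: orb_Suc regular_def)

lemma regular_nxt: "regular (Suc n) P \<Longrightarrow> regular n (nxt P)"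
  using regular_curve[of "Suc n" P "Suc 0"] by (auto simp: regular_def orb_Suc'[symmetric] orb_Suc[of 0, simplified])

lemma ae_regular: "ae (regular n)"
proof (rule ae_mono)
  show "ae (\<lambda>P. \<forall>j\<le>n. den (fst (orb j P)) \<noteq> 0)"
    using ae_orb_le[OF ae_den] .
qed (auto simp: regular_def)

lemma ev_rels: 
  assumes "regular 1 P" "r \<in> sklyanin_rels \<alpha> \<beta> \<gamma>"
  shows "ev P r = 0"
proof -
  have "consec (snd P) (fst P) (fst (nxt P))"
    using regular_consec[OF assms(1), of 0] by (simp add: orb_Suc)
  from quad_val_rels_point[OF this assms(2)] show ?thesis
    using ev_hom_2[OF rels_hom[OF assms(2)], of P] by (simp add: nxt_def)
qed

lemma ev_W:
  assumes "regular 1 P"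
  shows "ev P W1 = 0" "ev P W2 = 0"
proof -
  have "consec (snd P) (fst P) (fst (nxt P))"
    using regular_consec[OF assms(1), of 0] by (simp add: orb_Suc)
  from quad_val_W_point[OF this] show "ev P W1 = 0" "ev P W2 = 0"
    using ev_hom_2[of W1 P] ev_hom_2[of W2 P] by (simp_all add: nxt_def)
qed

text \<open>That \<open>J\<close> is a graded ideal and that its homogeneous elements vanish along
  orbits are proved in one induction. Both need the component of \<open>a * s * b\<close> in
  explicit form, which is available once \<open>a\<close> is a single word.\<close>

lemma len_part_J_ev:
  assumes "x \<in> J"
  shows "len_part n x \<in> J \<and> (\<forall>P. regular n P \<longrightarrow> ev P (len_part n x) = 0)"
  using assms
proof induction
  case zero
  show ?case by (simp add: len_part_def ideal_gen.zero ev_linear)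
next
  case (add s x a b)
  have "len_part n (a * s * b) \<in> J \<and> (\<forall>P. regular n P \<longrightarrow> ev P (len_part n (a * s * b)) = 0)"
  proof (induction a rule: free_alg_induct)
    case zero
    show ?case by (simp add: len_part_def ideal_gen.zero ev_linear)
  next
    case (add f g)
    then show ?case by (simp add: distrib_right len_part_add ideal_gen_add ev_linear)
  next
    case (single c w)
    let ?a = "Poly_Mapping.single (Word w) c"
    have a: "?a \<in> hom_alg (length w)" by (rule hom_alg_single) simp
    have as: "?a * s \<in> hom_alg (length w + 2)"
      by (rule hom_alg_mult[OF a rels_hom[OF add.hyps(1)]])
    show ?case
    proof (cases "length w + 2 \<le> n")
      case True
      let ?b = "len_part (n - (length w + 2)) b"
      have eq: "len_part n (?a * s * b) = ?a * s * ?b"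
        using len_part_mult_left[OF as, of n b] True by simp
      have "ev P (?a * s * ?b) = 0" if "regular n P" for P
      proof -
        have "regular 1 (orb (length w) P)"
          using that True regular_curve[OF that, of "length w"] by (auto simp: regular_def)
        then show ?thesis
          using ev_rels[OF _ add.hyps(1)]
          by (simp add: ev_mult[OF as] ev_mult[OF a])
      qed
      then show ?thesis
        unfolding eq using ideal_gen_incl[OF add.hyps(1)]
        by (simp add: ideal_gen_rmult ideal_gen_lmult)
    next
      case False
      then have "len_part n (?a * s * b) = 0"
        using len_part_mult_left[OF as, of n b] by simp
      then show ?thesis by (simp add: ideal_gen.zero ev_linear)
    qed
  qed
  with add.IH show ?case by (simp add: len_part_add ideal_gen_add ev_linear)
qed

lemmas len_part_J = len_part_J_ev[THEN conjunct1]

lemma ev_J: "x \<in> J \<Longrightarrow> x \<in> hom_alg n \<Longrightarrow> regular n P \<Longrightarrow> ev P x = 0"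
  using len_part_J_ev[of x n, THEN conjunct2, rule_format, of P] len_part_id[of x n] by simp

section \<open>The quotient by the two central quadrics\<close>

text \<open>Right multiples of the quadrics already give a two-sided ideal, because
  \<open>W1\<close> and \<open>W2\<close> are central modulo \<open>J\<close>
  (\<open>JW_lmult\<close>).\<close>

definition JW :: "'k free_alg set" where
  "JW = {x. \<exists>f g. x - W1 * f - W2 * g \<in> J}"

lemma JW_J: "x \<in> J \<Longrightarrow> x \<in> JW"
  unfolding JW_def by (auto intro!: exI[of _ 0])

lemma JW_W: "W1 * f \<in> JW" "W2 * f \<in> JW"
proof -
  have "W1 * f - W1 * f - W2 * 0 \<in> J" "W2 * f - W1 * 0 - W2 * f \<in> J"
    by (simp_all add: ideal_gen.zero)
  then show "W1 * f \<in> JW" "W2 * f \<in> JW"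
    unfolding JW_def by blast+
qed

lemma JW_add: "x \<in> JW \<Longrightarrow> y \<in> JW \<Longrightarrow> x + y \<in> JW"
proof -
  assume "x \<in> JW" "y \<in> JW"
  then obtain f g f' g' where "x - W1 * f - W2 * g \<in> J" "y - W1 * f' - W2 * g' \<in> J"
    by (auto simp: JW_def)
  then have "(x - W1 * f - W2 * g) + (y - W1 * f' - W2 * g') \<in> J" by (rule ideal_gen_add)
  then have "x + y - W1 * (f + f') - W2 * (g + g') \<in> J"
    by (simp add: algebra_simps)
  then show ?thesis unfolding JW_def by blast
qed

lemma JW_rmult: "x \<in> JW \<Longrightarrow> x * y \<in> JW"
proof -
  assume "x \<in> JW"
  then obtain f g where "x - W1 * f - W2 * g \<in> J" by (auto simp: JW_def)
  then have "(x - W1 * f - W2 * g) * y \<in> J" by (rule ideal_gen_rmult)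
  then have "x * y - W1 * (f * y) - W2 * (g * y) \<in> J" by (simp add: algebra_simps)
  then show ?thesis unfolding JW_def by blast
qed

lemma JW_lmult: "x \<in> JW \<Longrightarrow> y * x \<in> JW"
proof -
  assume "x \<in> JW"
  then obtain f g where "x - W1 * f - W2 * g \<in> J" by (auto simp: JW_def)
  then have "y * (x - W1 * f - W2 * g) + (y * W1 - W1 * y) * f + (y * W2 - W2 * y) * g \<in> J"
    using commJ_W1[of y] commJ_W2[of y] unfolding commJ_def
    by (intro ideal_gen_add ideal_gen_lmult ideal_gen_rmult)
  then have "y * x - W1 * (y * f) - W2 * (y * g) \<in> J" by (simp add: algebra_simps)
  then show ?thesis unfolding JW_def by blast
qed

lemma JW_hom:
  assumes "x \<in> JW" "x \<in> hom_alg n"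
  obtains f g where "x - W1 * f - W2 * g \<in> J" "f \<in> hom_alg (n - 2)" "g \<in> hom_alg (n - 2)"
    "n < 2 \<longrightarrow> f = 0 \<and> g = 0"
proof -
  obtain f g where "x - W1 * f - W2 * g \<in> J"
    using assms(1) by (auto simp: JW_def)
  then have *: "len_part n (x - W1 * f - W2 * g) \<in> J" by (rule len_part_J)
  show ?thesis
  proof (cases "2 \<le> n")
    case True
    then show ?thesis
      using * that[of "len_part (n - 2) f" "len_part (n - 2) g"]
      by (simp add: len_part_diff len_part_id[OF assms(2)] len_part_mult_left[OF W_hom(1)]
          len_part_mult_left[OF W_hom(2)] len_part_in)
  next
    case False
    then show ?thesis
      using * that[of 0 0]
      by (simp add: len_part_diff len_part_id[OF assms(2)] len_part_mult_left[OF W_hom(1)]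
          len_part_mult_left[OF W_hom(2)])
  qed
qed

lemma ev_JW:
  assumes "x \<in> JW" "x \<in> hom_alg n" "regular n P"
  shows "ev P x = 0"
proof -
  obtain f g where fg: "x - W1 * f - W2 * g \<in> J" "f \<in> hom_alg (n - 2)" "g \<in> hom_alg (n - 2)"
    "n < 2 \<longrightarrow> f = 0 \<and> g = 0"
    by (rule JW_hom[OF assms(1,2)])
  have hom: "W1 * f \<in> hom_alg n" "W2 * g \<in> hom_alg n"
    using fg hom_alg_mult'[OF W_hom(1), of f "n - 2" n] hom_alg_mult'[OF W_hom(2), of g "n - 2" n]
    by (cases "n < 2"; simp)+
  have "ev P (W1 * f) = 0 \<and> ev P (W2 * g) = 0"
  proof (cases "n < 2")
    case False
    then have "regular 1 P" using assms(3) by (auto elim: regular_mono)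
    then show ?thesis by (simp add: ev_mult[OF W_hom(1)] ev_mult[OF W_hom(2)] ev_W)
  qed (simp add: fg ev_linear)
  moreover have "ev P (x - W1 * f - W2 * g) = 0"
    by (rule ev_J[OF fg(1) _ assms(3)]) (intro hom_alg_diff assms(2) hom)
  ultimately show ?thesis by (simp add: ev_linear)
qed

section \<open>Right ideals with two generators, modulo the central quadrics\<close>

definition rid :: "'k free_alg \<Rightarrow> 'k free_alg \<Rightarrow> 'k free_alg set" where
  "rid p q = {x. \<exists>f g. x - p * f - q * g \<in> JW}"

lemma rid_JW: "x \<in> JW \<Longrightarrow> x \<in> rid p q"
  unfolding rid_def by (auto intro!: exI[of _ 0])

lemma rid_gen: "p * f \<in> rid p q" "q * f \<in> rid p q"
proof -
  have "0 \<in> JW" by (rule JW_J) (rule ideal_gen.zero)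
  then have "p * f - p * f - q * 0 \<in> JW" "q * f - p * 0 - q * f \<in> JW" by simp_all
  then show "p * f \<in> rid p q" "q * f \<in> rid p q"
    unfolding rid_def by blast+
qed

lemma rid_add: "x \<in> rid p q \<Longrightarrow> y \<in> rid p q \<Longrightarrow> x + y \<in> rid p q"
proof -
  assume "x \<in> rid p q" "y \<in> rid p q"
  then obtain f g f' g' where "x - p * f - q * g \<in> JW" "y - p * f' - q * g' \<in> JW"
    by (auto simp: rid_def)
  then have "(x - p * f - q * g) + (y - p * f' - q * g') \<in> JW" by (rule JW_add)
  then have "x + y - p * (f + f') - q * (g + g') \<in> JW"
    by (simp add: algebra_simps)
  then show ?thesis unfolding rid_def by blast
qed

lemma rid_rmult: "x \<in> rid p q \<Longrightarrow> x * y \<in> rid p q"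
proof -
  assume "x \<in> rid p q"
  then obtain f g where "x - p * f - q * g \<in> JW" by (auto simp: rid_def)
  then have "(x - p * f - q * g) * y \<in> JW" by (rule JW_rmult)
  then have "x * y - p * (f * y) - q * (g * y) \<in> JW" by (simp add: algebra_simps)
  then show ?thesis unfolding rid_def by blast
qed

lemma rid_fconst: "x \<in> rid p q \<Longrightarrow> fconst c * x \<in> rid p q"
  using rid_rmult[of x p q "fconst c"] by (simp add: fconst_commute)

lemma rid_fconst_cancel: "fconst c * x \<in> rid p q \<Longrightarrow> c \<noteq> 0 \<Longrightarrow> x \<in> rid p q"
  using rid_fconst[of "fconst c * x" p q "1 / c"] by (simp add: fconst_mult_mult)

lemma rid_uminus: "x \<in> rid p q \<Longrightarrow> - x \<in> rid p q"
  using rid_rmult[of x p q "- 1"] by simp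

lemma rid_diff: "x \<in> rid p q \<Longrightarrow> y \<in> rid p q \<Longrightarrow> x - y \<in> rid p q"
  using rid_add[of x p q "- y"] by (simp add: rid_uminus)

lemma rid_W: "W1 \<in> rid p q" "W2 \<in> rid p q"
  using JW_W[of 1] by (auto intro: rid_JW)

lemmas rid_rels = rels_e[THEN JW_J, THEN rid_JW]

lemmas rid_intros = rid_add rid_diff rid_uminus rid_fconst rid_gen rid_rels rid_W

text \<open>Linear forms through \<open>P\<close> and \<open>neg P\<close> (see
  \<open>lin_val_hf_kf\<close>). The form \<open>kf P\<close> depends on u v only and so also
  vanishes at the swapped points.\<close>

definition hf :: "'k \<times> 'k \<Rightarrow> 'k free_alg" where
  "hf P = fconst (snd P) * eA + fconst (fst P) * eD"

definition kf :: "'k \<times> 'k \<Rightarrow> 'k free_alg" where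
  "kf P = eB + fconst (fst P * snd P) * eC"

lemma hf_kf_hom [simp]: "hf P \<in> hom_alg 1" "kf P \<in> hom_alg 1"
  unfolding hf_def kf_def by (intro hom_alg_add hom_alg_fconst_mult e_hom)+

lemmas f_simps = e_simps fconst_add fconst_diff fconst_uminus

lemma hom_alg_Suc_0 [simp]: "eA \<in> hom_alg (Suc 0)" "eB \<in> hom_alg (Suc 0)" "eC \<in> hom_alg (Suc 0)"
  "eD \<in> hom_alg (Suc 0)" "hf P \<in> hom_alg (Suc 0)" "kf P \<in> hom_alg (Suc 0)"
  using e_hom hf_kf_hom by simp_all

lemma rid_trans: "x - y \<in> rid p q \<Longrightarrow> y \<in> rid p q \<Longrightarrow> x \<in> rid p q"
  using rid_add[of "x - y" p q y] by simp

text \<open>In the first letter, \<open>eD\<close> and \<open>eB\<close> can be expressed by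
  \<open>eA\<close> and \<open>eC\<close> modulo the two forms. The first two facts then identify
  the four products of \<open>eA\<close> and \<open>eC\<close> in pairs. The other four say that
  left multiplication by \<open>eA\<close> or \<open>eC\<close> carries the forms at the successor
  \<open>(w, u)\<close> into the right ideal at \<open>(u, v)\<close>; this drives the induction
  along the orbit.\<close>

lemma pair_relations:
  assumes c: "consec v u w" and u: "u \<noteq> 0" and D: "1 + \<alpha> * \<nu> * u * v \<noteq> 0" and N: "\<nu> * v - u \<noteq> 0"
  shows "fconst u * (eC * eA) - fconst w * (eA * eC) \<in> rid (hf (u, v)) (kf (u, v))" (is ?F5)
    and "eA * eA - fconst (u * w) * (eC * eC) \<in> rid (hf (u, v)) (kf (u, v))" (is ?F6)
    and "eA * kf (w, u) \<in> rid (hf (u, v)) (kf (u, v))" (is ?F1)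
    and "eA * hf (w, u) \<in> rid (hf (u, v)) (kf (u, v))" (is ?F2)
    and "eC * kf (w, u) \<in> rid (hf (u, v)) (kf (u, v))" (is ?F3)
    and "eC * hf (w, u) \<in> rid (hf (u, v)) (kf (u, v))" (is ?F4)
proof -
  let ?h = "hf (u, v)" and ?k = "kf (u, v)"
  from c have c1: "v + w + \<alpha> * \<nu> * u * v * w = \<nu> * u" and c2: "\<nu> * v * w = \<alpha> * \<nu> + u * (v + w)"
    by (auto simp: consec_def)
  \<comment> \<open>Both equations of \<open>consec\<close> are linear in \<open>w\<close>. The two
    coefficients of \<open>w\<close> are the quantities assumed nonzero; the membership is proved
    after multiplying by them.\<close>
  have Dw: "(1 + \<alpha> * \<nu> * u * v) * w = \<nu> * u - v"
    using c1 by (simp add: algebra_simps eq_diff_eq)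
  have Nw: "(\<nu> * v - u) * w = \<alpha> * \<nu> + u * v"
    using c2 by (simp add: algebra_simps diff_eq_eq)
  have c4: "u * u - v * w - \<alpha> * (u * u * v * w - 1) = 0"
  proof -
    have "\<nu> * (u * u - v * w - \<alpha> * (u * u * v * w - 1))
      = u * (\<nu> * u - (v + w + \<alpha> * \<nu> * u * v * w)) + (\<alpha> * \<nu> + u * (v + w) - \<nu> * v * w)"
      by (simp add: algebra_simps)
    then show ?thesis using c1 c2 \<nu>_neq by simp
  qed
  have "fconst (1 + \<alpha> * \<nu> * u * v) * (fconst u * (eC * eA) - fconst w * (eA * eC))
      = fconst ((1 + \<alpha> * \<nu> * u * v) * u) * (eC * eA) - fconst (\<nu> * u - v) * (eA * eC)"
    unfolding Dw[symmetric] by (simp add: right_diff_distrib fconst_mult_mult)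
  also have "\<dots> = ?h * eC + fconst (u * (\<alpha> * \<nu>)) * (?k * eA) + fconst u * r6"
    by (simp add: hf_def kf_def f_simps)
  also have "\<dots> \<in> rid ?h ?k" by (intro rid_intros)
  finally show F5: ?F5 using D by (rule rid_fconst_cancel)
  have "fconst (\<nu> * v - u) * (eA * eA - fconst (u * w) * (eC * eC))
      = fconst (\<nu> * v - u) * (eA * eA) - fconst (u * (\<alpha> * \<nu> + u * v)) * (eC * eC)"
    unfolding Nw[symmetric] by (simp add: right_diff_distrib fconst_mult_mult mult_ac)
  also have "\<dots> = fconst \<nu> * (?h * eA) - fconst u * (?k * eC) - fconst (u * \<nu>) * (W2 + r4)"
    using \<nu>_neq by (simp add: hf_def kf_def W2_def f_simps)
  also have "\<dots> \<in> rid ?h ?k" by (intro rid_intros)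
  finally show F6: ?F6 using N by (rule rid_fconst_cancel)
  have "eA * kf (w, u) = ?k * eD + fconst \<nu> * (?k * eA) - fconst (u * v) * r2 + r5
     - fconst (\<nu> * v) * (fconst u * (eC * eA) - fconst w * (eA * eC))
     + fconst (\<alpha> * \<nu> + u * (v + w) - \<nu> * v * w) * (eA * eC)"
    by (simp add: kf_def f_simps)
  then have "eA * kf (w, u) = ?k * eD + fconst \<nu> * (?k * eA) - fconst (u * v) * r2 + r5
     - fconst (\<nu> * v) * (fconst u * (eC * eA) - fconst w * (eA * eC))"
    using c2 by simp
  also have "\<dots> \<in> rid ?h ?k" by (intro rid_add rid_diff[OF _ rid_fconst[OF F5]] rid_intros)
  finally show ?F1 .
  have "fconst u * (eA * hf (w, u)) = fconst w * (?h * eA - fconst (u * \<alpha>) * (?k * eB)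
      + fconst (\<alpha> * u * u * v) * W1 - fconst u * r4)
      - fconst \<alpha> * (eA * eA - fconst (u * w) * (eC * eC))
      + fconst (u * u - v * w - \<alpha> * (u * u * v * w - 1)) * (eA * eA)"
    by (simp add: hf_def kf_def W1_def f_simps)
  also have "\<dots> = fconst w * (?h * eA - fconst (u * \<alpha>) * (?k * eB)
      + fconst (\<alpha> * u * u * v) * W1 - fconst u * r4)
      - fconst \<alpha> * (eA * eA - fconst (u * w) * (eC * eC))"
    using c4 by simp
  also have "\<dots> \<in> rid ?h ?k" by (intro rid_diff[OF _ rid_fconst[OF F6]] rid_intros)
  finally show ?F2 using u by (rule rid_fconst_cancel)
  have "eC * kf (w, u) = W1 - (eA * eA - fconst (u * w) * (eC * eC))"
    by (simp add: kf_def W1_def f_simps)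
  also have "\<dots> \<in> rid ?h ?k" by (intro rid_diff F6 rid_intros)
  finally show ?F3 .
  have "eC * hf (w, u) = fconst u * (eC * eA) - fconst w * (eA * eC) + fconst w * r2"
    by (simp add: hf_def f_simps)
  also have "\<dots> \<in> rid ?h ?k" by (intro rid_add F5 rid_intros)
  finally show ?F4 .
qed

text \<open>Here \<open>(w, v)\<close> is the successor of the swapped point \<open>(v, u)\<close>.
  Left multiplication by \<open>hf\<close> carries both forms at that successor into the right ideal
  of \<open>kf\<close> alone.\<close>

lemma four_relations:
  assumes c: "consec u v w"
  shows "hf (u, v) * kf (w, v) \<in> rid (kf (u, v)) 0" "hf (u, v) * hf (w, v) \<in> rid (kf (u, v)) 0"
proof -
  let ?h = "hf (u, v)" and ?k = "kf (u, v)"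
  from c have c1: "u + w + \<alpha> * \<nu> * v * u * w = \<nu> * v" and c2: "\<nu> * u * w = \<alpha> * \<nu> + v * (u + w)"
    by (auto simp: consec_def)
  have "hf (u, v) * kf (w, v) = fconst v * (?k * eD + fconst \<nu> * (?k * eA) + fconst (\<nu> * \<alpha>) * r2 + r5)
      + fconst (v * v * w) * r2 + fconst u * (r1 - ?k * eA)
      - fconst (u * w * v) * (fconst \<nu> * r2 + fconst (\<nu> * \<alpha>) * (?k * eA) + r6)
      + fconst (u * v * (u + w + \<alpha> * \<nu> * v * u * w - \<nu> * v)) * (eC * eA)
      + fconst (v * (\<nu> * u * w - (\<alpha> * \<nu> + v * (u + w)))) * (eC * eD)"
    by (simp add: hf_def kf_def f_simps)
  also have "\<dots> = fconst v * (?k * eD + fconst \<nu> * (?k * eA) + fconst (\<nu> * \<alpha>) * r2 + r5)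
      + fconst (v * v * w) * r2 + fconst u * (r1 - ?k * eA)
      - fconst (u * w * v) * (fconst \<nu> * r2 + fconst (\<nu> * \<alpha>) * (?k * eA) + r6)"
    using c1 c2 by simp
  also have "\<dots> \<in> rid ?k 0" by (intro rid_intros)
  finally show "hf (u, v) * kf (w, v) \<in> rid ?k 0" .
  let ?m = "1 / \<nu>"
  have "fconst \<nu> * (hf (u, v) * hf (w, v)) = fconst \<nu> * (fconst (v * v) * W1
      + fconst (v * w) * (W2 - fconst \<alpha> * (?k * eB) - fconst ?m * W1 + fconst ?m * (?k * eC))
      + fconst (u * v) * (W2 + r4 - fconst ?m * W1 + fconst ?m * (?k * eC))
      + fconst (u * w) * (W1 - r3 - ?k * eC))
      + fconst (v * (u + w + \<alpha> * \<nu> * v * u * w - \<nu> * v)) * (eC * eB)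
      + fconst (u * v * (\<nu> * u * w - (\<alpha> * \<nu> + v * (u + w)))) * (eC * eC)"
    using \<nu>_neq by (simp add: hf_def kf_def W1_def W2_def f_simps)
  also have "\<dots> = fconst \<nu> * (fconst (v * v) * W1
      + fconst (v * w) * (W2 - fconst \<alpha> * (?k * eB) - fconst ?m * W1 + fconst ?m * (?k * eC))
      + fconst (u * v) * (W2 + r4 - fconst ?m * W1 + fconst ?m * (?k * eC))
      + fconst (u * w) * (W1 - r3 - ?k * eC))"
    using c1 c2 by simp
  also have "\<dots> \<in> rid ?k 0" by (intro rid_intros)
  finally show "hf (u, v) * hf (w, v) \<in> rid ?k 0" using \<nu>_neq by (rule rid_fconst_cancel)
qed

section \<open>Elements vanishing at points of the curve\<close>

lemma JW_len_part: "x \<in> JW \<Longrightarrow> len_part n x \<in> JW"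
proof -
  assume "x \<in> JW"
  then obtain f g where "x - W1 * f - W2 * g \<in> J" by (auto simp: JW_def)
  then have *: "len_part n (x - W1 * f - W2 * g) \<in> J" by (rule len_part_J)
  show ?thesis
  proof (cases "2 \<le> n")
    case True
    then have "len_part n x - W1 * len_part (n - 2) f - W2 * len_part (n - 2) g \<in> J"
      using * by (simp add: len_part_diff len_part_mult_left[OF W_hom(1)] len_part_mult_left[OF W_hom(2)])
    then show ?thesis by (auto simp: JW_def)
  next
    case False
    then show ?thesis
      using * by (simp add: len_part_diff len_part_mult_left[OF W_hom(1)] len_part_mult_left[OF W_hom(2)] JW_J)
  qed
qed

lemma rid_hom:
  assumes "x \<in> rid p q" "x \<in> hom_alg (Suc n)" "p \<in> hom_alg 1" "q \<in> hom_alg 1"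
  obtains f g where "f \<in> hom_alg n" "g \<in> hom_alg n" "x - p * f - q * g \<in> JW"
proof -
  obtain f g where "x - p * f - q * g \<in> JW"
    using assms(1) by (auto simp: rid_def)
  then have "len_part (Suc n) (x - p * f - q * g) \<in> JW" by (rule JW_len_part)
  then have "x - p * len_part n f - q * len_part n g \<in> JW"
    using len_part_mult_left[OF assms(3), of "Suc n" f] len_part_mult_left[OF assms(4), of "Suc n" g]
    by (simp add: len_part_diff len_part_id[OF assms(2)])
  then show ?thesis using that len_part_in by blast
qed

lemma hom_alg_Suc_mult: "p \<in> hom_alg 1 \<Longrightarrow> f \<in> hom_alg n \<Longrightarrow> p * f \<in> hom_alg (Suc n)"
  using hom_alg_mult'[of p 1 f n "Suc n"] by simp

lemma ev_mult_1: "p \<in> hom_alg 1 \<Longrightarrow> ev P (p * f) = lin_val (pt P) p * ev (nxt P) f"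
  using ev_mult[of p 1 P f] ev_hom_1[of p P] by (simp add: orb_Suc[of 0, simplified])

lemmas ev_mult_e = ev_mult_1[OF e_hom(1)] ev_mult_1[OF e_hom(3)]

lemma ev_rid_expand:
  assumes "x - p * f - q * g \<in> JW" "f \<in> hom_alg n" "g \<in> hom_alg n" "p \<in> hom_alg 1" "q \<in> hom_alg 1"
    "x \<in> hom_alg (Suc n)" "regular (Suc n) P"
  shows "ev P x = lin_val (pt P) p * ev (nxt P) f + lin_val (pt P) q * ev (nxt P) g"
proof -
  have "ev P (x - p * f - q * g) = 0"
    by (rule ev_JW[OF assms(1) _ assms(7)]) (intro hom_alg_diff hom_alg_Suc_mult assms)
  then show ?thesis
    by (simp add: ev_linear ev_mult_1[OF assms(4)] ev_mult_1[OF assms(5)] diff_eq_eq add.commute)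
qed

lemma lin_val_hf_kf:
  "lin_val (pt (x, y)) (hf (u, v)) = 2 * (v * x - u * y)"
  "lin_val (pt (x, y)) (kf (u, v)) = 2 * (u * v - x * y)"
  by (simp_all add: hf_def kf_def lin_val_linear lin_val_pt algebra_simps)

definition gcond :: "'k \<times> 'k \<Rightarrow> bool" where
  "gcond P \<longleftrightarrow> fst P \<noteq> 0 \<and> 1 + \<alpha> * \<nu> * fst P * snd P \<noteq> 0 \<and> \<nu> * snd P - fst P \<noteq> 0"

definition generic :: "nat \<Rightarrow> 'k \<times> 'k \<Rightarrow> bool" where
  "generic n P \<longleftrightarrow> regular n P \<and> (\<forall>j\<le>n. gcond (orb j P))"

lemma ae_gcond: "ae gcond"
proof -
  have 1: "ae (\<lambda>P. fst P \<noteq> 0)"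
    using ae_fst_notin[of "{0}"] by simp
  have 2: "ae (\<lambda>P. 1 + \<alpha> * \<nu> * fst P * snd P \<noteq> 0)"
    using ae_neq_0[of 1 "[:0, \<alpha> * \<nu>:]"] by (simp add: mult_ac)
  have "ae (\<lambda>P. \<nu> * snd P - fst P \<noteq> 0)"
    using ae_neq_0[of "[:0, - 1:]" "[:\<nu>:]"] by simp
  then show ?thesis
    unfolding gcond_def using 1 2 by (intro ae_conj)
qed

lemma ae_generic: "ae (generic n)"
  unfolding generic_def using ae_conj[OF ae_regular ae_orb_le[OF ae_gcond]] .

lemma generic_nxt: "generic (Suc n) P \<Longrightarrow> generic n (nxt P)"
  unfolding generic_def using regular_nxt by (auto simp flip: orb_Suc')

lemma nxt_neg: "nxt (neg P) = neg (nxt P)"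
  by (simp add: nxt_def neg_def den_def)

lemma orb_neg: "orb n (neg P) = neg (orb n P)"
  by (induction n) (simp_all add: orb_Suc nxt_neg)

lemma regular_neg: "regular n P \<Longrightarrow> regular n (neg P)"
  unfolding regular_def by (auto simp: orb_neg neg_curve) (simp add: neg_def den_def)

lemma linear_reduce:
  assumes "x \<in> hom_alg (Suc n)" "fst P \<noteq> 0"
  obtains f1 f2 g1 g2 where "f1 \<in> hom_alg n" "f2 \<in> hom_alg n"
    "x = eA * f1 + eC * f2 + hf P * g1 + kf P * g2"
proof -
  have "\<exists>f1 f2 g1 g2. f1 \<in> hom_alg n \<and> f2 \<in> hom_alg n \<and> x = eA * f1 + eC * f2 + hf P * g1 + kf P * g2"
  proof -
    obtain h where h: "\<forall>i. h i \<in> hom_alg n" "x = (\<Sum>i\<in>UNIV. fgen i * h i)"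
      using hom_alg_Suc_left[OF assms(1)] by blast
    have "\<exists>f1 f2 g1 g2. f1 \<in> hom_alg n \<and> f2 \<in> hom_alg n \<and> y * f = eA * f1 + eC * f2 + hf P * g1 + kf P * g2"
      if yf: "y \<in> hom_alg 1" "f \<in> hom_alg n" for y f
    proof -
      obtain p q r s where y: "y = fconst p * eA + fconst q * eB + fconst r * eC + fconst s * eD"
        by (rule hom_alg_1_e_cases[OF yf(1)])
      let ?u = "fst P" and ?v = "snd P"
      have "fconst (s / ?u) * hf P = fconst (s / ?u * ?v) * eA + fconst s * eD"
        using assms(2) by (simp add: hf_def distrib_left fconst_mult_mult)
      then have "y = fconst (p - s / ?u * ?v) * eA + fconst (r - q * (?u * ?v)) * eC
          + fconst (s / ?u) * hf P + fconst q * kf P"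
        by (simp add: y kf_def fconst_diff algebra_simps fconst_mult_mult)
      then have "y * f = eA * (fconst (p - s / ?u * ?v) * f) + eC * (fconst (r - q * (?u * ?v)) * f)
          + hf P * (fconst (s / ?u) * f) + kf P * (fconst q * f)"
        by (simp only: distrib_right mult.assoc fconst_left_commute)
      then show ?thesis
        using yf(2) by (blast intro: hom_alg_fconst_mult)
    qed
    then have "\<forall>i. \<exists>f1 f2 g1 g2. f1 \<in> hom_alg n \<and> f2 \<in> hom_alg n \<and>
       fgen i * h i = eA * f1 + eC * f2 + hf P * g1 + kf P * g2"
      using h(1) hom_alg_fgen by blast
    then obtain f1 f2 g1 g2 where *: "\<And>i. f1 i \<in> hom_alg n" "\<And>i. f2 i \<in> hom_alg n"
      "\<And>i. fgen i * h i = eA * f1 i + eC * f2 i + hf P * g1 i + kf P * g2 i"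
      by metis
    have "x = eA * (\<Sum>i\<in>UNIV. f1 i) + eC * (\<Sum>i\<in>UNIV. f2 i) + hf P * (\<Sum>i\<in>UNIV. g1 i) + kf P * (\<Sum>i\<in>UNIV. g2 i)"
      unfolding h(2) * by (simp add: sum.distrib sum_distrib_left)
    then show ?thesis
      using *(1,2) by (blast intro: hom_alg_sum)
  qed
  then show ?thesis using that by blast
qed

text \<open>Induction along the orbit: modulo the linear forms vanishing at \<open>P\<close> and \<open>neg P\<close>, a form of degree
  \<open>n + 1\<close> is \<open>eC\<close> times a form of degree \<open>n\<close> vanishing at \<open>nxt P\<close> and \<open>nxt (neg P)\<close>.\<close>

lemma pair_division:
  assumes "b \<in> hom_alg n" "generic n P" "ev P b = 0" "ev (neg P) b = 0"
  shows "b \<in> rid (hf P) (kf P)"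
  using assms
proof (induction n arbitrary: b P)
  case 0
  then obtain c where "b = fconst c" using hom_alg_0_fconst by blast
  with 0 show ?case by (simp add: ev_fconst rid_JW JW_J ideal_gen.zero)
next
  case (Suc n)
  obtain u v where P: "P = (u, v)" by (cases P)
  define w where "w = fst (nxt P)"
  have nP: "nxt P = (w, u)" by (simp add: w_def P nxt_def)
  have reg: "regular (Suc n) P" and g0: "gcond P" and g1: "gcond (nxt P)"
    using Suc.prems(2) by (auto simp: generic_def orb_Suc[of 0, simplified] dest: spec[of _ 0] spec[of _ "Suc 0"])
  have u: "u \<noteq> 0" and D: "1 + \<alpha> * \<nu> * u * v \<noteq> 0" and N: "\<nu> * v - u \<noteq> 0" and w: "w \<noteq> 0"
    using g0 g1 by (simp_all add: gcond_def P nP nP[unfolded P])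
  have con: "consec v u w"
    using regular_consec[OF reg, of 0] by (simp add: P orb_Suc w_def)
  note F = pair_relations[OF con u D N]
  note regn = regular_neg[OF reg]
  let ?R = "rid (hf P) (kf P)"
  obtain b1 b3 g g' where b: "b1 \<in> hom_alg n" "b3 \<in> hom_alg n"
      "b = eA * b1 + eC * b3 + hf P * g + kf P * g'"
    by (rule linear_reduce[OF Suc.prems(1), of P]) (use u P in auto)
  have main: "b \<in> ?R" if c: "b - eC * b'' \<in> ?R" "b'' \<in> hom_alg n" for b''
  proof -
    have hom: "b - eC * b'' \<in> hom_alg (Suc n)"
      by (intro hom_alg_diff Suc.prems(1) hom_alg_Suc_mult e_hom c(2))
    obtain f g where fg: "f \<in> hom_alg n" "g \<in> hom_alg n" "b - eC * b'' - hf P * f - kf P * g \<in> JW"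
      by (rule rid_hom[OF c(1) hom hf_kf_hom])
    note expand = ev_rid_expand[OF fg(3) fg(1,2) hf_kf_hom hom]
    have "ev P (b - eC * b'') = 0"
      using expand[OF reg] by (simp add: P lin_val_hf_kf)
    then have 1: "ev (nxt P) b'' = 0"
      using Suc.prems(3) two_neq_0 by (simp add: ev_linear ev_mult_e P lin_val_pt)
    have "ev (neg P) (b - eC * b'') = 0"
      using expand[OF regn] by (simp add: P neg_def lin_val_hf_kf)
    then have 2: "ev (neg (nxt P)) b'' = 0"
      using Suc.prems(4) two_neq_0 by (simp add: ev_linear ev_mult_e nxt_neg) (simp add: P neg_def lin_val_pt)
    have "b'' \<in> rid (hf (nxt P)) (kf (nxt P))"
      by (rule Suc.IH[OF c(2) generic_nxt[OF Suc.prems(2)] 1 2])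
    then obtain f' g'' where "b'' - hf (nxt P) * f' - kf (nxt P) * g'' \<in> JW"
      by (auto simp: rid_def)
    then have "eC * (b'' - hf (nxt P) * f' - kf (nxt P) * g'') \<in> ?R"
      by (intro rid_JW JW_lmult)
    then have "eC * (b'' - hf (nxt P) * f' - kf (nxt P) * g'') + eC * hf (nxt P) * f' + eC * kf (nxt P) * g'' \<in> ?R"
      using F(5,6) by (intro rid_add rid_rmult[where y = f'] rid_rmult[where y = g'']) (simp_all add: P nP[unfolded P])
    then have "eC * b'' \<in> ?R" by (simp add: algebra_simps)
    with c(1) show ?thesis by (rule rid_trans)
  qed
  have hk: "hf P * g + kf P * g' \<in> ?R"
    by (intro rid_intros)
  show ?case
  proof (cases n)
    \<comment> \<open>In degree one there is no second letter to rewrite. The coefficients p and r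
      of \<open>eA\<close> and \<open>eC\<close> satisfy u p + r = 0 at \<open>P\<close> and r - u p
      = 0 at \<open>neg P\<close>, hence vanish since 2u is nonzero.\<close>
    case 0
    with b obtain p r where pr: "b1 = fconst p" "b3 = fconst r"
      using hom_alg_0_fconst by metis
    have hom: "b - (eA * b1 + eC * b3) \<in> hom_alg (Suc n)"
      by (intro hom_alg_diff hom_alg_add Suc.prems(1) hom_alg_Suc_mult e_hom b)
    have in_R: "b - (eA * b1 + eC * b3) \<in> ?R"
      using hk by (simp add: b(3) add.assoc)
    obtain f g where fg: "f \<in> hom_alg n" "g \<in> hom_alg n"
      "b - (eA * b1 + eC * b3) - hf P * f - kf P * g \<in> JW"
      by (rule rid_hom[OF in_R hom hf_kf_hom])
    note expand = ev_rid_expand[OF fg(3) fg(1,2) hf_kf_hom hom]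
    have "ev P (b - (eA * b1 + eC * b3)) = 0"
      using expand[OF reg] by (simp add: P lin_val_hf_kf)
    then have 1: "2 * (u * p + r) = 0"
      using Suc.prems(3) by (simp add: ev_linear ev_mult_e P lin_val_pt pr ev_fconst algebra_simps)
    have "ev (neg P) (b - (eA * b1 + eC * b3)) = 0"
      using expand[OF regn] by (simp add: P neg_def lin_val_hf_kf)
    then have 2: "2 * (r - u * p) = 0"
      using Suc.prems(4) by (simp add: ev_linear ev_mult_e P neg_def lin_val_pt pr ev_fconst algebra_simps) auto
    have z: "u * p + r = 0" "r - u * p = 0" using 1 2 two_neq_0 by (metis mult_eq_0_iff)+
    have "2 * r = (u * p + r) + (r - u * p)" by (simp add: algebra_simps)
    then have "2 * r = 0" using z by simp
    then have "r = 0" using two_neq_0 by simp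
    moreover have "p = 0" using z(2) \<open>r = 0\<close> u by simp
    ultimately show ?thesis
      using in_R by (simp add: pr)
  next
    case (Suc m)
    obtain f1 f2 g1 g2 where f: "f1 \<in> hom_alg m" "f2 \<in> hom_alg m"
      "b1 = eA * f1 + eC * f2 + hf (nxt P) * g1 + kf (nxt P) * g2"
      by (rule linear_reduce[of b1 m "nxt P"]) (use b w nP Suc in auto)
    \<comment> \<open>Modulo the right ideal, \<open>eA * eA\<close> becomes u w
      \<open>eC * eC\<close> and \<open>eA * eC\<close> becomes (u / w) \<open>eC * eA\<close>, so
      that \<open>eC\<close> can be taken out on the left of the whole form.\<close>
    define b'' where "b'' = fconst (u * w) * (eC * f1) + fconst (u / w) * (eA * f2) + b3"
    have "b'' \<in> hom_alg n"
      unfolding b''_def Suc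
      by (intro hom_alg_add hom_alg_fconst_mult hom_alg_Suc_mult e_hom f) (use b Suc in simp)
    have "b - eC * b'' = (eA * eA - fconst (u * w) * (eC * eC)) * f1
        - fconst (1 / w) * ((fconst u * (eC * eA) - fconst w * (eA * eC)) * f2)
        + eA * hf (nxt P) * g1 + eA * kf (nxt P) * g2 + (hf P * g + kf P * g')"
      using w by (simp add: b(3) f(3) b''_def f_simps)
    also have "\<dots> \<in> ?R"
      using rid_rmult[OF F(2), of f1] rid_fconst[OF rid_rmult[OF F(1), of f2], of "1 / w"]
        rid_rmult[OF F(4), of g1] rid_rmult[OF F(3), of g2] hk
      unfolding P nP[unfolded P] by (blast intro: rid_add rid_diff)
    finally have "b - eC * b'' \<in> ?R" .
    then show ?thesis using \<open>b'' \<in> hom_alg n\<close> by (rule main)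
  qed
qed

text \<open>The form \<open>kf P\<close> cuts out the plane through the four points listed in the last assumption.\<close>

lemma four_division:
  assumes "b \<in> hom_alg (Suc n)" "generic (Suc n) P" "regular (Suc n) (swp P)" "generic n (nxt (swp P))"
    and "fst P * fst P \<noteq> snd P * snd P"
    and "\<And>Q. Q \<in> {P, neg P, swp P, neg (swp P)} \<Longrightarrow> ev Q b = 0"
  shows "b \<in> rid (kf P) 0"
proof -
  obtain u v where P: "P = (u, v)" by (cases P)
  have "b \<in> rid (hf P) (kf P)"
    by (rule pair_division[OF assms(1,2)]) (simp_all add: assms(6))
  then obtain f g where fg: "f \<in> hom_alg n" "g \<in> hom_alg n" "b - hf P * f - kf P * g \<in> JW"
    by (rule rid_hom[OF _ assms(1) hf_kf_hom])
  note expand = ev_rid_expand[OF fg(3) fg(1,2) hf_kf_hom assms(1)]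
  have n: "2 * (v * v - u * u) \<noteq> 0" "2 * (u * u - v * v) \<noteq> 0"
    using assms(5) two_neq_0 by (auto simp: P)
  \<comment> \<open>At \<open>swp P\<close> and its negative \<open>kf P\<close> vanishes, but
    \<open>hf P\<close> does not, because the squares of the coordinates of \<open>P\<close> differ.
    So the cofactor \<open>f\<close> of \<open>hf P\<close> vanishes at the successors, and
    \<open>pair_division\<close> applies to it.\<close>
  have 1: "ev (nxt (swp P)) f = 0"
    using expand[OF assms(3)] assms(6)[of "swp P"] n
    by (simp add: P swp_def lin_val_hf_kf mult.commute)
  have 2: "ev (neg (nxt (swp P))) f = 0"
    using expand[OF regular_neg[OF assms(3)]] assms(6)[of "neg (swp P)"] n
    by (simp add: nxt_neg) (simp add: P swp_def neg_def lin_val_hf_kf mult.commute)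
  define w where "w = fst (nxt (swp P))"
  have nP: "nxt (swp P) = (w, v)" by (simp add: w_def P swp_def nxt_def)
  have con: "consec u v w"
    using regular_consec[OF assms(3), of 0] by (simp add: P swp_def orb_Suc w_def)
  have "f \<in> rid (hf (w, v)) (kf (w, v))"
    using pair_division[OF fg(1) assms(4) 1 2] by (simp add: nP)
  then obtain f' g' where "f - hf (w, v) * f' - kf (w, v) * g' \<in> JW"
    by (auto simp: rid_def)
  then have "hf P * (f - hf (w, v) * f' - kf (w, v) * g') \<in> rid (kf P) 0"
    by (intro rid_JW JW_lmult)
  moreover have "b - hf P * f - kf P * g \<in> rid (kf P) 0"
    using fg(3) by (rule rid_JW)
  ultimately have "(b - hf P * f - kf P * g) + hf P * (f - hf (w, v) * f' - kf (w, v) * g')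
      + hf P * hf (w, v) * f' + hf P * kf (w, v) * g' + kf P * g \<in> rid (kf P) 0"
    using four_relations[OF con]
    by (intro rid_add rid_gen rid_rmult[where y = f'] rid_rmult[where y = g']) (auto simp: P)
  then show ?thesis by (simp add: algebra_simps)
qed

text \<open>Division by one plane section. For a fixed generic \<open>P\<close> the form is
  \<open>kf P\<close> times a form of smaller degree, modulo \<open>JW\<close>. As
  \<open>kf P\<close> is nonzero at almost all points of the curve, the cofactor vanishes almost
  everywhere on it, and induction on the degree applies.\<close>

theorem in_JW_if_vanishing:
  assumes "b \<in> hom_alg n" "ae (\<lambda>P. ev P b = 0)"
  shows "b \<in> JW"
  using assms
proof (induction n arbitrary: b)
  case 0
  then obtain c where c: "b = fconst c" using hom_alg_0_fconst by blast
  obtain P where "ev P b = 0" using ae_ex[OF 0(2)] by blast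
  then show ?case by (simp add: c ev_fconst JW_J ideal_gen.zero)
next
  case (Suc n)
  note v = Suc.prems(2)
  have "ae (\<lambda>P. fst P * fst P \<noteq> snd P * snd P)"
  proof -
    have "ae (\<lambda>P. fst P - snd P \<noteq> 0 \<and> fst P + snd P \<noteq> 0)"
      using ae_conj[OF ae_neq_0[of "[:0, 1:]" "[:- 1:]"] ae_neq_0[of "[:0, 1:]" "[:1:]"]] by simp
    then show ?thesis
    proof (rule ae_mono)
      fix P :: "'k \<times> 'k"
      assume "fst P - snd P \<noteq> 0 \<and> fst P + snd P \<noteq> 0"
      then have "(fst P - snd P) * (fst P + snd P) \<noteq> 0" by simp
      then show "fst P * fst P \<noteq> snd P * snd P" by (auto simp: algebra_simps)
    qed
  qed
  then have "ae (\<lambda>P. fst P * fst P \<noteq> snd P * snd P \<and> generic (Suc n) P \<and> regular (Suc n) (swp P)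
     \<and> generic n (nxt (swp P)) \<and> ev P b = 0 \<and> ev (neg P) b = 0 \<and> ev (swp P) b = 0 \<and> ev (neg (swp P)) b = 0)"
    by (intro ae_conj ae_generic ae_swp[OF ae_regular] ae_swp[OF ae_nxt[OF ae_generic]] v
        ae_neg[OF v] ae_swp[OF v] ae_swp[OF ae_neg[OF v]])
  from ae_ex[OF this] obtain P where P: "fst P * fst P \<noteq> snd P * snd P" "generic (Suc n) P" "regular (Suc n) (swp P)"
     "generic n (nxt (swp P))" "ev P b = 0" "ev (neg P) b = 0" "ev (swp P) b = 0" "ev (neg (swp P)) b = 0"
    by blast
  have "b \<in> rid (kf P) 0"
    by (rule four_division[OF Suc.prems(1) P(2-4,1)]) (use P in auto)
  then obtain f g where fg: "f \<in> hom_alg n" "g \<in> hom_alg n" "b - kf P * f - 0 * g \<in> JW"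
    by (rule rid_hom[OF _ Suc.prems(1) hf_kf_hom(2) hom_alg_0])
  have "ae (\<lambda>Q. fst P * snd P - fst Q * snd Q \<noteq> 0)"
    using ae_neq_0[of "[:fst P * snd P:]" "[:0, - 1:]"] by simp
  then have "ae (\<lambda>Q. fst P * snd P - fst Q * snd Q \<noteq> 0 \<and> regular (Suc n) Q \<and> ev Q b = 0)"
    by (intro ae_conj ae_regular v)
  then have "ae (\<lambda>Q. ev (nxt Q) f = 0)"
  proof (rule ae_mono)
    fix Q assume Q: "fst P * snd P - fst Q * snd Q \<noteq> 0 \<and> regular (Suc n) Q \<and> ev Q b = 0"
    have "ev Q b = lin_val (pt Q) (kf P) * ev (nxt Q) f + lin_val (pt Q) 0 * ev (nxt Q) g"
      by (rule ev_rid_expand[OF fg(3) fg(1,2) _ _ Suc.prems(1)]) (use Q in simp_all)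
    moreover have "lin_val (pt Q) (kf P) \<noteq> 0"
      using Q two_neq_0 by (cases Q; cases P) (simp add: lin_val_hf_kf)
    ultimately show "ev (nxt Q) f = 0"
      using Q by (simp add: lin_val_linear)
  qed
  then have "ae (\<lambda>Q. ev Q f = 0)" by (rule ae_nxt_rev)
  then have "f \<in> JW" by (rule Suc.IH[OF fg(1)])
  then have "(b - kf P * f - 0 * g) + kf P * f \<in> JW"
    by (intro JW_add fg(3) JW_lmult)
  then show ?case by simp
qed

end

lemma quad_val_scale:
  "quad_val (\<lambda>x. c * y x) (\<lambda>x. d * z x) f = c * d * quad_val y z f"
proof -
  have "(case w of [x, x'] \<Rightarrow> c * y x * (d * z x') | _ \<Rightarrow> 0)
      = c * d * (case w of [x, x'] \<Rightarrow> y x * z x' | _ \<Rightarrow> 0)" for w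
    by (auto split: list.split)
  then show ?thesis
    by (simp add: quad_val_def lin_fun_def sum_distrib_left mult_ac)
qed

context sklyanin_setup
begin

section \<open>Modules with a two-dimensional family of points\<close>

text \<open>The functions on \<open>\<nat> \<times> \<nat>\<close> carry (the transpose of) a truncated line module: the generators act by
  difference operators along the orbits of two points \<open>P\<close> and \<open>Q\<close>, the second one reflected.
  For \<open>r = 0\<close> only the orbit of \<open>P\<close> is involved and the module is a point module.\<close>

definition wt :: "nat \<Rightarrow> 'k \<times> 'k \<Rightarrow> 'k \<times> 'k \<Rightarrow> nat \<Rightarrow> 'k" where
  "wt r P Q t = (if r = 0 then 1 else 1 / (snd (orb t P) - fst (orb t Q)))"

text \<open>The number \<open>i + (r - j)\<close> is the position on both orbits. It grows with a
  step in the first direction and drops with a step in the second, where the orbit of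
  \<open>Q\<close> is run backwards. The bounds \<open>M\<close> and \<open>r\<close> truncate the
  module, so that finitely many points of the orbits occur.\<close>

definition line_op :: "nat \<Rightarrow> nat \<Rightarrow> 'k \<times> 'k \<Rightarrow> 'k \<times> 'k \<Rightarrow> gen \<Rightarrow> (nat \<times> nat \<Rightarrow> 'k) \<Rightarrow> nat \<times> nat \<Rightarrow> 'k" where
  "line_op M r P Q x F s = (case s of (i, j) \<Rightarrow>
     (if i < M then wt r P Q (i + (r - j)) else 0) * pt (orb (i + (r - j)) P) x * F (Suc i, j)
     + (if i \<le> M \<and> j < r then wt r P Q (i + (r - j)) else 0) * pt (swp (orb (i + (r - j)) Q)) x * F (i, Suc j))"

lemma line_op_pair: "line_op M r P Q x F (i, j) =
     (if i < M then wt r P Q (i + (r - j)) else 0) * pt (orb (i + (r - j)) P) x * F (Suc i, j)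
     + (if i \<le> M \<and> j < r then wt r P Q (i + (r - j)) else 0) * pt (swp (orb (i + (r - j)) Q)) x * F (i, Suc j)"
  unfolding line_op_def by (subst prod.case) (rule refl)

lemma op_linear_line_op: "op_linear (line_op M r P Q)"
  unfolding op_linear_def line_op_def by (auto simp: algebra_simps fun_eq_iff)

definition line_ok :: "nat \<Rightarrow> nat \<Rightarrow> 'k \<times> 'k \<Rightarrow> 'k \<times> 'k \<Rightarrow> bool" where
  "line_ok M r P Q \<longleftrightarrow> regular (M + r) P \<and>
     (0 < r \<longrightarrow> regular (Suc (M + r)) Q \<and> (\<forall>t\<le>M + r. snd (orb t P) \<noteq> fst (orb t Q)))"

definition line_val :: "nat \<Rightarrow> 'k \<times> 'k \<Rightarrow> 'k \<times> 'k \<Rightarrow> nat \<Rightarrow> 'k free_alg \<Rightarrow> 'k" where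
  "line_val r P Q t f = wt r P Q t * wt r P Q (Suc t) * quad_val (pt (orb t P)) (pt (swp (orb (Suc t) Q))) f
     + wt r P Q t * wt r P Q (t - 1) * quad_val (pt (swp (orb t Q))) (pt (orb (t - 1) P)) f"

lemma act_line_quad:
  assumes "f \<in> hom_alg 2"
  shows "act (line_op M r P Q) f F (i, j) =
    (if Suc i < M then wt r P Q (i + (r - j)) * wt r P Q (Suc (i + (r - j)))
       * quad_val (pt (orb (i + (r - j)) P)) (pt (orb (Suc (i + (r - j))) P)) f * F (Suc (Suc i), j) else 0)
    + (if i < M \<and> j < r then line_val r P Q (i + (r - j)) f * F (Suc i, Suc j) else 0)
    + (if i \<le> M \<and> Suc j < r then wt r P Q (i + (r - j)) * wt r P Q (i + (r - j) - 1)
       * quad_val (pt (swp (orb (i + (r - j)) Q))) (pt (swp (orb (i + (r - j) - 1) Q))) f * F (i, Suc (Suc j)) else 0)"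
proof -
  let ?t = "\<lambda>i j. i + (r - j)"
  let ?A = "\<lambda>i j x. (if i < M then wt r P Q (?t i j) else 0) * pt (orb (?t i j) P) x"
  let ?B = "\<lambda>i j x. (if i \<le> M \<and> j < r then wt r P Q (?t i j) else 0) * pt (swp (orb (?t i j) Q)) x"
  have "act (line_op M r P Q) f F (i, j) = quad_val (?A i j) (?A (Suc i) j) f * F (Suc (Suc i), j)
     + (quad_val (?A i j) (?B (Suc i) j) f + quad_val (?B i j) (?A i (Suc j)) f) * F (Suc i, Suc j)
     + quad_val (?B i j) (?B i (Suc j)) f * F (i, Suc (Suc j))"
    by (rule act_quad[OF op_linear_line_op assms, where y = "?A i j" and z = "?B i j" and ?y1.0 = "?A (Suc i) j"
      and ?z1.0 = "?B (Suc i) j" and ?y2.0 = "?A i (Suc j)" and ?z2.0 = "?B i (Suc j)"])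
      (rule line_op_pair)+
  moreover have "?t (Suc i) j = Suc (?t i j)" "\<And>i. j < r \<Longrightarrow> ?t i (Suc j) = ?t i j - 1"
    by simp_all
  ultimately show ?thesis
    unfolding quad_val_scale line_val_def
    by (cases "j < r"; cases "i < M")
      (simp_all add: distrib_right mult_ac not_less Suc_le_eq del: Nat.add_diff_assoc Nat.diff_add_assoc)
qed

lemma quad_val_swp:
  assumes "regular n Q" "t < n" "\<And>u v w. consec v u w \<Longrightarrow> quad_val (pt (u, v)) (pt (w, u)) f = 0"
  shows "quad_val (pt (swp (orb (Suc t) Q))) (pt (swp (orb t Q))) f = 0"
proof -
  obtain u v where uv: "orb t Q = (u, v)" by (cases "orb t Q")
  have "consec v u (fst (nxt (u, v)))"
    using regular_consec[OF assms(1,2)] by (simp add: uv orb_Suc)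
  then have "quad_val (pt (u, fst (nxt (u, v)))) (pt (v, u)) f = 0"
    using assms(3) consec_sym by blast
  then show ?thesis by (simp add: orb_Suc uv swp_def) (simp add: nxt_def)
qed

lemma quad_val_orb:
  assumes "regular n P" "t < n" "\<And>u v w. consec v u w \<Longrightarrow> quad_val (pt (u, v)) (pt (w, u)) f = 0"
  shows "quad_val (pt (orb t P)) (pt (orb (Suc t) P)) f = 0"
proof -
  obtain u v where uv: "orb t P = (u, v)" by (cases "orb t P")
  have "consec v u (fst (nxt (u, v)))"
    using regular_consec[OF assms(1,2)] by (simp add: uv orb_Suc)
  then have "quad_val (pt (u, v)) (pt (fst (nxt (u, v)), u)) f = 0"
    using assms(3) by blast
  then show ?thesis by (simp add: orb_Suc uv) (simp add: nxt_def)
qed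

text \<open>Two steps in one direction use two successive points of an orbit, for \<open>Q\<close>
  in reversed order by the symmetry of \<open>consec\<close>, and there the form vanishes. Only the
  diagonal term remains.\<close>

lemma act_line_diag:
  assumes "line_ok M r P Q" "f \<in> hom_alg 2"
    and "\<And>u v w. consec v u w \<Longrightarrow> quad_val (pt (u, v)) (pt (w, u)) f = 0"
  shows "act (line_op M r P Q) f F (i, j) =
    (if i < M \<and> j < r then line_val r P Q (i + (r - j)) f * F (Suc i, Suc j) else 0)"
proof -
  have 1: "quad_val (pt (orb (i + (r - j)) P)) (pt (orb (Suc (i + (r - j))) P)) f = 0" if "Suc i < M"
    by (rule quad_val_orb[OF _ _ assms(3), of "M + r"]) (use assms(1) that in \<open>auto simp: line_ok_def\<close>)
  have 2: "quad_val (pt (swp (orb (i + (r - j)) Q))) (pt (swp (orb (i + (r - j) - 1) Q))) f = 0" if "i \<le> M" "Suc j < r"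
  proof -
    have "quad_val (pt (swp (orb (Suc (i + (r - j) - 1)) Q))) (pt (swp (orb (i + (r - j) - 1) Q))) f = 0"
      by (rule quad_val_swp[OF _ _ assms(3), of "Suc (M + r)"]) (use assms(1) that in \<open>auto simp: line_ok_def\<close>)
    moreover have "Suc (i + (r - j) - 1) = i + (r - j)" using that by simp
    ultimately show ?thesis by simp
  qed
  show ?thesis
    unfolding act_line_quad[OF assms(2)] using 1 2
    by (simp del: Nat.add_diff_assoc Nat.diff_add_assoc)
qed

lemma line_data:
  assumes "line_ok M r P Q" "0 < r" "Suc t < M + r"
  obtains u v w x y z where
    "orb (Suc t) P = (w, u)" "orb t P = (u, v)" "orb (Suc t) Q = (x, z)" "orb (Suc (Suc t)) Q = (y, x)"
    "consec v u w" "consec z x y" "den u \<noteq> 0" "den x \<noteq> 0" "w - y \<noteq> 0" "v - z \<noteq> 0" "u - x \<noteq> 0"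
    "\<And>f. line_val r P Q (Suc t) f = wt r P Q (Suc t) / ((w - y) * (v - z)) *
       ((v - z) * quad_val (pt (w, u)) (pt (x, y)) f + (w - y) * quad_val (pt (z, x)) (pt (u, v)) f)"
proof -
  have reg: "regular (M + r) P" "regular (Suc (M + r)) Q"
    and ne: "\<And>t. t \<le> M + r \<Longrightarrow> snd (orb t P) \<noteq> fst (orb t Q)"
    using assms by (auto simp: line_ok_def)
  define u v w x y z where d: "u = fst (orb t P)" "v = snd (orb t P)" "w = fst (orb (Suc t) P)"
    "x = fst (orb (Suc t) Q)" "y = fst (orb (Suc (Suc t)) Q)" "z = snd (orb (Suc t) Q)"
  have s: "snd (orb (Suc n) R) = fst (orb n R)" for n R by (simp add: orb_Suc nxt_def)
  have o: "orb (Suc t) P = (w, u)" "orb t P = (u, v)" "orb (Suc t) Q = (x, z)" "orb (Suc (Suc t)) Q = (y, x)"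
    by (simp_all add: d prod_eq_iff s)
  have c: "consec v u w" "consec z x y"
    using regular_consec[OF reg(1), of t] regular_consec[OF reg(2), of "Suc t"] assms(3) by (simp_all add: d)
  have dn: "den u \<noteq> 0" "den x \<noteq> 0"
    using reg assms(3) by (auto simp: regular_def d)
  have e: "w - y \<noteq> 0" "v - z \<noteq> 0" "u - x \<noteq> 0"
    using ne[of "Suc (Suc t)"] ne[of t] ne[of "Suc t"] assms(3) by (auto simp: d s)
  have "line_val r P Q (Suc t) f = wt r P Q (Suc t) / ((w - y) * (v - z)) *
       ((v - z) * quad_val (pt (w, u)) (pt (x, y)) f + (w - y) * quad_val (pt (z, x)) (pt (u, v)) f)" for f
  proof -
    have wts: "wt r P Q (Suc (Suc t)) = 1 / (w - y)" "wt r P Q t = 1 / (v - z)"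
      using assms(2) by (simp_all add: wt_def d s)
    show ?thesis
      using e(1,2) by (simp add: line_val_def o swp_def wts) (simp add: field_simps)
  qed
  then show ?thesis using that o c dn e by blast
qed

lemma line_val_rels:
  assumes "line_ok M r P Q" "0 < r" "Suc t < M + r" "f \<in> sklyanin_rels \<alpha> \<beta> \<gamma>"
  shows "line_val r P Q (Suc t) f = 0"
proof -
  from line_data[OF assms(1-3)] obtain u v w x y z where
    "consec v u w" "consec z x y" "den u \<noteq> 0" "den x \<noteq> 0"
    "line_val r P Q (Suc t) f = wt r P Q (Suc t) / ((w - y) * (v - z)) *
       ((v - z) * quad_val (pt (w, u)) (pt (x, y)) f + (w - y) * quad_val (pt (z, x)) (pt (u, v)) f)"
    by metis
  then show ?thesis using quad_val_rels_line[of v u w z x y f] assms(4) by simp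
qed

lemma act_line_J:
  assumes "line_ok M r P Q" "x \<in> J"
  shows "act (line_op M r P Q) x F = (\<lambda>_. 0)"
proof (rule act_ideal_gen[OF op_linear_line_op _ assms(2)], rule ext)
  fix f F and s :: "nat \<times> nat" assume f: "f \<in> sklyanin_rels \<alpha> \<beta> \<gamma>"
  obtain i j where s: "s = (i, j)" by (cases s)
  have "line_val r P Q (i + (r - j)) f = 0" if "i < M" "j < r"
  proof -
    have "Suc (i + (r - j) - 1) = i + (r - j)" using that by simp
    then show ?thesis
      using line_val_rels[OF assms(1) _ _ f, of "i + (r - j) - 1"] that by fastforce
  qed
  then show "act (line_op M r P Q) f F s = 0"
    unfolding s
    by (subst act_line_diag[OF assms(1) rels_hom[OF f]])
      (auto intro: quad_val_rels_point[OF _ f] simp del: Nat.add_diff_assoc Nat.diff_add_assoc)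
qed

lemma act_line_W:
  assumes "line_ok M r P Q" "W \<in> {W1, W2}"
  shows "act (line_op M r P Q) W F (i, j)
    = (if i < M \<and> j < r then line_val r P Q (i + (r - j)) W * F (Suc i, Suc j) else 0)"
  by (rule act_line_diag[OF assms(1)]) (use assms(2) quad_val_W_point in auto)

text \<open>A diagonal step leaves \<open>i + (r - j)\<close> unchanged, so every factor
  \<open>W\<close> contributes the same scalar.\<close>

lemma act_line_W_power:
  assumes "line_ok M r P Q" "W \<in> {W1, W2}"
  shows "act (line_op M r P Q) (W ^ k * b) F (i, j) = (if k = 0 \<or> i + k \<le> M \<and> j + k \<le> r
    then line_val r P Q (i + (r - j)) W ^ k * act (line_op M r P Q) b F (i + k, j + k) else 0)"
proof (induction k arbitrary: i j)
  case (Suc k)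
  have "act (line_op M r P Q) (W ^ Suc k * b) F (i, j)
     = act (line_op M r P Q) W (act (line_op M r P Q) (W ^ k * b) F) (i, j)"
    by (simp add: act_mult[OF op_linear_line_op, symmetric] mult.assoc)
  also have "\<dots> = (if i < M \<and> j < r then line_val r P Q (i + (r - j)) W
      * act (line_op M r P Q) (W ^ k * b) F (Suc i, Suc j) else 0)"
    by (rule act_line_W[OF assms])
  also have "\<dots> = (if Suc k = 0 \<or> i + Suc k \<le> M \<and> j + Suc k \<le> r
    then line_val r P Q (i + (r - j)) W ^ Suc k * act (line_op M r P Q) b F (i + Suc k, j + Suc k) else 0)"
  proof (cases "i < M \<and> j < r")
    case True
    then have "Suc i + (r - Suc j) = i + (r - j)" by linarith
    then show ?thesis
      using True by (simp only: Suc.IH) auto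
  next
    case False
    then show ?thesis by auto
  qed
  finally show ?case .
qed simp

text \<open>In the row \<open>j = r\<close> no step in the second direction is left, and up to the
  weights the module is the point module of \<open>P\<close>.\<close>

lemma act_line_bottom:
  assumes "b \<in> hom_alg m" "i + m \<le> M"
  shows "act (line_op M r P Q) b F (i, r)
     = (\<Prod>k<m. wt r P Q (i + k)) * ev (orb i P) b * F (i + m, r)"
  using assms(1)
proof (induction b rule: hom_alg_induct)
  case zero
  show ?case by (simp add: act_0 ev_linear)
next
  case (add f g)
  then show ?case by (simp add: act_add ev_linear algebra_simps)
next
  case (single c w)
  have "foldr (line_op M r P Q) w F (i, r)
     = (\<Prod>k<length w. wt r P Q (i + k)) * word_val w (orb i P) * F (i + length w, r)"
    if "i + length w \<le> M" for i
    using that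
  proof (induction w arbitrary: i)
    case (Cons x w)
    have "foldr (line_op M r P Q) (x # w) F (i, r) = wt r P Q i * pt (orb i P) x * foldr (line_op M r P Q) w F (Suc i, r)"
      using Cons.prems by (simp add: line_op_pair)
    moreover have "(\<Prod>k<Suc (length w). wt r P Q (i + k)) = wt r P Q i * (\<Prod>k<length w. wt r P Q (Suc i + k))"
      by (subst prod.lessThan_Suc_shift) simp
    ultimately show ?case
      using Cons.IH[of "Suc i"] Cons.prems by (simp add: orb_Suc)
  qed simp
  then show ?case
    using single assms(2) by (simp add: act_single ev_def)
qed

section \<open>The action of the Klein four-group on the curve\<close>

definition invp :: "'k \<times> 'k \<Rightarrow> 'k \<times> 'k" where "invp P = (1 / fst P, 1 / snd P)"

text \<open>The sign automorphisms act on the elliptic curve as translations by its 2-torsion points.\<close>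

definition tau :: "klein4 \<Rightarrow> 'k \<times> 'k \<Rightarrow> 'k \<times> 'k" where
  "tau h P = (case h of (p, q) \<Rightarrow>
     if q = 0 then (if p = 0 then P else neg P) else (if p = 0 then neg (invp P) else invp P))"

lemma tau_tau: "tau h (tau h P) = P"
  by (cases h) (auto simp: tau_def neg_def invp_def)

definition tgood :: "'k \<times> 'k \<Rightarrow> bool" where
  "tgood P \<longleftrightarrow> fst P \<noteq> 0 \<and> snd P \<noteq> 0 \<and> den (fst P) \<noteq> 0 \<and> fst P * fst P + \<alpha> \<noteq> 0"

lemma ae_tgood: "ae tgood"
proof -
  have 1: "ae (\<lambda>P. fst P \<noteq> 0)"
    using ae_fst_notin[of "{0}"] by simp
  have "ae (\<lambda>P. poly [:\<alpha>, 0, 1:] (fst P) + poly 0 (fst P) * snd P \<noteq> 0)"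
    by (rule ae_neq_0) simp
  then have "ae (\<lambda>P. fst P * fst P + \<alpha> \<noteq> 0)"
    by (simp add: add.commute)
  then show ?thesis
    unfolding tgood_def using 1 ae_swp[OF 1] ae_den
    by (intro ae_conj) (simp_all add: swp_def)
qed

text \<open>Inverting all coordinates exchanges the two equations of \<open>consec\<close>.\<close>

lemma nxt_invp:
  assumes "P \<in> curve" "tgood P"
  shows "nxt (invp P) = invp (nxt P)"
proof -
  obtain u v where P: "P = (u, v)" by (cases P)
  define w where "w = fst (nxt P)"
  have nP: "nxt P = (w, u)" by (simp add: w_def P nxt_def)
  have u: "u \<noteq> 0" and v: "v \<noteq> 0" and D: "den u \<noteq> 0" and E: "u * u + \<alpha> \<noteq> 0"
    using assms(2) by (simp_all add: tgood_def P)
  have c: "consec v u w"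
    using consec_nxt[of u v] assms(1) D by (simp add: P w_def)
  then have w: "w \<noteq> 0"
    using consec_prod[OF c] E by auto
  have "consec (1 / v) (1 / u) (1 / w)"
  proof -
    have "1 / v + 1 / w + \<alpha> * \<nu> * (1 / u) * (1 / v) * (1 / w) = (u * (v + w) + \<alpha> * \<nu>) / (u * v * w)"
      "\<nu> * (1 / u) = \<nu> * v * w / (u * v * w)" "\<nu> * (1 / v) * (1 / w) = \<nu> * u / (u * v * w)"
      "\<alpha> * \<nu> + 1 / u * (1 / v + 1 / w) = (v + w + \<alpha> * \<nu> * u * v * w) / (u * v * w)"
      using u v w by (simp_all add: field_simps)
    then show ?thesis
      using c unfolding consec_def by (simp add: add.commute)
  qed
  moreover have "den (1 / u) \<noteq> 0"
    using u E by (simp add: den_def divide_simps add.commute)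
  ultimately have "1 / w = fst (nxt (1 / u, 1 / v))"
    by (rule consec_unique)
  then show ?thesis
    unfolding nP by (simp add: P invp_def prod_eq_iff) (simp add: nxt_def)
qed

lemma orb_tau:
  assumes "\<And>j. j < n \<Longrightarrow> orb j P \<in> curve \<and> tgood (orb j P)"
  shows "orb n (tau h P) = tau h (orb n P)"
  using assms
proof (induction n)
  case (Suc n)
  then have "nxt (tau h (orb n P)) = tau h (nxt (orb n P))"
    by (cases h) (auto simp: tau_def nxt_neg nxt_invp)
  then show ?case using Suc by (simp add: orb_Suc)
qed simp

text \<open>At almost all points \<open>tau h\<close> commutes with \<open>orb m\<close>, and it is
  an involution. So \<open>orb m P = tau h P\<close> gives \<open>orb (m + m) P = P\<close>.\<close>

lemma ae_orb_neq_tau: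
  assumes "ae (\<lambda>P. orb (m + m) P \<noteq> P)"
  shows "ae (\<lambda>P. \<forall>h. orb m P \<noteq> tau h P)"
proof -
  have "ae (\<lambda>P. orb (m + m) P \<noteq> P \<and> (\<forall>j\<le>m. tgood (orb j P)) \<and> regular m P)"
    by (intro ae_conj assms ae_orb_le ae_tgood ae_regular)
  then show ?thesis
  proof (rule ae_mono)
    fix P assume P: "orb (m + m) P \<noteq> P \<and> (\<forall>j\<le>m. tgood (orb j P)) \<and> regular m P"
    show "\<forall>h. orb m P \<noteq> tau h P"
    proof (rule allI, rule notI)
      fix h assume h: "orb m P = tau h P"
      have "orb m (tau h P) = tau h (orb m P)"
        using P regular_curve[of m P] by (intro orb_tau) auto
      then have "orb (m + m) P = P"
        using h by (simp add: orb_add tau_tau)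
      then show False using P by simp
    qed
  qed
qed

text \<open>The coordinates of a point are u = eA/eC and v = -eD/eC. The bit \<open>p\<close>
  changes the signs of \<open>eB\<close> and \<open>eC\<close>; the bit \<open>q\<close> exchanges
  \<open>eA\<close> with \<open>eD\<close> and, up to sign, \<open>eB\<close> with
  \<open>eC\<close>, which inverts u and v up to sign.\<close>

lemma proportional_tau:
  assumes "c \<noteq> 0" "\<And>x. c * pt P' x = c' * (gen_sign h x * pt P x)" "fst P \<noteq> 0" "snd P \<noteq> 0"
  shows "P' = tau h P"
proof -
  obtain u v where P: "P = (u, v)" by (cases P)
  obtain u' v' where P': "P' = (u', v')" by (cases P')
  obtain p q where h: "h = (p, q)" by (cases h)
  have e: "c * (pt P' X0 + \<iota> * pt P' X1) = c' * (gen_sign h X0 * pt P X0 + \<iota> * (gen_sign h X1 * pt P X1))"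
    "c * (pt P' X0 - \<iota> * pt P' X1) = c' * (gen_sign h X0 * pt P X0 - \<iota> * (gen_sign h X1 * pt P X1))"
    "c * (\<iota> * pt P' X3 - pt P' X2) = c' * (\<iota> * (gen_sign h X3 * pt P X3) - gen_sign h X2 * pt P X2)"
    using assms(2)[of X0] assms(2)[of X1] assms(2)[of X2] assms(2)[of X3]
    by (simp_all add: distrib_left right_diff_distrib mult.left_commute)
  let ?q = "bsign q :: 'k" and ?p = "bsign p :: 'k"
  have 1: "2 * (c * u') = c' * ((u - v) + ?q * (u + v))"
    and 2: "- 2 * (c * v') = c' * ((u - v) - ?q * (u + v))"
    and 3: "2 * c = c' * (?p * (?q * (1 - u * v) + (1 + u * v)))"
    using e by (simp_all add: h P P' pt_simps i_simps)
  have u: "u \<noteq> 0" and v: "v \<noteq> 0" using assms(3,4) by (simp_all add: P)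
  have cancel: "x = y" if "2 * x = 2 * y" for x y :: 'k using that two_neq_0 by simp
  show ?thesis
  proof (cases "q = 0")
    case True
    have "c = c' * ?p" "c * u' = c' * u" "c * v' = c' * v"
      by (rule cancel, use 1 2 3 True in \<open>simp add: bsign_def algebra_simps\<close>)+
    then have "c * u' = c * (?p * u)" "c * v' = c * (?p * v)"
      by (auto simp: bsign_def)
    then show ?thesis
      using assms(1) True by (auto simp: P P' h tau_def neg_def bsign_def)
  next
    case False
    then have q: "?q = - 1" by (simp add: bsign_def)
    have "2 * c = 2 * (c' * (?p * (u * v)))" "2 * (c * u') = 2 * (- (c' * v))"
      unfolding 1 3 q by (simp_all add: algebra_simps)
    moreover have "2 * (c * v') = - (- 2 * (c * v'))" by simp
    then have "2 * (c * v') = 2 * (- (c' * u))"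
      unfolding 2 q by (simp add: algebra_simps)
    ultimately have 4: "c = c' * (?p * (u * v))" "c * u' = - (c' * v)" "c * v' = - (c' * u)"
      by (blast intro: cancel)+
    have "c * (?p * (u' * u)) = ?p * u * (c * u')" "c * (?p * (v' * v)) = ?p * v * (c * v')"
      by (simp_all add: mult_ac)
    moreover have "?p * u * (- (c' * v)) = c * - 1" "?p * v * (- (c' * u)) = c * - 1"
      by (subst 4(1), simp add: mult_ac)+
    ultimately have "c * (?p * (u' * u)) = c * - 1" "c * (?p * (v' * v)) = c * - 1"
      unfolding 4(2,3) by simp_all
    then have "?p * (u' * u) = - 1" "?p * (v' * v) = - 1"
      using assms(1) mult_left_cancel by blast+
    then have "u' = - ?p / u" "v' = - ?p / v"
      using u v by (auto simp: bsign_def field_simps eq_neg_iff_add_eq_0 split: if_splits)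
    then show ?thesis
      using False by (auto simp: P P' h tau_def neg_def invp_def bsign_def)
  qed
qed

section \<open>Independence of the central quadrics on lines\<close>

text \<open>Up to a nonzero factor the scalar by which \<open>W2\<close> acts on a line (see
  \<open>line_val_W\<close>), as a function of one coordinate from each orbit.\<close>

definition kq :: "'k \<Rightarrow> 'k \<Rightarrow> 'k" where
  "kq u x = (1 - \<alpha> * \<alpha>) * ((x + u) * (x + u) * inverse \<nu> - \<nu> * (1 - \<alpha> * u * x) * (x * u - \<alpha>))"

definition kq_poly :: "'k \<Rightarrow> 'k poly" where
  "kq_poly u = smult (1 - \<alpha> * \<alpha>) (smult (inverse \<nu>) ([:u, 1:] * [:u, 1:]) - smult \<nu> ([:1, - \<alpha> * u:] * [:- \<alpha>, u:]))"

lemma poly_kq_poly: "poly (kq_poly u) x = kq u x"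
  by (simp add: kq_poly_def kq_def algebra_simps)

lemma ae_kq: "u * u * inverse \<nu> + \<nu> * \<alpha> \<noteq> 0 \<Longrightarrow> ae (\<lambda>R. kq u (fst R) \<noteq> 0)"
proof -
  assume "u * u * inverse \<nu> + \<nu> * \<alpha> \<noteq> 0"
  moreover have "1 - \<alpha> * \<alpha> \<noteq> 0" using \<kappa>_neq by (auto simp: \<kappa>_def)
  ultimately have "poly (kq_poly u) 0 \<noteq> 0"
    unfolding poly_kq_poly kq_def by simp
  then have "kq_poly u \<noteq> 0" by auto
  then show ?thesis
    using ae_neq_0[of "kq_poly u" 0] by (simp add: poly_kq_poly)
qed

text \<open>With R = (x, z), the difference of the two sides reduces on the curve to p(x) + q(x) z,
  where q is a multiple of \<open>den_poly\<close> by \<open>den u * (w - v)\<close> and hence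
  nonzero. So a prescribed ratio of the two quadrics is attained for finitely many \<open>R\<close>
  at most.\<close>

lemma ae_ratio:
  assumes "v \<noteq> w" "den u \<noteq> 0"
  shows "ae (\<lambda>R. (w - fst (nxt R)) * (snd R - v) * (den u * den (fst R)) \<noteq> \<rho> * kq u (fst R))"
proof -
  define p where "p = smult (den u) (smult v [:0, \<kappa>:] - smult (w * v) den_poly - [:\<alpha>, 0, 1:]) - smult \<rho> (kq_poly u)"
  define q where "q = smult (den u * (w - v)) den_poly"
  have "q \<noteq> 0" using assms by (simp add: q_def)
  then have "ae (\<lambda>R. poly p (fst R) + poly q (fst R) * snd R \<noteq> 0 \<and> den (fst R) \<noteq> 0)"
    by (intro ae_conj ae_neq_0 ae_den disjI2)
  then show ?thesis
  proof (rule ae_mono)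
    fix R assume R: "R \<in> curve" and *: "poly p (fst R) + poly q (fst R) * snd R \<noteq> 0 \<and> den (fst R) \<noteq> 0"
    obtain x z where xz: "R = (x, z)" by (cases R)
    define y where "y = fst (nxt R)"
    have D: "den x \<noteq> 0" using * by (simp add: xz)
    have c: "consec z x y"
      using consec_nxt[of x z] R D by (simp add: xz y_def)
    have "(w - y) * (z - v) * (den u * den x)
       = den u * (w * z * den x - w * v * den x - den x * (z * y) + v * (den x * (z + y)) - v * z * den x)"
      by (simp add: algebra_simps)
    also have "\<dots> - \<rho> * kq u x = poly p x + poly q x * z"
      unfolding consec_sum[OF c] consec_prod[OF c]
      by (simp add: p_def q_def poly_kq_poly algebra_simps)
    finally have "(w - y) * (z - v) * (den u * den x) - \<rho> * kq u x \<noteq> 0"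
      using * by (simp add: xz)
    then show "(w - fst (nxt R)) * (snd R - v) * (den u * den (fst R)) \<noteq> \<rho> * kq u (fst R)"
      by (simp add: xz y_def)
  qed
qed

lemma line_val_W:
  assumes "line_ok M r P Q" "0 < r" "Suc t < M + r"
    and "kq (fst (orb t P)) (fst (orb (Suc t) Q)) \<noteq> 0"
  shows "line_val r P Q (Suc t) W2 \<noteq> 0"
    and "(fst (orb (Suc t) P) - fst (nxt (orb (Suc t) Q))) * (snd (orb (Suc t) Q) - snd (orb t P))
       * (den (fst (orb t P)) * den (fst (orb (Suc t) Q))) \<noteq> \<rho> * kq (fst (orb t P)) (fst (orb (Suc t) Q))
      \<Longrightarrow> line_val r P Q (Suc t) W1 \<noteq> \<rho> * line_val r P Q (Suc t) W2"
proof -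
  obtain u v w x y z where o: "orb (Suc t) P = (w, u)" "orb t P = (u, v)" "orb (Suc t) Q = (x, z)" "orb (Suc (Suc t)) Q = (y, x)"
    and c: "consec v u w" "consec z x y" "den u \<noteq> 0" "den x \<noteq> 0"
    and n: "w - y \<noteq> 0" "v - z \<noteq> 0" "u - x \<noteq> 0"
    and l: "\<And>f. line_val r P Q (Suc t) f = wt r P Q (Suc t) / ((w - y) * (v - z)) *
       ((v - z) * quad_val (pt (w, u)) (pt (x, y)) f + (w - y) * quad_val (pt (z, x)) (pt (u, v)) f)"
    by (rule line_data[OF assms(1-3)]) blast
  have y: "fst (nxt (orb (Suc t) Q)) = y" using o(4) by (simp add: orb_Suc)
  define g where "g = wt r P Q (Suc t) / ((w - y) * (v - z)) * (- 4 * (x - u)) / (den u * den x)"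
  have "wt r P Q (Suc t) \<noteq> 0"
    using n(3) assms(2) by (simp add: wt_def o)
  then have g: "g \<noteq> 0"
    using n c(3,4) four_neq_0 by (simp add: g_def)
  have frac: "d \<noteq> 0 \<Longrightarrow> e \<noteq> 0 \<Longrightarrow> a * (- 4 * (b * s)) = a * (- 4 * b) / (d * e) * (s * (d * e))" for a b s d e :: 'k
    by (simp add: field_simps)
  have frac2: "a * (- 4 * (b * s / (d * e) * f)) = a * (- 4 * b) / (d * e) * (s * f)" for a b s d e f :: 'k
    by (simp only: divide_inverse mult_ac)
  have l1: "line_val r P Q (Suc t) W1 = g * ((w - y) * (z - v) * (den u * den x))"
    unfolding l quad_val_W_line(1)[OF c] g_def using c(3,4) by (rule frac)
  have l2: "line_val r P Q (Suc t) W2 = g * kq u x"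
    unfolding l quad_val_W_line(2)[OF c] g_def kq_def slope_def by (rule frac2)
  show "line_val r P Q (Suc t) W2 \<noteq> 0"
    using g assms(4) by (simp add: l2 o)
  assume "(fst (orb (Suc t) P) - fst (nxt (orb (Suc t) Q))) * (snd (orb (Suc t) Q) - snd (orb t P))
       * (den (fst (orb t P)) * den (fst (orb (Suc t) Q))) \<noteq> \<rho> * kq (fst (orb t P)) (fst (orb (Suc t) Q))"
  then have "g * ((w - y) * (z - v) * (den u * den x)) \<noteq> g * (\<rho> * kq u x)"
    using g unfolding y by (simp add: o)
  then show "line_val r P Q (Suc t) W1 \<noteq> \<rho> * line_val r P Q (Suc t) W2"
    unfolding l1 l2 by (simp add: mult_ac)
qed

section \<open>Normal elements\<close>

lemma ae_orb_rev: "ae (\<lambda>P. \<Phi> (orb n P)) \<Longrightarrow> ae \<Phi>"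
proof (induction n arbitrary: \<Phi>)
  case (Suc n)
  from Suc.prems have "ae (\<lambda>P. \<Phi> (nxt (orb n P)))" by (simp only: orb_Suc)
  then have "ae (\<lambda>P. \<Phi> (nxt P))" by (rule Suc.IH)
  then show ?case by (rule ae_nxt_rev)
qed simp

text \<open>The open conditions on \<open>P\<close> for the comparison below. The index
  \<open>r - 1\<close> occurs because at the state (0, 0) the quadrics act at position
  \<open>r\<close>, and this involves the preceding point of the orbit of \<open>P\<close>.\<close>

definition base_ok :: "nat \<Rightarrow> nat \<Rightarrow> 'k \<times> 'k \<Rightarrow> bool" where
  "base_ok r m P \<longleftrightarrow> regular (Suc m + r + r) P \<and> fst (orb r P) \<noteq> 0 \<and> snd (orb r P) \<noteq> 0 \<and>
    (\<forall>h. orb m (orb r P) \<noteq> tau h (orb r P)) \<and>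
    (0 < r \<longrightarrow> snd (orb (r - 1) P) \<noteq> fst (nxt (orb (r - 1) P)) \<and>
      fst (orb (r - 1) P) * fst (orb (r - 1) P) * inverse \<nu> + \<nu> * \<alpha> \<noteq> 0)"

lemma ae_base_ok:
  assumes "ae (\<lambda>P. orb (m + m) P \<noteq> P)"
  shows "ae (base_ok r m)"
proof -
  have 1: "ae (\<lambda>P. fst P \<noteq> 0)" and 2: "ae (\<lambda>P. snd P \<noteq> 0)"
    using ae_tgood by (rule ae_mono, simp add: tgood_def)+
  have "ae (\<lambda>P. poly [:0, - \<kappa>:] (fst P) + poly (smult 2 den_poly) (fst P) * snd P \<noteq> 0 \<and> den (fst P) \<noteq> 0)"
    using \<kappa>_neq by (intro ae_conj ae_neq_0 ae_den) simp
  then have 3: "ae (\<lambda>P. snd P \<noteq> fst (nxt P))"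
    by (rule ae_mono) (auto simp: nxt_def divide_simps algebra_simps)
  have "ae (\<lambda>P. poly [:\<nu> * \<alpha>, 0, inverse \<nu>:] (fst P) + poly 0 (fst P) * snd P \<noteq> 0)"
    using \<nu>_neq by (intro ae_neq_0) simp
  then have 4: "ae (\<lambda>P. fst P * fst P * inverse \<nu> + \<nu> * \<alpha> \<noteq> 0)"
    by (rule ae_mono) (simp add: algebra_simps)
  have "ae (\<lambda>P. snd P \<noteq> fst (nxt P) \<and> fst P * fst P * inverse \<nu> + \<nu> * \<alpha> \<noteq> 0)"
    by (intro ae_conj 3 4)
  from ae_orb[OF this, of "r - 1"]
  have 5: "ae (\<lambda>P. 0 < r \<longrightarrow> snd (orb (r - 1) P) \<noteq> fst (nxt (orb (r - 1) P)) \<and>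
      fst (orb (r - 1) P) * fst (orb (r - 1) P) * inverse \<nu> + \<nu> * \<alpha> \<noteq> 0)"
    by (rule ae_mono) simp
  show ?thesis
    unfolding base_ok_def
    using ae_orb[OF 1, of r] ae_orb[OF 2, of r] ae_orb[OF ae_orb_neq_tau[OF assms], of r] 5 ae_regular
    by (intro ae_conj)
qed

lemma ae_line_ok:
  assumes "regular (M + r) P"
  shows "ae (line_ok M r P)"
proof -
  have "ae (\<lambda>Q. \<forall>t\<le>M + r. fst (orb t Q) \<notin> (\<lambda>t. snd (orb t P)) ` {..M + r})"
    by (rule ae_orb_le) (rule ae_fst_notin, simp)
  then have "ae (\<lambda>Q. (\<forall>t\<le>M + r. fst (orb t Q) \<notin> (\<lambda>t. snd (orb t P)) ` {..M + r}) \<and> regular (Suc (M + r)) Q)"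
    using ae_regular by (rule ae_conj)
  then show ?thesis
    by (rule ae_mono) (use assms in \<open>force simp: line_ok_def\<close>)
qed

lemma binary_form_nonzero:
  fixes c :: "nat \<Rightarrow> 'k"
  assumes "k \<le> r" "c k \<noteq> 0" "0 < r \<Longrightarrow> h2 \<noteq> 0"
    and "\<And>\<rho>. 0 < r \<Longrightarrow> poly (\<Sum>k\<le>r. monom (c k) k) \<rho> = 0 \<Longrightarrow> h1 \<noteq> \<rho> * h2"
  shows "(\<Sum>k\<le>r. h1 ^ k * h2 ^ (r - k) * c k) \<noteq> 0"
proof (cases "r = 0")
  case True
  then show ?thesis using assms by simp
next
  case False
  then have h2: "h2 \<noteq> 0" using assms(3) by simp
  have "(\<Sum>k\<le>r. h1 ^ k * h2 ^ (r - k) * c k) = h2 ^ r * poly (\<Sum>k\<le>r. monom (c k) k) (h1 / h2)"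
    unfolding poly_sum sum_distrib_left
  proof (rule sum.cong[OF refl])
    fix k assume "k \<in> {..r}"
    then have "h2 ^ r = h2 ^ k * h2 ^ (r - k)" by (simp flip: power_add)
    then show "h1 ^ k * h2 ^ (r - k) * c k = h2 ^ r * poly (monom (c k) k) (h1 / h2)"
      using h2 by (simp add: poly_monom power_divide)
  qed
  moreover have "poly (\<Sum>k\<le>r. monom (c k) k) (h1 / h2) \<noteq> 0"
    using assms(4)[of "h1 / h2"] h2 False by auto
  ultimately show ?thesis using h2 by simp
qed

text \<open>On a generic line module \<open>W1\<close> and \<open>W2\<close> act with an arbitrary ratio, so the leading coefficients of
  \<open>z\<close> cannot cancel. If they do not vanish at a point, normality of \<open>z\<close> makes the point a fixed point of
  a power of \<open>nxt\<close> up to 2-torsion.\<close>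

lemma normal_coefficients_vanish:
  assumes m: "0 < m" and P: "base_ok r m P" and b: "\<And>k. k \<le> r \<Longrightarrow> b k \<in> hom_alg m"
    and z: "z - (\<Sum>k\<le>r. W1 ^ k * (W2 ^ (r - k) * b k)) \<in> J"
    and normal: "\<And>x. z * fgen x - fconst (gen_sign h x) * (fgen x * z) \<in> J"
    and k: "k \<le> r"
  shows "ev (orb r P) (b k) = 0"
proof (rule ccontr)
  assume nz: "ev (orb r P) (b k) \<noteq> 0"
  \<comment> \<open>In the first direction \<open>z\<close> makes r + m steps, and the product
    \<open>z * fgen x\<close> needs one more.\<close>
  define M where "M = Suc m + r"
  define c where "c k = ev (orb r P) (b k)" for k
  define q where "q = (\<Sum>k\<le>r. monom (c k) k)"
  have "coeff q k = c k" using k by (simp add: q_def coeff_sum)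
  then have "q \<noteq> 0" using nz by (auto simp: c_def)
  then have fin: "finite {\<rho>. poly q \<rho> = 0}" by (rule poly_roots_finite)
  have regP: "regular (M + r) P" using P by (simp add: base_ok_def M_def)
  let ?u = "fst (orb (r - 1) P)" and ?v = "snd (orb (r - 1) P)" and ?w = "fst (nxt (orb (r - 1) P))"
  have "ae (\<lambda>Q. line_ok M r P Q \<and> (0 < r \<longrightarrow> kq ?u (fst (orb r Q)) \<noteq> 0 \<and>
     (\<forall>\<rho>\<in>{\<rho>. poly q \<rho> = 0}. (?w - fst (nxt (orb r Q))) * (snd (orb r Q) - ?v)
       * (den ?u * den (fst (orb r Q))) \<noteq> \<rho> * kq ?u (fst (orb r Q)))))"
  proof (rule ae_conj[OF ae_line_ok[OF regP]], cases "0 < r")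
    case True
    have du: "den ?u \<noteq> 0"
      using regP True by (auto simp: regular_def M_def)
    have "ae (\<lambda>R. kq ?u (fst R) \<noteq> 0 \<and> (\<forall>\<rho>\<in>{\<rho>. poly q \<rho> = 0}. (?w - fst (nxt R)) * (snd R - ?v)
       * (den ?u * den (fst R)) \<noteq> \<rho> * kq ?u (fst R)))"
      using P True by (intro ae_conj ae_kq ae_ball[OF fin] ae_ratio du) (auto simp: base_ok_def)
    from ae_orb[OF this, of r] show "ae (\<lambda>Q. 0 < r \<longrightarrow> kq ?u (fst (orb r Q)) \<noteq> 0 \<and>
     (\<forall>\<rho>\<in>{\<rho>. poly q \<rho> = 0}. (?w - fst (nxt (orb r Q))) * (snd (orb r Q) - ?v)
       * (den ?u * den (fst (orb r Q))) \<noteq> \<rho> * kq ?u (fst (orb r Q))))"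
      by (rule ae_mono) simp
  qed (simp add: ae_all)
  from ae_ex[OF this] obtain Q where ok: "line_ok M r P Q"
    and Q1: "0 < r \<Longrightarrow> kq ?u (fst (orb r Q)) \<noteq> 0"
    and Q2: "\<And>\<rho>. 0 < r \<Longrightarrow> poly q \<rho> = 0 \<Longrightarrow> (?w - fst (nxt (orb r Q))) * (snd (orb r Q) - ?v)
       * (den ?u * den (fst (orb r Q))) \<noteq> \<rho> * kq ?u (fst (orb r Q))"
    by blast
  let ?T = "line_op M r P Q"
  define h1 where "h1 = line_val r P Q r W1"
  define h2 where "h2 = line_val r P Q r W2"
  have \<Phi>: "(\<Sum>k\<le>r. h1 ^ k * h2 ^ (r - k) * c k) \<noteq> 0"
  proof (rule binary_form_nonzero[OF k])
    show "c k \<noteq> 0" using nz by (simp add: c_def)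
    assume r: "0 < r"
    then obtain t where t: "r = Suc t" by (cases r) auto
    have tM: "Suc t < M + r" by (simp add: M_def t)
    have o: "orb (Suc t) P = nxt (orb t P)" by (rule orb_Suc)
    show "h2 \<noteq> 0"
      unfolding h2_def using line_val_W(1)[OF ok r tM] Q1[OF r] by (simp add: t)
    fix \<rho> assume "poly (\<Sum>k\<le>r. monom (c k) k) \<rho> = 0"
    then show "h1 \<noteq> \<rho> * h2"
      unfolding h1_def h2_def
      using line_val_W(2)[OF ok r tM, of \<rho>] Q1[OF r] Q2[OF r, of \<rho>] by (simp add: t q_def o)
  qed
  have actz: "act ?T z F s = (\<Sum>k\<le>r. act ?T (W1 ^ k * (W2 ^ (r - k) * b k)) F s)" for F s
    using act_line_J[OF ok z, of F, THEN fun_cong, of s] by (simp add: act_diff act_sum)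
  \<comment> \<open>Starting at (0, 0), the r quadrics use up all steps in the second direction and
    lead to (r, r). From there b_k moves along the bottom row with value
    \<open>ev (orb r P) (b k)\<close>.\<close>
  have act00: "act ?T z F (0, 0) = (\<Prod>k<m. wt r P Q (r + k)) * (\<Sum>k\<le>r. h1 ^ k * h2 ^ (r - k) * c k) * F (r + m, r)" for F
  proof -
    have "act ?T (W1 ^ k * (W2 ^ (r - k) * b k)) F (0, 0)
      = (\<Prod>k<m. wt r P Q (r + k)) * (h1 ^ k * h2 ^ (r - k) * c k) * F (r + m, r)" if "k \<le> r" for k
    proof -
      have "act ?T (W1 ^ k * (W2 ^ (r - k) * b k)) F (0, 0) = h1 ^ k * act ?T (W2 ^ (r - k) * b k) F (k, k)"
        by (subst act_line_W_power[OF ok]) (use that in \<open>auto simp: h1_def M_def\<close>)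
      also have "act ?T (W2 ^ (r - k) * b k) F (k, k) = h2 ^ (r - k) * act ?T (b k) F (r, r)"
        by (subst act_line_W_power[OF ok]) (use that in \<open>auto simp: h2_def M_def\<close>)
      also have "act ?T (b k) F (r, r) = (\<Prod>k<m. wt r P Q (r + k)) * c k * F (r + m, r)"
        unfolding c_def by (rule act_line_bottom[OF b[OF that]]) (simp add: M_def)
      finally show ?thesis by (simp add: mult_ac)
    qed
    then show ?thesis unfolding actz by (simp add: sum_distrib_left sum_distrib_right)
  qed
  \<comment> \<open>After one step in the second direction only r - 1 diagonal steps remain, too few
    for r quadrics.\<close>
  have act01: "act ?T z F (0, Suc 0) = 0" if "0 < r" for F
  proof -
    have "act ?T (W1 ^ k * (W2 ^ (r - k) * b k)) F (0, Suc 0) = 0" if "k \<le> r" for k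
      using \<open>0 < r\<close> that by (cases "k = 0") (auto simp: act_line_W_power[OF ok])
    then show ?thesis unfolding actz by simp
  qed
  have wt: "wt r P Q t \<noteq> 0" if "t \<le> M + r" for t
    using ok that by (auto simp: wt_def line_ok_def)
  define F :: "nat \<times> nat \<Rightarrow> 'k" where "F = (\<lambda>_. 1)"
  define C where "C = (\<Prod>k<m. wt r P Q (r + k)) * (\<Sum>k\<le>r. h1 ^ k * h2 ^ (r - k) * c k) * wt r P Q (r + m)"
  have "C \<noteq> 0"
    unfolding C_def using \<Phi> wt by (auto simp: M_def)
  \<comment> \<open>Reading \<open>x\<close> after \<open>z\<close> evaluates it at position r + m,
    and reading it before \<open>z\<close> evaluates it at position r. Normality makes the two
    vectors proportional up to the signs of \<open>h\<close>.\<close>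
  moreover have "C * pt (orb m (orb r P)) x = (wt r P Q r * act ?T z F (Suc 0, 0)) * (gen_sign h x * pt (orb r P) x)" for x
  proof -
    have 1: "act ?T (z * fgen x) F (0, 0) = C * pt (orb (r + m) P) x"
      unfolding act_mult[OF op_linear_line_op] act_fgen act00
      by (simp add: line_op_pair F_def C_def M_def mult_ac)
    have 2: "act ?T (fgen x * z) F (0, 0) = wt r P Q r * pt (orb r P) x * act ?T z F (Suc 0, 0)"
      unfolding act_mult[OF op_linear_line_op] act_fgen
      using act01[of F] by (simp add: line_op_pair M_def)
    have "act ?T (z * fgen x) F (0, 0) = gen_sign h x * act ?T (fgen x * z) F (0, 0)"
      using act_line_J[OF ok normal[of x], of F, THEN fun_cong, of "(0, 0)"]
      by (simp add: act_diff act_fconst_mult)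
    moreover have "orb (r + m) P = orb m (orb r P)"
      by (simp add: add.commute[of r] orb_add)
    ultimately show ?thesis unfolding 1 2 by (simp add: mult_ac)
  qed
  ultimately have "orb m (orb r P) = tau h (orb r P)"
    by (rule proportional_tau) (use P in \<open>auto simp: base_ok_def\<close>)
  moreover have "\<forall>h. orb m (orb r P) \<noteq> tau h (orb r P)" using P unfolding base_ok_def by blast
  ultimately show False by blast
qed

lemma normal_coefficients_in_JW:
  assumes "\<And>n. 0 < n \<Longrightarrow> ae (\<lambda>P. orb n P \<noteq> P)"
    and "0 < m" "\<And>k. k \<le> r \<Longrightarrow> b k \<in> hom_alg m"
    and "z - (\<Sum>k\<le>r. W1 ^ k * (W2 ^ (r - k) * b k)) \<in> J"
    and "\<And>x. z * fgen x - fconst (gen_sign h x) * (fgen x * z) \<in> J"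
    and "k \<le> r"
  shows "b k \<in> JW"
proof (rule in_JW_if_vanishing[OF assms(3)[OF assms(6)]])
  have "ae (\<lambda>P. ev (orb r P) (b k) = 0)"
  proof (rule ae_mono)
    show "ae (base_ok r m)"
      using assms(1)[of "m + m"] assms(2) by (intro ae_base_ok) simp
    show "ev (orb r P) (b k) = 0" if "base_ok r m P" for P
      by (rule normal_coefficients_vanish[OF assms(2) that assms(3-6)])
  qed
  then show "ae (\<lambda>P. ev P (b k) = 0)" by (rule ae_orb_rev)
qed

section \<open>Raising the degree in the two quadrics\<close>

lemma commJ_power: "commJ (W2 ^ n) W1"
  by (induction n) (auto intro: commJ_mult_left commJ_sym[OF commJ_W2] simp: commJ_fconst[of 1, simplified])

text \<open>In the new sum \<open>f k\<close> belongs to index k + 1 and \<open>g k\<close> to index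
  k. To insert \<open>W1 * f k\<close>, the factor \<open>W1\<close> is moved past a power of
  \<open>W2\<close>.\<close>

lemma central_expansion_step:
  assumes "\<And>k. k \<le> r \<Longrightarrow> b k - W1 * f k - W2 * g k \<in> J"
    and "z - (\<Sum>k\<le>r. W1 ^ k * (W2 ^ (r - k) * b k)) \<in> J"
  shows "z - (\<Sum>k\<le>Suc r. W1 ^ k * (W2 ^ (Suc r - k) *
     ((if k = 0 then 0 else f (k - 1)) + (if k \<le> r then g k else 0)))) \<in> J"
proof -
  have 1: "W1 ^ k * (W2 ^ (r - k) * b k) - W1 ^ Suc k * (W2 ^ (r - k) * f k) - W1 ^ k * (W2 ^ (Suc r - k) * g k) \<in> J"
    if "k \<le> r" for k
  proof -
    have "W1 ^ k * (W2 ^ (r - k) * (b k - W1 * f k - W2 * g k))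
      + W1 ^ k * ((W2 ^ (r - k) * W1 - W1 * W2 ^ (r - k)) * f k) \<in> J"
      using commJ_power[of "r - k"] assms(1)[OF that] unfolding commJ_def
      by (intro ideal_gen_add ideal_gen_lmult ideal_gen_rmult)
    moreover have "W2 ^ (Suc r - k) = W2 ^ (r - k) * W2"
      using that by (simp add: Suc_diff_le power_commutes)
    moreover have "W1 ^ Suc k = W1 ^ k * W1" by (simp add: power_commutes)
    ultimately show ?thesis by (simp add: algebra_simps)
  qed
  have "(\<Sum>k\<le>Suc r. W1 ^ k * (W2 ^ (Suc r - k) * ((if k = 0 then 0 else f (k - 1)) + (if k \<le> r then g k else 0))))
    = (\<Sum>k\<le>Suc r. W1 ^ k * (W2 ^ (Suc r - k) * (if k = 0 then 0 else f (k - 1))))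
     + (\<Sum>k\<le>Suc r. W1 ^ k * (W2 ^ (Suc r - k) * (if k \<le> r then g k else 0)))"
    by (simp add: distrib_left sum.distrib)
  also have "(\<Sum>k\<le>Suc r. W1 ^ k * (W2 ^ (Suc r - k) * (if k = 0 then 0 else f (k - 1))))
     = (\<Sum>k\<le>r. W1 ^ Suc k * (W2 ^ (r - k) * f k))"
    by (subst sum.atMost_Suc_shift) simp
  also have "(\<Sum>k\<le>Suc r. W1 ^ k * (W2 ^ (Suc r - k) * (if k \<le> r then g k else 0)))
     = (\<Sum>k\<le>r. W1 ^ k * (W2 ^ (Suc r - k) * g k))"
    by simp
  finally have 2: "(\<Sum>k\<le>Suc r. W1 ^ k * (W2 ^ (Suc r - k) * ((if k = 0 then 0 else f (k - 1)) + (if k \<le> r then g k else 0))))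
    = (\<Sum>k\<le>r. W1 ^ Suc k * (W2 ^ (r - k) * f k)) + (\<Sum>k\<le>r. W1 ^ k * (W2 ^ (Suc r - k) * g k))" .
  have "(z - (\<Sum>k\<le>r. W1 ^ k * (W2 ^ (r - k) * b k)))
     + (\<Sum>k\<le>r. W1 ^ k * (W2 ^ (r - k) * b k) - W1 ^ Suc k * (W2 ^ (r - k) * f k) - W1 ^ k * (W2 ^ (Suc r - k) * g k)) \<in> J"
    by (intro ideal_gen_add assms(2) ideal_gen_sum 1) simp
  then show ?thesis
    unfolding 2 by (simp add: sum_subtractf sum.distrib algebra_simps)
qed

theorem normal_element_polynomial:
  assumes "\<And>n. 0 < n \<Longrightarrow> ae (\<lambda>P. orb n P \<noteq> P)"
    and "z \<in> hom_alg n"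
    and "\<And>x. z * fgen x - fconst (gen_sign h x) * (fgen x * z) \<in> J"
  shows "\<exists>r c. z - (\<Sum>k\<le>r. W1 ^ k * (W2 ^ (r - k) * fconst (c k))) \<in> J"
proof -
  have exp: "\<exists>b. (\<forall>k. b k \<in> hom_alg (n - 2 * r)) \<and> z - (\<Sum>k\<le>r. W1 ^ k * (W2 ^ (r - k) * b k)) \<in> J"
    if "2 * r \<le> n" for r
    using that
  proof (induction r)
    case 0
    show ?case
      by (rule exI[of _ "\<lambda>_. z"]) (simp add: assms(2) ideal_gen.zero)
  next
    case (Suc r)
    then obtain b where b: "\<And>k. b k \<in> hom_alg (n - 2 * r)" "z - (\<Sum>k\<le>r. W1 ^ k * (W2 ^ (r - k) * b k)) \<in> J"
      by auto
    have "\<exists>f g. f \<in> hom_alg (n - 2 * r - 2) \<and> g \<in> hom_alg (n - 2 * r - 2) \<and> b k - W1 * f - W2 * g \<in> J" if "k \<le> r" for k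
    proof -
      have "b k \<in> JW"
        by (rule normal_coefficients_in_JW[OF assms(1) _ b assms(3) that]) (use Suc.prems in auto)
      from JW_hom[OF this b(1)] show ?thesis by blast
    qed
    then obtain f g where fg: "\<And>k. k \<le> r \<Longrightarrow> f k \<in> hom_alg (n - 2 * r - 2) \<and> g k \<in> hom_alg (n - 2 * r - 2)
       \<and> b k - W1 * f k - W2 * g k \<in> J"
      by metis
    \<comment> \<open>The additional case \<open>Suc r < k\<close> makes the coefficient homogeneous
      at every index without changing the sum.\<close>
    let ?b = "\<lambda>k. (if k = 0 \<or> Suc r < k then 0 else f (k - 1)) + (if k \<le> r then g k else 0)"
    have "?b k \<in> hom_alg (n - 2 * Suc r)" for k
      using fg by (intro hom_alg_add) auto
    moreover have "(\<Sum>k\<le>Suc r. W1 ^ k * (W2 ^ (Suc r - k) * ?b k)) = (\<Sum>k\<le>Suc r. W1 ^ k * (W2 ^ (Suc r - k) *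
       ((if k = 0 then 0 else f (k - 1)) + (if k \<le> r then g k else 0))))"
      by (intro sum.cong) auto
    moreover have "z - (\<Sum>k\<le>Suc r. W1 ^ k * (W2 ^ (Suc r - k) *
       ((if k = 0 then 0 else f (k - 1)) + (if k \<le> r then g k else 0)))) \<in> J"
      by (rule central_expansion_step[OF _ b(2)]) (use fg in blast)
    ultimately show ?case by (intro exI[of _ ?b]) auto
  qed
  obtain b where b: "\<And>k. b k \<in> hom_alg (n - 2 * (n div 2))"
    "z - (\<Sum>k\<le>n div 2. W1 ^ k * (W2 ^ (n div 2 - k) * b k)) \<in> J"
    using exp[of "n div 2"] by auto
  show ?thesis
  proof (cases "even n")
    case True
    then have "\<forall>k. \<exists>c. b k = fconst c"
      using b(1) hom_alg_0_fconst by fastforce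
    then obtain c where "\<And>k. b k = fconst (c k)" by metis
    then show ?thesis using b(2) by auto
  next
    \<comment> \<open>For odd degree the last coefficients have degree one. In that degree
      \<open>JW\<close> and \<open>J\<close> agree, since the quadrics have degree two, so
      \<open>z\<close> itself lies in \<open>J\<close>.\<close>
    case False
    then have n: "n - 2 * (n div 2) = 1" by presburger
    have "b k \<in> J" if "k \<le> n div 2" for k
    proof -
      have "b k \<in> JW"
        by (rule normal_coefficients_in_JW[OF assms(1) _ b assms(3) that]) (use n in auto)
      from JW_hom[OF this b(1)[unfolded n]] show ?thesis by auto
    qed
    then have "(\<Sum>k\<le>n div 2. W1 ^ k * (W2 ^ (n div 2 - k) * b k)) \<in> J"
      by (intro ideal_gen_sum ideal_gen_lmult) auto
    with b(2) have "z \<in> J" using ideal_gen_add by fastforce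
    then show ?thesis by (intro exI[of _ 0] exI[of _ "\<lambda>_. 0"]) simp
  qed
qed

end

section \<open>The quotient ring\<close>

lemma sklyanin_ideal_eq: "sklyanin_ideal \<alpha> \<beta> \<gamma> = ideal_gen (sklyanin_rels \<alpha> \<beta> \<gamma>)"
  by (simp add: sklyanin_ideal_def genideal_eq_ideal_gen)

lemma ideal_sklyanin: "ideal (sklyanin_ideal \<alpha> \<beta> \<gamma>) free_ring"
  unfolding sklyanin_ideal_eq by (rule ideal_ideal_gen)

lemma ring_sklyanin: "ring (sklyanin \<alpha> \<beta> \<gamma>)"
  unfolding sklyanin_def by (rule ideal.quotient_is_ring[OF ideal_sklyanin])

lemma sk_class_eq: "sk_class \<alpha> \<beta> \<gamma> f = (\<lambda>j. j + f) ` ideal_gen (sklyanin_rels \<alpha> \<beta> \<gamma>)"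
  by (auto simp: sk_class_def sklyanin_ideal_eq a_r_coset_def')

lemma sk_class_eq_iff: "sk_class \<alpha> \<beta> \<gamma> f = sk_class \<alpha> \<beta> \<gamma> g \<longleftrightarrow> f - g \<in> ideal_gen (sklyanin_rels \<alpha> \<beta> \<gamma>)"
proof
  assume "sk_class \<alpha> \<beta> \<gamma> f = sk_class \<alpha> \<beta> \<gamma> g"
  moreover have "f \<in> sk_class \<alpha> \<beta> \<gamma> f"
    unfolding sk_class_eq using ideal_gen.zero by force
  ultimately obtain j where "j \<in> ideal_gen (sklyanin_rels \<alpha> \<beta> \<gamma>)" "f = j + g"
    unfolding sk_class_eq by blast
  then show "f - g \<in> ideal_gen (sklyanin_rels \<alpha> \<beta> \<gamma>)" by simp
next
  have *: "sk_class \<alpha> \<beta> \<gamma> f \<subseteq> sk_class \<alpha> \<beta> \<gamma> g" if "f - g \<in> ideal_gen (sklyanin_rels \<alpha> \<beta> \<gamma>)" for f g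
  proof
    fix x assume "x \<in> sk_class \<alpha> \<beta> \<gamma> f"
    then obtain j where "j \<in> ideal_gen (sklyanin_rels \<alpha> \<beta> \<gamma>)" "x = j + f"
      unfolding sk_class_eq by blast
    then have "x = (j + (f - g)) + g" "j + (f - g) \<in> ideal_gen (sklyanin_rels \<alpha> \<beta> \<gamma>)"
      using that by (auto intro: ideal_gen_add)
    then show "x \<in> sk_class \<alpha> \<beta> \<gamma> g" unfolding sk_class_eq by blast
  qed
  assume "f - g \<in> ideal_gen (sklyanin_rels \<alpha> \<beta> \<gamma>)"
  then show "sk_class \<alpha> \<beta> \<gamma> f = sk_class \<alpha> \<beta> \<gamma> g"
    using *[of f g] *[of g f] ideal_gen_uminus[of "f - g"] by auto
qed

lemma sklyanin_simps:
  "carrier (sklyanin \<alpha> \<beta> \<gamma>) = range (sk_class \<alpha> \<beta> \<gamma>)"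
  "sk_class \<alpha> \<beta> \<gamma> f \<oplus>\<^bsub>sklyanin \<alpha> \<beta> \<gamma>\<^esub> sk_class \<alpha> \<beta> \<gamma> g = sk_class \<alpha> \<beta> \<gamma> (f + g)"
  "sk_class \<alpha> \<beta> \<gamma> f \<otimes>\<^bsub>sklyanin \<alpha> \<beta> \<gamma>\<^esub> sk_class \<alpha> \<beta> \<gamma> g = sk_class \<alpha> \<beta> \<gamma> (f * g)"
  "\<one>\<^bsub>sklyanin \<alpha> \<beta> \<gamma>\<^esub> = sk_class \<alpha> \<beta> \<gamma> 1"
  "\<zero>\<^bsub>sklyanin \<alpha> \<beta> \<gamma>\<^esub> = sk_class \<alpha> \<beta> \<gamma> 0"
proof -
  interpret I: ideal "sklyanin_ideal \<alpha> \<beta> \<gamma>" free_ring by (rule ideal_sklyanin)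
  have hom: "sk_class \<alpha> \<beta> \<gamma> \<in> ring_hom free_ring (sklyanin \<alpha> \<beta> \<gamma>)"
    using I.rcos_ring_hom by (simp add: sk_class_def[abs_def] sklyanin_def)
  show "carrier (sklyanin \<alpha> \<beta> \<gamma>) = range (sk_class \<alpha> \<beta> \<gamma>)"
    by (auto simp: sklyanin_def FactRing_def A_RCOSETS_def' sk_class_def)
  show "sk_class \<alpha> \<beta> \<gamma> f \<oplus>\<^bsub>sklyanin \<alpha> \<beta> \<gamma>\<^esub> sk_class \<alpha> \<beta> \<gamma> g = sk_class \<alpha> \<beta> \<gamma> (f + g)"
    using ring_hom_add[OF hom, of f g] by simp
  show "sk_class \<alpha> \<beta> \<gamma> f \<otimes>\<^bsub>sklyanin \<alpha> \<beta> \<gamma>\<^esub> sk_class \<alpha> \<beta> \<gamma> g = sk_class \<alpha> \<beta> \<gamma> (f * g)"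
    using ring_hom_mult[OF hom, of f g] by simp
  show "\<one>\<^bsub>sklyanin \<alpha> \<beta> \<gamma>\<^esub> = sk_class \<alpha> \<beta> \<gamma> 1"
    using ring_hom_one[OF hom] by simp
  have "sk_class \<alpha> \<beta> \<gamma> 0 = sklyanin_ideal \<alpha> \<beta> \<gamma>"
    by (simp add: sk_class_eq sklyanin_ideal_eq)
  then show "\<zero>\<^bsub>sklyanin \<alpha> \<beta> \<gamma>\<^esub> = sk_class \<alpha> \<beta> \<gamma> 0"
    by (simp add: sklyanin_def FactRing_def)
qed

lemma a_inv_sklyanin: "\<ominus>\<^bsub>sklyanin \<alpha> \<beta> \<gamma>\<^esub> sk_class \<alpha> \<beta> \<gamma> f = sk_class \<alpha> \<beta> \<gamma> (- f)"
proof -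
  interpret ring "sklyanin \<alpha> \<beta> \<gamma>" by (rule ring_sklyanin)
  show ?thesis by (rule minus_equality) (simp_all add: sklyanin_simps)
qed

section \<open>Cyclic right modules\<close>

lemma comm_monoid_cong:
  assumes "Group.comm_monoid G" "carrier H = carrier G" "monoid.mult H = monoid.mult G" "\<one>\<^bsub>H\<^esub> = \<one>\<^bsub>G\<^esub>"
  shows "Group.comm_monoid H"
  using assms(1)
  unfolding Group.comm_monoid_def Group.monoid_def Group.comm_monoid_axioms_def assms(2-4) .

context ring
begin

lemma right_ideal_gen_props:
  assumes "S \<subseteq> carrier R"
  shows "additive_subgroup (right_ideal_gen R S) R" "S \<subseteq> right_ideal_gen R S"
    and "j \<in> right_ideal_gen R S \<Longrightarrow> a \<in> carrier R \<Longrightarrow> j \<otimes> a \<in> right_ideal_gen R S"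
proof -
  let ?\<J> = "{J. additive_subgroup J R \<and> S \<subseteq> J \<and> (\<forall>j\<in>J. \<forall>a\<in>carrier R. j \<otimes> a \<in> J)}"
  have "carrier R \<in> ?\<J>"
    using assms by (auto intro!: additive_subgroup.intro add.subgroup_self)
  then have "subgroup (\<Inter>?\<J>) (add_monoid R)"
    by (intro add.subgroups_Inter) (auto intro: additive_subgroup.a_subgroup)
  then show "additive_subgroup (right_ideal_gen R S) R"
    by (auto simp: right_ideal_gen_def intro: additive_subgroup.intro)
  show "S \<subseteq> right_ideal_gen R S"
    by (auto simp: right_ideal_gen_def)
  show "j \<in> right_ideal_gen R S \<Longrightarrow> a \<in> carrier R \<Longrightarrow> j \<otimes> a \<in> right_ideal_gen R S"
    by (auto simp: right_ideal_gen_def)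
qed

lemma right_ideal_gen_minimal:
  "additive_subgroup J R \<Longrightarrow> S \<subseteq> J \<Longrightarrow> (\<And>j a. j \<in> J \<Longrightarrow> a \<in> carrier R \<Longrightarrow> j \<otimes> a \<in> J)
    \<Longrightarrow> right_ideal_gen R S \<subseteq> J"
  by (auto simp: right_ideal_gen_def)

context
  fixes J and D :: "nat \<Rightarrow> 'a set"
  assumes J: "additive_subgroup J R" and closed: "\<And>j a. j \<in> J \<Longrightarrow> a \<in> carrier R \<Longrightarrow> j \<otimes> a \<in> J"
begin

lemma abelian_subgroup_J: "abelian_subgroup J R"
  by (rule abelian_subgroupI3[OF J is_abelian_group])

lemma coset_eq_iff:
  assumes "x \<in> carrier R"
  shows "J +> x = J \<longleftrightarrow> x \<in> J"
proof -
  interpret abelian_subgroup J R by (rule abelian_subgroup_J)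
  show ?thesis using a_rcos_self[OF assms] a_rcos_const by auto
qed

lemma ract_coset:
  assumes m: "m \<in> carrier R" and a: "a \<in> carrier R"
  shows "ract (right_quotient R D J) (J +> m) a = J +> (m \<otimes> a)"
proof -
  interpret abelian_subgroup J R by (rule abelian_subgroup_J)
  have "J +> (c \<otimes> a) = J +> (m \<otimes> a)" if cm: "c \<in> J +> m" for c
  proof -
    obtain j where j: "j \<in> J" "c = j \<oplus> m"
      using cm by (auto simp: a_r_coset_def')
    then have "j \<in> carrier R" using a_subset by auto
    then have "c \<otimes> a = j \<otimes> a \<oplus> m \<otimes> a"
      using j m a by (simp add: l_distr)
    moreover have "j \<otimes> a \<in> J" using closed j a by blast
    ultimately have "c \<otimes> a \<in> J +> (m \<otimes> a)"
      by (auto simp: a_r_coset_def')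
    then show ?thesis
      using m a a_repr_independence' by blast
  qed
  then have "(\<Union>c\<in>J +> m. J +> (c \<otimes> a)) = (\<Union>c\<in>J +> m. J +> (m \<otimes> a))"
    by (intro SUP_cong refl)
  moreover have "J +> m \<noteq> {}" using a_rcos_self[OF m] by blast
  ultimately show ?thesis
    by (simp add: right_quotient_def)
qed

lemma abelian_monoid_right_quotient: "abelian_monoid (right_quotient R D J)"
proof -
  interpret abelian_subgroup J R by (rule abelian_subgroup_J)
  have cm: "comm_monoid (R A_Mod J)"
    using a_factorgroup_is_comm_group by (rule comm_group.axioms)
  show ?thesis
    by (rule abelian_monoid.intro, rule comm_monoid_cong[OF cm])
      (simp_all add: right_quotient_def A_FactGroup_def')
qed

text \<open>A single coset is a sum of homogeneous elements all of whose other terms are the zero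
  coset \<open>J\<close>.\<close>

lemma shift_trunc_carrier:
  assumes D: "\<And>n. D n \<subseteq> carrier R" "\<And>n. \<zero> \<in> D n" and c: "c \<in> D (Suc n)"
  shows "J +> c \<in> carrier (shift_trunc (right_quotient R D J))"
proof -
  interpret S: abelian_subgroup J R by (rule abelian_subgroup_J)
  interpret M: abelian_monoid "right_quotient R D J" by (rule abelian_monoid_right_quotient)
  let ?M = "right_quotient R D J"
  have "J +> \<zero> = J"
    using D(2)[of 0] D(1)[of 0] by (subst coset_eq_iff) (auto simp: S.zero_closed)
  then have zero: "J \<in> piece ?M n" for n
    using D(2)[of n] by (force simp: right_quotient_def)
  let ?c = "\<lambda>k. if Suc n = k then J +> c else J"
  have "c \<in> carrier R" using D(1) c by blast
  then have "J +> c \<in> carrier ?M"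
    by (auto simp: right_quotient_def A_RCOSETS_def')
  then have "(\<Oplus>\<^bsub>?M\<^esub>k\<in>{1..Suc n}. if Suc n = k then J +> c else \<zero>\<^bsub>?M\<^esub>) = J +> c"
    by (intro M.finsum_singleton) auto
  moreover have z: "\<zero>\<^bsub>?M\<^esub> = J" by (simp add: right_quotient_def)
  ultimately have "finsum ?M ?c {1..Suc n} = J +> c" unfolding z by blast
  moreover have "\<forall>k. ?c k \<in> piece ?M k"
    using c zero by (auto simp: right_quotient_def)
  ultimately have "J +> c \<in> {finsum ?M c {1..N} | c N. \<forall>n. c n \<in> piece ?M n}"
    by (intro CollectI exI[of _ ?c] exI[of _ "Suc n"]) auto
  then show ?thesis
    unfolding shift_trunc_def by simp
qed

end

end

lemma shift_trunc_simps:
  "ract (shift_trunc M) = ract M" "piece (shift_trunc M) n = piece M (Suc n)"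
  by (simp_all add: shift_trunc_def)

lemma sk_piece_eq: "sk_piece \<alpha> \<beta> \<gamma> n = sk_class \<alpha> \<beta> \<gamma> ` hom_alg n"
  by (auto simp: sk_piece_def hom_alg_def)

context sklyanin_setup
begin

section \<open>The associated automorphism\<close>

abbreviation "A \<equiv> sklyanin \<alpha> \<beta> \<gamma>"
abbreviation "cl \<equiv> sk_class \<alpha> \<beta> \<gamma>"

text \<open>The annihilator of the generator in the point module of \<open>P\<close>, truncated
  after degree \<open>M\<close>. It is a right ideal, so it bounds the right ideal generated by
  linear forms from above without a basis of the quotient. \<open>M = 0\<close> detects the unit and
  \<open>M = 2\<close> products of two linear forms.\<close>

definition annih :: "nat \<Rightarrow> 'k \<times> 'k \<Rightarrow> 'k free_alg set set" where
  "annih M P = {cl g | g. \<forall>F. act (line_op M 0 P P) g F (0, 0) = 0}"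

lemma annih_iff:
  assumes "line_ok M 0 P P"
  shows "cl g \<in> annih M P \<longleftrightarrow> (\<forall>F. act (line_op M 0 P P) g F (0, 0) = 0)"
proof
  assume "cl g \<in> annih M P"
  then obtain h where h: "\<forall>F. act (line_op M 0 P P) h F (0, 0) = 0" "g - h \<in> J"
    by (auto simp: annih_def sk_class_eq_iff)
  then show "\<forall>F. act (line_op M 0 P P) g F (0, 0) = 0"
    using act_line_J[OF assms h(2), THEN fun_cong, of _ "(0, 0)"] by (simp add: act_diff)
qed (auto simp: annih_def)

lemma annih_right_ideal:
  assumes "line_ok M 0 P P"
  shows "additive_subgroup (annih M P) A"
    and "j \<in> annih M P \<Longrightarrow> a \<in> carrier A \<Longrightarrow> j \<otimes>\<^bsub>A\<^esub> a \<in> annih M P"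
proof -
  interpret ring A by (rule ring_sklyanin)
  note iff = annih_iff[OF assms]
  show "additive_subgroup (annih M P) A"
  proof (rule additive_subgroup.intro, rule add.subgroupI)
    show "annih M P \<subseteq> carrier A" by (auto simp: annih_def sklyanin_simps)
    have "cl 0 \<in> annih M P" unfolding iff by (simp add: act_0)
    then show "annih M P \<noteq> {}" by blast
    fix a b assume "a \<in> annih M P" "b \<in> annih M P"
    then obtain g h where gh: "a = cl g" "b = cl h" "cl g \<in> annih M P" "cl h \<in> annih M P"
      by (auto simp: annih_def)
    have "cl (- g) \<in> annih M P"
      using gh(3) unfolding iff using act_diff[of "line_op M 0 P P" 0 g] by (simp add: act_0)
    then show "\<ominus>\<^bsub>A\<^esub> a \<in> annih M P"
      by (simp add: gh a_inv_sklyanin)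
    have "cl (g + h) \<in> annih M P"
      using gh(3,4) unfolding iff by (simp add: act_add)
    then show "a \<oplus>\<^bsub>A\<^esub> b \<in> annih M P"
      by (simp add: gh sklyanin_simps)
  qed
  assume "j \<in> annih M P" "a \<in> carrier A"
  then obtain g h where gh: "j = cl g" "a = cl h" "cl g \<in> annih M P"
    by (auto simp: annih_def sklyanin_simps)
  then have "cl (g * h) \<in> annih M P"
    unfolding iff by (simp add: act_mult[OF op_linear_line_op])
  then show "j \<otimes>\<^bsub>A\<^esub> a \<in> annih M P"
    by (simp add: gh sklyanin_simps)
qed

lemma act_line_linear:
  "act (line_op M 0 P P) (\<Sum>i\<in>UNIV. fconst (c i) * fgen i) F (k, 0)
    = (if k < M then (\<Sum>i\<in>UNIV. c i * pt (orb k P) i) * F (Suc k, 0) else 0)"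
  by (simp add: act_sum act_fconst_mult act_fgen line_op_pair wt_def sum_distrib_right mult.assoc)

lemma right_ideal_gen_annih:
  assumes "line_ok M 0 P P" "0 < M \<Longrightarrow> pt P \<in> p"
  shows "right_ideal_gen A (point_perp \<alpha> \<beta> \<gamma> p) \<subseteq> annih M P"
proof -
  interpret ring A by (rule ring_sklyanin)
  show ?thesis
  proof (rule right_ideal_gen_minimal)
    show "point_perp \<alpha> \<beta> \<gamma> p \<subseteq> annih M P"
      using assms(2) by (auto simp: point_perp_def annih_iff[OF assms(1)] act_line_linear)
  qed (use annih_right_ideal[OF assms(1)] in auto)
qed

lemma proj_pointI: "c \<noteq> 0 \<Longrightarrow> (\<And>i. y i = c * z i) \<Longrightarrow> proj_point y = proj_point z"
proof -
  assume c: "c \<noteq> 0" and y: "\<And>i. y i = c * z i"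
  have 1: "(\<lambda>i. d * y i) = (\<lambda>i. (d * c) * z i)" for d using y by (simp add: mult.assoc)
  have 2: "(\<lambda>i. d * z i) = (\<lambda>i. (d / c) * y i)" for d using y c by simp
  show ?thesis
    unfolding proj_point_def
  proof (intro equalityI subsetI)
    fix x assume "x \<in> {\<lambda>i. d * y i |d. d \<noteq> 0}"
    then obtain d where "x = (\<lambda>i. d * y i)" "d \<noteq> 0" by blast
    then show "x \<in> {\<lambda>i. d * z i |d. d \<noteq> 0}"
      using c unfolding 1 by (intro CollectI exI[of _ "d * c"]) simp
  next
    fix x assume "x \<in> {\<lambda>i. d * z i |d. d \<noteq> 0}"
    then obtain d where "x = (\<lambda>i. d * z i)" "d \<noteq> 0" by blast
    then show "x \<in> {\<lambda>i. d * y i |d. d \<noteq> 0}"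
      using c unfolding 2 by (intro CollectI exI[of _ "d / c"]) simp
  qed
qed

lemma pt_neq_0: "\<exists>i. pt P i \<noteq> 0"
proof (rule ccontr)
  assume "\<not> (\<exists>i. pt P i \<noteq> 0)"
  then have "lin_val (pt P) eC = 0" by (simp add: lin_val_e)
  then show False using two_neq_0 by (cases P) (simp add: lin_val_pt)
qed

text \<open>The isomorphism sends the class of some linear form g to the generator. If a linear form
  h vanishes at y, it kills the generator, so g h is zero in the module of \<open>P\<close> and g(P)
  h(nxt P) = 0. But g(P) is nonzero, since otherwise the generator would be zero. So every linear
  form vanishing at y vanishes at \<open>nxt P\<close>.\<close>

lemma point_module_shift:
  assumes reg: "regular 2 P"
    and iso: "gr_rmodule_iso A (shift_trunc (point_module \<alpha> \<beta> \<gamma> (proj_point (pt P)))) (point_module \<alpha> \<beta> \<gamma> (proj_point y))"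
    and y: "y \<noteq> (\<lambda>_. 0)"
  shows "proj_point y = proj_point (pt (nxt P))"
proof -
  interpret ring A by (rule ring_sklyanin)
  define p where "p = proj_point (pt P)"
  define J1 where "J1 = right_ideal_gen A (point_perp \<alpha> \<beta> \<gamma> p)"
  define J2 where "J2 = right_ideal_gen A (point_perp \<alpha> \<beta> \<gamma> (proj_point y))"
  let ?D = "sk_piece \<alpha> \<beta> \<gamma>"
  have perp: "point_perp \<alpha> \<beta> \<gamma> q \<subseteq> carrier A" for q
    by (auto simp: point_perp_def sklyanin_simps)
  note props1 = right_ideal_gen_props[OF perp[of p], folded J1_def]
  note props2 = right_ideal_gen_props[OF perp[of "proj_point y"], folded J2_def]
  have ok2: "line_ok 2 0 P P" and ok0: "line_ok 0 0 P P"
    using reg by (auto simp: line_ok_def regular_def)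
  have "pt P \<in> p" unfolding p_def proj_point_def by (auto intro!: exI[of _ 1])
  then have J1: "J1 \<subseteq> annih 2 P"
    unfolding J1_def by (intro right_ideal_gen_annih[OF ok2])
  have J2: "J2 \<subseteq> annih 0 P"
    unfolding J2_def by (intro right_ideal_gen_annih[OF ok0]) simp
  define M1 where "M1 = right_quotient A ?D J1"
  define M2 where "M2 = right_quotient A ?D J2"
  have M: "point_module \<alpha> \<beta> \<gamma> (proj_point (pt P)) = M1" "point_module \<alpha> \<beta> \<gamma> (proj_point y) = M2"
    by (simp_all add: point_module_def M1_def M2_def J1_def J2_def p_def)
  from iso[unfolded M gr_rmodule_iso_def shift_trunc_simps] obtain f where f:
    "bij_betw f (carrier (shift_trunc M1)) (carrier M2) \<and>
     (\<forall>m\<in>carrier (shift_trunc M1). \<forall>m'\<in>carrier (shift_trunc M1).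
        f (m \<oplus>\<^bsub>shift_trunc M1\<^esub> m') = f m \<oplus>\<^bsub>M2\<^esub> f m') \<and>
     (\<forall>m\<in>carrier (shift_trunc M1). \<forall>a\<in>carrier A. f (ract M1 m a) = ract M2 (f m) a) \<and>
     (\<forall>n. f ` piece M1 (Suc n) = piece M2 n)"
    by (rule exE)
  have bij: "bij_betw f (carrier (shift_trunc M1)) (carrier M2)"
    using f by (rule conjunct1)
  have lin: "f (ract M1 m a) = ract M2 (f m) a" if "m \<in> carrier (shift_trunc M1)" "a \<in> carrier A" for m a
    using f that by simp
  have pieces: "f ` piece M1 (Suc n) = piece M2 n" for n
    using f by simp
  have Dsub: "?D n \<subseteq> carrier A" "\<zero>\<^bsub>A\<^esub> \<in> ?D n" for n
    by (auto simp: sk_piece_eq sklyanin_simps)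
  have carr: "J1 +>\<^bsub>A\<^esub> c \<in> carrier (shift_trunc M1)" if "c \<in> ?D (Suc n)" for c n
    unfolding M1_def
    by (rule shift_trunc_carrier[where D = ?D, OF props1(1) _ Dsub that]) (rule props1(3))
  have ract1: "ract M1 (J1 +>\<^bsub>A\<^esub> m) a = J1 +>\<^bsub>A\<^esub> (m \<otimes>\<^bsub>A\<^esub> a)" if "m \<in> carrier A" "a \<in> carrier A" for m a
    unfolding M1_def by (rule ract_coset[OF props1(1) _ that]) (rule props1(3))
  have ract2: "ract M2 (J2 +>\<^bsub>A\<^esub> m) a = J2 +>\<^bsub>A\<^esub> (m \<otimes>\<^bsub>A\<^esub> a)" if "m \<in> carrier A" "a \<in> carrier A" for m a
    unfolding M2_def by (rule ract_coset[OF props2(1) _ that]) (rule props2(3))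
  have coset1: "J1 +>\<^bsub>A\<^esub> x = J1 \<longleftrightarrow> x \<in> J1" if "x \<in> carrier A" for x
    by (rule coset_eq_iff[OF props1(1) _ that]) (rule props1(3))
  have coset2: "J2 +>\<^bsub>A\<^esub> x = J2 \<longleftrightarrow> x \<in> J2" if "x \<in> carrier A" for x
    by (rule coset_eq_iff[OF props2(1) _ that]) (rule props2(3))
  have "cl 1 \<in> ?D 0"
    using hom_alg_fconst[of 1] by (auto simp: sk_piece_eq)
  then have "J2 +>\<^bsub>A\<^esub> cl 1 \<in> piece M2 0"
    by (auto simp: M2_def right_quotient_def)
  then obtain g where g: "g \<in> hom_alg 1" "f (J1 +>\<^bsub>A\<^esub> cl g) = J2 +>\<^bsub>A\<^esub> cl 1"
    unfolding pieces[symmetric] by (auto simp: M1_def right_quotient_def sk_piece_eq)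
  have gD: "cl g \<in> ?D (Suc 0)" using g(1) by (auto simp: sk_piece_eq)
  have in_A [simp]: "cl x \<in> carrier A" for x by (simp add: sklyanin_simps)
  have f_mult: "f (J1 +>\<^bsub>A\<^esub> cl (g * h)) = J2 +>\<^bsub>A\<^esub> cl h" for h
    using lin[OF carr[OF gD], of "cl h"] ract1[of "cl g" "cl h"] ract2[of "cl 1" "cl h"]
    by (simp add: g(2) sklyanin_simps)
  have f_J1: "f J1 = J2"
    using f_mult[of 0] coset1[of "cl 0"] coset2[of "cl 0"]
      additive_subgroup.zero_closed[OF props1(1)] additive_subgroup.zero_closed[OF props2(1)]
    by (simp add: sklyanin_simps)
  have J1_carr: "J1 \<in> carrier (shift_trunc M1)"
    using carr[of "cl 0" 0] coset1[of "cl 0"]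
      additive_subgroup.zero_closed[OF props1(1)] Dsub(2)[of "Suc 0"]
    by (simp add: sklyanin_simps)
  have g_P: "lin_val (pt P) g \<noteq> 0"
  proof
    assume 0: "lin_val (pt P) g = 0"
    obtain c where c: "g = (\<Sum>i\<in>UNIV. fconst (c i) * fgen i)"
      by (rule hom_alg_1_cases[OF g(1)])
    have "(\<Sum>i\<in>UNIV. c i * pt P i) = 0"
      using 0 by (simp add: c lin_val_sum lin_val_linear lin_val_fgen)
    then have "(\<Sum>i\<in>UNIV. c i * (d * pt P i)) = 0" for d
      using sum_distrib_left[of d "\<lambda>i. c i * pt P i" UNIV] by (simp add: mult_ac)
    then have "cl g \<in> point_perp \<alpha> \<beta> \<gamma> p"
      unfolding point_perp_def p_def proj_point_def c by blast
    then have "cl g \<in> J1" using props1(2) by blast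
    then have "J1 +>\<^bsub>A\<^esub> cl g = J1"
      using coset1[of "cl g"] by simp
    then have "J2 +>\<^bsub>A\<^esub> cl 1 = J2" using g(2) f_J1 by simp
    then have "cl 1 \<in> J2"
      using coset2[of "cl 1"] by simp
    then have "act (line_op 0 0 P P) 1 (\<lambda>_. 1) (0, 0) = 0"
      using J2 annih_iff[OF ok0] by blast
    then show False
      using act_single[of "line_op 0 0 P P" "[]" 1 "\<lambda>_. 1"] by (simp flip: fconst_1 add: fconst_single)
  qed
  have vanish: "(\<Sum>i\<in>UNIV. c i * pt (nxt P) i) = 0" if c: "(\<Sum>i\<in>UNIV. c i * y i) = 0" for c
  proof -
    define h where "h = (\<Sum>i\<in>UNIV. fconst (c i) * fgen i)"
    have hom_h: "h \<in> hom_alg 1"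
      unfolding h_def by (intro hom_alg_sum hom_alg_fconst_mult hom_alg_fgen)
    have "(\<Sum>i\<in>UNIV. c i * (d * y i)) = 0" for d
      using c sum_distrib_left[of d "\<lambda>i. c i * y i" UNIV] by (simp add: mult_ac)
    then have "cl h \<in> point_perp \<alpha> \<beta> \<gamma> (proj_point y)"
      unfolding point_perp_def proj_point_def h_def by blast
    then have "cl h \<in> J2" using props2(2) by blast
    then have "f (J1 +>\<^bsub>A\<^esub> cl (g * h)) = f J1"
      unfolding f_mult f_J1 using coset2[of "cl h"] by simp
    moreover have "g * h \<in> hom_alg (Suc (Suc 0))"
      using hom_alg_mult[OF g(1) hom_h] by simp
    then have "J1 +>\<^bsub>A\<^esub> cl (g * h) \<in> carrier (shift_trunc M1)"
      by (intro carr[of _ "Suc 0"]) (auto simp: sk_piece_eq)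
    ultimately have "J1 +>\<^bsub>A\<^esub> cl (g * h) = J1"
      using bij J1_carr by (auto simp: bij_betw_def inj_on_def)
    then have "cl (g * h) \<in> J1"
      using coset1[of "cl (g * h)"] by simp
    then have *: "act (line_op 2 0 P P) (g * h) (\<lambda>_. 1) (0, 0) = 0"
      using J1 annih_iff[OF ok2] by blast
    obtain b where b: "g = (\<Sum>i\<in>UNIV. fconst (b i) * fgen i)"
      by (rule hom_alg_1_cases[OF g(1)])
    have "act (line_op 2 0 P P) g (act (line_op 2 0 P P) h (\<lambda>_. 1)) (0, 0)
        = lin_val (pt P) g * (\<Sum>i\<in>UNIV. c i * pt (nxt P) i)"
      unfolding h_def b act_line_linear
      by (simp add: lin_val_sum lin_val_linear lin_val_fgen orb_Suc[of 0, simplified])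
    with * g_P show ?thesis
      by (simp add: act_mult[OF op_linear_line_op])
  qed
  obtain i0 where i0: "y i0 \<noteq> 0" using y by auto
  \<comment> \<open>The forms with coefficient \<open>y i0\<close> at \<open>j\<close> and
    \<open>- y j\<close> at \<open>i0\<close> vanish at \<open>y\<close>; at \<open>nxt P\<close>
    they give proportionality.\<close>
  have prp: "y i0 * pt (nxt P) j = y j * pt (nxt P) i0" for j
  proof -
    define c where "c = (\<lambda>i. (if i = j then y i0 else 0) - (if i = i0 then y j else 0))"
    have s: "(\<Sum>i\<in>UNIV. c i * z i) = y i0 * z j - y j * z i0" for z
      by (simp add: c_def left_diff_distrib sum_subtractf if_distrib[of "\<lambda>x. x * _"] cong: if_cong)
    show ?thesis
      using vanish[of c] unfolding s by simp
  qed
  obtain j where j: "pt (nxt P) j \<noteq> 0" using pt_neq_0 by blast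
  have "pt (nxt P) i0 \<noteq> 0"
    using prp[of j] i0 j by auto
  then show ?thesis
    using i0 prp by (intro proj_pointI[of "y i0 / pt (nxt P) i0"]) (auto simp: field_simps)
qed

end

lemma finite_bij_funpow_id:
  assumes "finite N" "bij_betw f N N"
  obtains m where "0 < m" "\<And>x. x \<in> N \<Longrightarrow> (f ^^ m) x = x"
proof -
  have into: "(f ^^ k) x \<in> N" if "x \<in> N" for k x
    using bij_betw_funpow[OF assms(2), of k] that by (auto simp: bij_betw_def)
  have "\<not> inj (\<lambda>k. restrict (f ^^ k) N)"
  proof
    assume "inj (\<lambda>k. restrict (f ^^ k) N)"
    then have "infinite (range (\<lambda>k. restrict (f ^^ k) N))"
      by (simp add: finite_image_iff)
    moreover have "range (\<lambda>k. restrict (f ^^ k) N) \<subseteq> N \<rightarrow>\<^sub>E N"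
      using into by auto
    ultimately show False
      using finite_PiE[of N "\<lambda>_. N"] assms(1) finite_subset by blast
  qed
  then obtain k l where kl: "k < l" "restrict (f ^^ k) N = restrict (f ^^ l) N"
    unfolding inj_def by (metis nat_neq_iff)
  show thesis
  proof (rule that[of "l - k"])
    fix x assume x: "x \<in> N"
    have "(f ^^ k) ((f ^^ (l - k)) x) = (f ^^ l) x"
      using kl(1) by (simp flip: funpow_add[THEN fun_cong, simplified])
    also have "\<dots> = (f ^^ k) x"
      using kl(2) x by (metis restrict_apply')
    finally show "(f ^^ (l - k)) x = x"
      using bij_betw_funpow[OF assms(2), of k] x into[OF x] by (auto simp: bij_betw_def inj_on_def)
  qed (use kl in simp)
qed

context sklyanin_setup
begin

section \<open>The projective curve and its plane model\<close>

lemma curve_coeffs: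
  shows "(1 + \<gamma>) / (1 - \<beta>) = 1 - \<alpha> * ((1 - \<gamma>) / (1 + \<alpha>))"
    and "\<kappa> * ((1 - \<gamma>) / (1 + \<alpha>)) = 2 * (1 + \<gamma>)"
    and "(1 - \<gamma>) / (1 + \<alpha>) * (1 + \<alpha>) = 1 - \<gamma>"
proof -
  have "(1 + \<gamma>) * (1 + \<alpha>) - (1 - \<beta>) * (1 + \<alpha> - \<alpha> * (1 - \<gamma>)) = \<alpha> + \<beta> + \<gamma> + \<alpha> * \<beta> * \<gamma>"
    by (simp add: algebra_simps)
  then have "(1 + \<gamma>) * (1 + \<alpha>) = (1 - \<beta>) * (1 + \<alpha> - \<alpha> * (1 - \<gamma>))"
    by (simp add: params)
  then show "(1 + \<gamma>) / (1 - \<beta>) = 1 - \<alpha> * ((1 - \<gamma>) / (1 + \<alpha>))"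
    using \<alpha>_neq \<beta>_neq by (simp add: divide_simps mult.commute)
  have "\<kappa> * (1 - \<gamma>) = 2 * (1 + \<gamma>) * (1 + \<alpha>)"
    unfolding \<nu>_eq'[symmetric] \<kappa>_def by (simp add: algebra_simps)
  then show "\<kappa> * ((1 - \<gamma>) / (1 + \<alpha>)) = 2 * (1 + \<gamma>)"
    using \<alpha>_neq by (simp add: divide_simps)
qed (use \<alpha>_neq in simp)

lemma pt_quadrics:
  "pt (u, v) X0 ^ 2 + pt (u, v) X1 ^ 2 + pt (u, v) X2 ^ 2 + pt (u, v) X3 ^ 2 = 0"
  "pt (u, v) X3 ^ 2 + (1 - \<gamma>) / (1 + \<alpha>) * pt (u, v) X1 ^ 2 + (1 + \<gamma>) / (1 - \<beta>) * pt (u, v) X2 ^ 2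
    = (1 - \<gamma>) / (1 + \<alpha>) * (\<kappa> * u * v - (\<alpha> * (1 + u * u * v * v) + u * u + v * v))"
proof -
  define a where "a = (1 - \<gamma>) / (1 + \<alpha>)"
  have sq: "pt (u, v) X1 ^ 2 = - ((u + v) * (u + v))" "pt (u, v) X3 ^ 2 = - ((1 - u * v) * (1 - u * v))"
    "pt (u, v) X2 ^ 2 = (1 + u * v) * (1 + u * v)"
    by (simp_all add: pt_simps power2_eq_square i_simps algebra_simps)
  show "pt (u, v) X0 ^ 2 + pt (u, v) X1 ^ 2 + pt (u, v) X2 ^ 2 + pt (u, v) X3 ^ 2 = 0"
    unfolding sq by (simp add: pt_simps power2_eq_square algebra_simps)
  have k: "\<kappa> * a = 4 - 2 * (a * (1 + \<alpha>))"
    using curve_coeffs(2,3) by (simp add: a_def)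
  have "a * (\<kappa> * u * v - (\<alpha> * (1 + u * u * v * v) + u * u + v * v))
     = (\<kappa> * a) * (u * v) - a * (\<alpha> * (1 + u * u * v * v) + u * u + v * v)"
    by (simp add: algebra_simps)
  also have "\<dots> = - ((1 - u * v) * (1 - u * v)) + a * - ((u + v) * (u + v))
      + (1 - \<alpha> * a) * ((1 + u * v) * (1 + u * v))"
    unfolding k by (simp add: algebra_simps)
  finally show "pt (u, v) X3 ^ 2 + (1 - \<gamma>) / (1 + \<alpha>) * pt (u, v) X1 ^ 2 + (1 + \<gamma>) / (1 - \<beta>) * pt (u, v) X2 ^ 2
    = (1 - \<gamma>) / (1 + \<alpha>) * (\<kappa> * u * v - (\<alpha> * (1 + u * u * v * v) + u * u + v * v))"
    unfolding curve_coeffs(1) sq a_def[symmetric] by simp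
qed

abbreviation Q :: "'k \<times> 'k \<Rightarrow> (gen \<Rightarrow> 'k) set" where "Q P \<equiv> proj_point (pt P)"

lemma Q_in_sk_curve:
  assumes "P \<in> curve"
  shows "Q P \<in> sk_curve \<alpha> \<beta> \<gamma>"
proof -
  obtain u v where uv: "P = (u, v)" by (cases P)
  have "pt P \<noteq> (\<lambda>_. 0)" using pt_neq_0[of P] by auto
  then show ?thesis
    using assms pt_quadrics[of u v] unfolding sk_curve_def uv curve_def
    by (intro CollectI exI[of _ "pt (u, v)"]) auto
qed

text \<open>The points of the curve with vanishing \<open>eC\<close> coordinate, which
  \<open>pt\<close> misses. There the first quadric splits into two linear factors and the second
  leaves t^2 = -\<alpha>, so they are finite in number.\<close>

definition extra :: "'k \<times> 'k \<Rightarrow> gen \<Rightarrow> 'k" where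
  "extra = (\<lambda>(s, t) i. case i of X0 \<Rightarrow> s * t | X1 \<Rightarrow> t | X2 \<Rightarrow> \<iota> | X3 \<Rightarrow> 1)"

lemma sk_curve_cases:
  assumes "p \<in> sk_curve \<alpha> \<beta> \<gamma>"
  shows "p \<in> Q ` curve \<or> p \<in> (\<lambda>x. proj_point (extra x)) ` ({\<iota>, - \<iota>} \<times> {t. poly [:\<alpha>, 0, 1:] t = 0})"
proof -
  obtain y where y: "p = proj_point y" "y \<noteq> (\<lambda>_. 0)"
    and 1: "y X0 ^ 2 + y X1 ^ 2 + y X2 ^ 2 + y X3 ^ 2 = 0"
    and 2: "y X3 ^ 2 + (1 - \<gamma>) / (1 + \<alpha>) * y X1 ^ 2 + (1 + \<gamma>) / (1 - \<beta>) * y X2 ^ 2 = 0"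
    using assms unfolding sk_curve_def by blast
  define c where "c = \<iota> * y X3 - y X2"
  have a: "(1 - \<gamma>) / (1 + \<alpha>) \<noteq> 0" using \<alpha>_neq \<gamma>_neq by simp
  show ?thesis
  proof (cases "c = 0")
    case False
    define u where "u = (y X0 + \<iota> * y X1) / c"
    define v where "v = - (y X0 - \<iota> * y X1) / c"
    have "(y X0 + \<iota> * y X1) * - (y X0 - \<iota> * y X1) = - (y X0 ^ 2 + y X1 ^ 2)"
      by (simp add: power2_eq_square i_simps algebra_simps)
    also have "\<dots> = y X2 ^ 2 + y X3 ^ 2"
      by (rule minus_unique) (use 1 in \<open>simp add: add.assoc\<close>)
    also have "\<dots> = - (y X2 + \<iota> * y X3) * c"
      by (simp add: c_def power2_eq_square i_simps algebra_simps)
    finally have "u * v = - (y X2 + \<iota> * y X3) * c / (c * c)"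
      unfolding u_def v_def by simp
    then have uv: "c * (u * v) = - (y X2 + \<iota> * y X3)"
      using False by simp
    have cu: "c * u = y X0 + \<iota> * y X1" and cv: "c * v = - (y X0 - \<iota> * y X1)"
      using False by (simp_all add: u_def v_def)
    have y_eq: "2 * y i = c * pt (u, v) i" for i
    proof (cases i)
      case X0
      have "c * (u - v) = c * u - c * v" by (simp add: algebra_simps)
      then show ?thesis using X0 cu cv by (simp add: pt_simps)
    next
      case X1
      have "c * (- \<iota> * (u + v)) = - \<iota> * (c * u + c * v)" by (simp add: algebra_simps)
      also have "\<dots> = 2 * y X1" unfolding cu cv by (simp add: i_simps algebra_simps)
      finally show ?thesis using X1 by (simp add: pt_simps)
    next
      case X2
      have "c * - (1 + u * v) = - (c + c * (u * v))" by (simp add: algebra_simps)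
      also have "\<dots> = 2 * y X2" unfolding uv by (simp add: c_def)
      finally show ?thesis using X2 by (simp add: pt_simps)
    next
      case X3
      have "c * (- \<iota> * (1 - u * v)) = - \<iota> * (c - c * (u * v))" by (simp add: algebra_simps)
      also have "\<dots> = 2 * y X3" unfolding uv by (simp add: c_def i_simps algebra_simps)
      finally show ?thesis using X3 by (simp add: pt_simps)
    qed
    have sq: "(c * c) * pt (u, v) i ^ 2 = 4 * y i ^ 2" for i
    proof -
      have "(c * c) * pt (u, v) i ^ 2 = (c * pt (u, v) i) ^ 2" by (simp add: power2_eq_square mult_ac)
      also have "\<dots> = 4 * y i ^ 2" unfolding y_eq[symmetric] by (simp add: power2_eq_square)
      finally show ?thesis .
    qed
    have "(c * c) * (pt (u, v) X3 ^ 2 + (1 - \<gamma>) / (1 + \<alpha>) * pt (u, v) X1 ^ 2 + (1 + \<gamma>) / (1 - \<beta>) * pt (u, v) X2 ^ 2)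
       = (c * c) * pt (u, v) X3 ^ 2 + (1 - \<gamma>) / (1 + \<alpha>) * ((c * c) * pt (u, v) X1 ^ 2)
         + (1 + \<gamma>) / (1 - \<beta>) * ((c * c) * pt (u, v) X2 ^ 2)"
      by (simp only: distrib_left mult_ac)
    also have "\<dots> = 4 * (y X3 ^ 2 + (1 - \<gamma>) / (1 + \<alpha>) * y X1 ^ 2 + (1 + \<gamma>) / (1 - \<beta>) * y X2 ^ 2)"
      unfolding sq by (simp only: distrib_left mult_ac)
    also have "\<dots> = 0" using 2 by simp
    finally have "(u, v) \<in> curve"
      unfolding pt_quadrics using False a by (simp add: curve_def)
    moreover have "p = Q (u, v)"
      unfolding y(1) using False y_eq two_neq_0 by (intro proj_pointI[of "c / 2"]) (auto simp: field_simps)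
    ultimately show ?thesis by blast
  next
    case True
    then have y2: "y X2 = \<iota> * y X3" by (simp add: c_def)
    have "(y X0 - \<iota> * y X1) * (y X0 + \<iota> * y X1) = 0"
      using 1 unfolding y2 by (simp add: power2_eq_square i_simps algebra_simps)
    then obtain s where s: "s \<in> {\<iota>, - \<iota>}" "y X0 = s * y X1"
      using that[of \<iota>] that[of "- \<iota>"] by (auto simp: eq_neg_iff_add_eq_0)
    have "a * (y X1 * y X1 + \<alpha> * (y X3 * y X3)) = y X3 ^ 2 + a * y X1 ^ 2 + (1 - \<alpha> * a) * y X2 ^ 2" for a
      unfolding y2 by (simp add: power2_eq_square i_simps algebra_simps)
    then have "(1 - \<gamma>) / (1 + \<alpha>) * (y X1 * y X1 + \<alpha> * (y X3 * y X3)) = 0"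
      using 2 unfolding curve_coeffs(1) by metis
    then have 3: "y X1 * y X1 + \<alpha> * (y X3 * y X3) = 0" using a by simp
    have y3: "y X3 \<noteq> 0"
    proof
      assume "y X3 = 0"
      then have "y i = 0" for i
        using 3 s(2) y2 by (cases i) auto
      then show False using y(2) by auto
    qed
    have "p = proj_point (extra (s, y X1 / y X3))"
      unfolding y(1)
    proof (rule proj_pointI[OF y3])
      fix i show "y i = y X3 * extra (s, y X1 / y X3) i"
        using y3 s(2) y2 by (cases i) (simp_all add: extra_def)
    qed
    moreover have "poly [:\<alpha>, 0, 1:] (y X1 / y X3) = 0"
      using 3 y3 by (simp add: field_simps)
    ultimately show ?thesis using s(1) by blast
  qed
qed

lemma finite_sk_curve_exception:
  assumes "ae \<Phi>"
  shows "finite (sk_curve \<alpha> \<beta> \<gamma> - Q ` {P \<in> curve. \<Phi> P})"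
proof (rule finite_subset)
  let ?E = "(\<lambda>x. proj_point (extra x)) ` ({\<iota>, - \<iota>} \<times> {t. poly [:\<alpha>, 0, 1:] t = 0})"
  show "sk_curve \<alpha> \<beta> \<gamma> - Q ` {P \<in> curve. \<Phi> P} \<subseteq> Q ` {P \<in> curve. \<not> \<Phi> P} \<union> ?E"
    using sk_curve_cases by blast
  have "finite {t. poly [:\<alpha>, 0, 1:] t = 0}" by (rule poly_roots_finite) simp
  then show "finite (Q ` {P \<in> curve. \<not> \<Phi> P} \<union> ?E)"
    using assms by (simp add: ae_def)
qed

text \<open>The maps \<sigma> and \<open>nxt\<close> are compared at almost all points only. If
  \<open>orb n\<close> were the identity there, the power n of \<sigma> would move finitely many
  points; it permutes these, so a further power of \<sigma> would be the identity
  everywhere.\<close>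

lemma ae_orb_neq:
  assumes aut: "associated_automorphism \<alpha> \<beta> \<gamma> \<sigma>" and inf: "infinite_order_on (sk_curve \<alpha> \<beta> \<gamma>) \<sigma>"
    and n: "0 < n"
  shows "ae (\<lambda>P. orb n P \<noteq> P)"
proof (rule ccontr)
  let ?S = "sk_curve \<alpha> \<beta> \<gamma>"
  have bij: "bij_betw \<sigma> ?S ?S" using aut by (simp add: associated_automorphism_def)
  have step: "ae (\<lambda>P. \<sigma> (Q P) = Q (nxt P))"
  proof (rule ae_mono[OF ae_conj[OF ae_regular[of 2] ae_all[of "\<lambda>P. P \<in> curve"]]])
    fix P assume P: "P \<in> curve" "regular 2 P \<and> P \<in> curve"
    have S: "Q P \<in> ?S" by (rule Q_in_sk_curve[OF P(1)])
    then have "\<sigma> (Q P) \<in> ?S" using bij by (auto simp: bij_betw_def)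
    then obtain y where y: "\<sigma> (Q P) = proj_point y" "y \<noteq> (\<lambda>_. 0)"
      unfolding sk_curve_def by blast
    have "gr_rmodule_iso A (shift_trunc (point_module \<alpha> \<beta> \<gamma> (Q P))) (point_module \<alpha> \<beta> \<gamma> (\<sigma> (Q P)))"
      using aut S by (simp add: associated_automorphism_def)
    then show "\<sigma> (Q P) = Q (nxt P)"
      unfolding y(1) using P(2) y(2) point_module_shift by blast
  qed simp
  have steps: "ae (\<lambda>P. (\<sigma> ^^ m) (Q P) = Q (orb m P))" for m
  proof (induction m)
    case 0
    show ?case by (rule ae_all) simp
  next
    case (Suc m)
    show ?case
      by (rule ae_mono[OF ae_conj[OF Suc ae_orb[OF step, of m]]]) (simp add: orb_Suc)
  qed
  assume "\<not> ae (\<lambda>P. orb n P \<noteq> P)"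
  then have "ae (\<lambda>P. orb n P = P)" using orb_dichotomy by blast
  then have "ae (\<lambda>P. (\<sigma> ^^ n) (Q P) = Q P)"
    using ae_mono[OF ae_conj[OF steps[of n]], of "\<lambda>P. orb n P = P"] by simp
  from finite_sk_curve_exception[OF this]
  have fin: "finite {p \<in> ?S. (\<sigma> ^^ n) p \<noteq> p}" (is "finite ?N")
    by (rule rev_finite_subset) auto
  have bijn: "bij_betw (\<sigma> ^^ n) ?S ?S" by (rule bij_betw_funpow[OF bij])
  have "(\<sigma> ^^ n) ` ?N \<subseteq> ?N"
    using bijn by (auto simp: bij_betw_def inj_on_def)
  moreover have "inj_on (\<sigma> ^^ n) ?N"
    using bijn by (auto simp: bij_betw_def intro: inj_on_subset)
  ultimately have "bij_betw (\<sigma> ^^ n) ?N ?N"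
    using endo_inj_surj[OF fin] by (auto simp: bij_betw_def)
  then obtain m where m: "0 < m" "\<And>p. p \<in> ?N \<Longrightarrow> ((\<sigma> ^^ n) ^^ m) p = p"
    using finite_bij_funpow_id[OF fin] by blast
  have "(\<sigma> ^^ (n * m)) p = p" if "p \<in> ?S" for p
  proof (cases "(\<sigma> ^^ n) p = p")
    case True
    have "((\<sigma> ^^ n) ^^ m) p = p" by (induction m) (simp_all add: True)
    then show ?thesis by (simp add: funpow_mult mult.commute)
  next
    case False
    then show ?thesis using m(2)[of p] that by (simp add: funpow_mult mult.commute)
  qed
  moreover have "0 < n * m" using n m by simp
  ultimately show False
    using inf unfolding infinite_order_on_def by blast
qed

end

section \<open>The group grading\<close>

lemma UNIV_klein4: "(UNIV :: klein4 set) = {(0, 0), (0, 1), (1, 0), (1, 1)}"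
proof -
  have "(UNIV :: bit set) = {0, 1}" by (auto simp: bit_not_zero_iff)
  then show ?thesis by (auto simp flip: UNIV_Times_UNIV)
qed

instance bit :: finite
  by standard (metis (full_types) UNIV_eq_I bit_not_zero_iff finite.emptyI finite.insertI insert_iff)

lemma klein4_cases:
  obtains "g = ((0, 0) :: klein4)" | "g = (0, 1)" | "g = (1, 0)" | "g = (1, 1)"
  using UNIV_klein4 by blast

lemma sum_klein4: "(\<Sum>g\<in>(UNIV :: klein4 set). F g) = F (0, 0) + F (0, 1) + F (1, 0) + F (1, 1)"
  by (simp add: UNIV_klein4 add.assoc)

lemma bsign_square: "bsign a * bsign a = (1 :: 'k::field)"
  by (simp add: bsign_def)

lemma klein_char_add: "klein_char h (g + g') = (klein_char h g * klein_char h g' :: 'k::field)"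
  by (cases h rule: klein4_cases; cases g rule: klein4_cases; cases g' rule: klein4_cases)
    (simp_all add: bsign_def)

lemma klein_char_0: "klein_char h 0 = 1" "klein_char h (0, 0) = 1"
  by (cases h; simp add: bsign_def zero_prod_def)+

lemma klein_char_square: "klein_char h g * klein_char h g = (1 :: 'k::field)"
  by (cases h; cases g) (simp add: bsign_square)

lemma klein_char_orthogonal:
  "(\<Sum>h\<in>UNIV. klein_char h g * klein_char h g') = (if g = g' then 4 else 0 :: 'k::field)"
  by (cases g rule: klein4_cases; cases g' rule: klein4_cases) (simp_all add: sum_klein4 bsign_def)

fun gdeg :: "gen \<Rightarrow> klein4" where
  "gdeg X0 = (0, 0)" | "gdeg X1 = (1, 0)" | "gdeg X2 = (0, 1)" | "gdeg X3 = (1, 1)"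

definition wdeg :: "gen list \<Rightarrow> klein4" where "wdeg w = sum_list (map gdeg w)"

lemma wdeg_simps [simp]: "wdeg [] = 0" "wdeg (i # w) = gdeg i + wdeg w" "wdeg (u @ v) = wdeg u + wdeg v"
  by (simp_all add: wdeg_def)

lemma gen_sign_gdeg: "gen_sign h i = klein_char h (gdeg i)"
  by (cases i) (simp_all add: gen_sign_eq_klein_char)

definition gpart :: "klein4 \<Rightarrow> 'k::field free_alg \<Rightarrow> 'k free_alg" where
  "gpart g = diag_op (\<lambda>w. if wdeg w = g then 1 else 0)"

definition gsign :: "klein4 \<Rightarrow> 'k::field free_alg \<Rightarrow> 'k free_alg" where
  "gsign h = diag_op (\<lambda>w. klein_char h (wdeg w))"

lemma gsign_mult: "gsign h (f * f') = gsign h f * gsign h f'"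
  unfolding gsign_def by (rule diag_op_mult_char) (simp add: klein_char_add)

lemma gsign_gsign: "gsign h (gsign h f) = f"
  using diag_op_ident_on[of f "\<lambda>_. 1" 1]
  by (simp add: gsign_def diag_op_comp klein_char_square)

lemma gsign_fgen: "gsign h (fgen i) = fconst (gen_sign h i) * fgen i"
  by (simp add: gsign_def fgen_def diag_op_single fconst_mult_single gen_sign_gdeg)

lemma fsubst_gsign: "fsubst (\<lambda>i. fconst (gen_sign h i) * fgen i) f = gsign h f"
proof -
  have word: "prod_list (map (\<lambda>i. fconst (gen_sign h i) * fgen i) w)
     = (Poly_Mapping.single (Word w) (klein_char h (wdeg w)) :: 'a free_alg)" for w
  proof (induction w)
    case Nil
    show ?case by (simp add: klein_char_0 flip: fconst_single)
  next
    case (Cons i w)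
    then show ?case
      by (simp add: fgen_def fconst_mult_single single_Word_mult gen_sign_gdeg klein_char_add)
  qed
  have "gsign h (\<Sum>w\<in>Poly_Mapping.keys f. Poly_Mapping.single w (Poly_Mapping.lookup f w))
     = (\<Sum>w\<in>Poly_Mapping.keys f. Poly_Mapping.single w (klein_char h (wdeg (letters w)) * Poly_Mapping.lookup f w))"
    unfolding gsign_def diag_op_sum
    by (intro sum.cong refl) (metis diag_op_single word.exhaust_sel)
  moreover have "fconst c * Poly_Mapping.single v d = Poly_Mapping.single v (d * c)" for c d :: 'a and v
    by (cases v) (simp add: fconst_mult_single mult.commute)
  ultimately show ?thesis
    unfolding free_alg_sum_single[symmetric] fsubst_def word by simp
qed

lemma gpart_idem: "gpart g (gpart g' f) = (if g = g' then gpart g f else 0)"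
  by (rule poly_mapping_eqI) (auto simp: gpart_def lookup_diag_op)

lemma gpart_sum: "(\<Sum>g\<in>UNIV. gpart g f) = f"
  by (rule poly_mapping_eqI) (simp add: lookup_sum gpart_def lookup_diag_op if_distrib[of "\<lambda>x. x * _"] cong: if_cong)

lemma gsign_gpart: "gsign h (gpart g f) = fconst (klein_char h g) * gpart g f"
  unfolding gsign_def
  by (rule diag_op_ident_on) (auto simp: gpart_def keys_diag_op split: if_splits)

lemma gpart_mult_fgen:
  "gpart (g + gdeg i) (f * fgen i) = gpart g f * fgen i" "gpart (g + gdeg i) (fgen i * f) = fgen i * gpart g f"
proof -
  show "gpart (g + gdeg i) (f * fgen i) = gpart g f * fgen i"
    unfolding gpart_def by (rule diag_op_mult_right) (auto simp: fgen_def)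
  show "gpart (g + gdeg i) (fgen i * f) = fgen i * gpart g f"
    unfolding gpart_def by (rule diag_op_mult_left) (auto simp: fgen_def add.commute[of g])
qed

lemmas gpart_linear = diag_op_add[of "\<lambda>w. if wdeg w = _ then 1 else 0", folded gpart_def]
  diag_op_diff[of "\<lambda>w. if wdeg w = _ then 1 else 0", folded gpart_def]
  diag_op_sum[of "\<lambda>w. if wdeg w = _ then 1 else 0", folded gpart_def]
  diag_op_fconst_mult[of "\<lambda>w. if wdeg w = _ then 1 else 0", folded gpart_def]

context sklyanin_setup
begin

lemma gsign_linear:
  "gsign h (f + f') = gsign h f + gsign h f'" "gsign h (f - f') = gsign h f - gsign h f'"
  "gsign h (fconst c * f) = fconst c * gsign h f" "gsign h 0 = 0"
  by (simp_all add: gsign_def diag_op_add diag_op_diff diag_op_fconst_mult)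

text \<open>All products in one relation have the same degree in G, for instance those of x0, x1 and
  of x2, x3. So the relation is an eigenvector of each sign automorphism.\<close>

lemma gsign_rels:
  assumes "s \<in> sklyanin_rels \<alpha> \<beta> \<gamma>"
  shows "\<exists>c. gsign h s = fconst c * s"
proof -
  have x: "gsign h (fgen i * fgen j) = fconst (gen_sign h i * gen_sign h j) * (fgen i * fgen j)" for i j
    by (simp add: gsign_mult gsign_fgen fconst_mult mult.assoc fconst_left_commute[of "fgen i"])
  have comm: "gsign h (commutator (fgen i) (fgen j)) = fconst (gen_sign h i * gen_sign h j) * commutator (fgen i) (fgen j)"
    and anti: "gsign h (anticommutator (fgen i) (fgen j)) = fconst (gen_sign h i * gen_sign h j) * anticommutator (fgen i) (fgen j)" for i j
    by (simp_all add: commutator_def anticommutator_def gsign_linear x mult.commute[of "gen_sign h j"]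
      right_diff_distrib distrib_left)
  have sgn: "gen_sign h X0 * gen_sign h X1 = (gen_sign h X2 * gen_sign h X3 :: 'k)"
    "gen_sign h X0 * gen_sign h X2 = (gen_sign h X3 * gen_sign h X1 :: 'k)"
    "gen_sign h X0 * gen_sign h X3 = (gen_sign h X1 * gen_sign h X2 :: 'k)"
    by (cases h rule: klein4_cases; simp add: bsign_def)+
  have rel: "gsign h (commutator (fgen i) (fgen j) - fconst c * anticommutator (fgen k) (fgen l))
      = fconst e * (commutator (fgen i) (fgen j) - fconst c * anticommutator (fgen k) (fgen l))"
    "gsign h (anticommutator (fgen i) (fgen j) - commutator (fgen k) (fgen l))
      = fconst e * (anticommutator (fgen i) (fgen j) - commutator (fgen k) (fgen l))"
    if "gen_sign h i * gen_sign h j = e" "gen_sign h k * gen_sign h l = e" for i j k l c e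
    by (simp_all add: gsign_linear comm anti that right_diff_distrib fconst_mult_mult mult.commute[of c])
  show ?thesis
    using assms unfolding sklyanin_rels_def
    by (elim insertE emptyE; simp only:) (rule exI, rule rel, rule sgn, rule refl)+
qed

lemma gsign_J: "x \<in> J \<Longrightarrow> gsign h x \<in> J"
proof (induction rule: ideal_gen.induct)
  case (add s x a b)
  have "s \<in> J" by (rule ideal_gen_incl[OF add.hyps(1)])
  then have "gsign h s \<in> J"
    using gsign_rels[OF add.hyps(1), of h] ideal_gen_lmult by auto
  then show ?case
    unfolding gsign_linear gsign_mult
    by (intro ideal_gen_add ideal_gen_lmult ideal_gen_rmult add.IH)
qed (simp add: gsign_linear ideal_gen.zero)

text \<open>Orthogonality of characters writes the projection through the sign automorphisms, which
  preserve \<open>J\<close>. As 4 is invertible, the projection preserves \<open>J\<close>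
  too.\<close>

lemma gpart_eq_average: "fconst 4 * gpart g f = (\<Sum>h\<in>UNIV. fconst (klein_char h g) * gsign h f)"
proof (rule poly_mapping_eqI)
  fix w
  have "(\<Sum>h\<in>UNIV. klein_char h g * (klein_char h (wdeg (letters w)) * Poly_Mapping.lookup f w))
     = (\<Sum>h\<in>UNIV. klein_char h g * klein_char h (wdeg (letters w))) * Poly_Mapping.lookup f w"
    by (simp only: sum_distrib_right mult.assoc)
  then show "Poly_Mapping.lookup (fconst 4 * gpart g f) w
     = Poly_Mapping.lookup (\<Sum>h\<in>UNIV. fconst (klein_char h g) * gsign h f) w"
    unfolding gpart_def gsign_def diag_op_scale[symmetric] lookup_sum lookup_diag_op klein_char_orthogonal
    by (simp add: mult.assoc)
qed

lemma in_J_cancel: "c \<noteq> 0 \<Longrightarrow> fconst c * x \<in> J \<Longrightarrow> x \<in> J"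
  using ideal_gen_lmult[of "fconst c * x" _ "fconst (1 / c)"] by (simp add: fconst_mult_mult)

lemma gpart_J: "x \<in> J \<Longrightarrow> gpart g x \<in> J"
  by (rule in_J_cancel[OF four_neq_0], unfold gpart_eq_average)
    (intro ideal_gen_sum ideal_gen_lmult gsign_J)

lemma sk_act_class: "sk_act h (cl f) = cl (gsign h f)"
proof -
  have J: "gsign h ` J = J"
  proof (intro equalityI subsetI)
    fix x assume "x \<in> J"
    then show "x \<in> gsign h ` J" using gsign_J[of x h] gsign_gsign[of h x] by (metis imageI)
  qed (auto intro: gsign_J)
  have "sk_act h (cl f) = (\<lambda>j. gsign h j + gsign h f) ` J"
    unfolding sk_act_def fsubst_gsign sk_class_eq image_image by (simp add: gsign_def diag_op_add)
  also have "\<dots> = (\<lambda>j. j + gsign h f) ` (gsign h ` J)" by (simp only: image_image)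
  finally show ?thesis unfolding J by (simp add: sk_class_eq)
qed

lemma sk_G_piece_iff: "a \<in> sk_G_piece \<alpha> \<beta> \<gamma> g \<longleftrightarrow> (\<exists>f. a = cl (gpart g f))"
proof
  assume a: "a \<in> sk_G_piece \<alpha> \<beta> \<gamma> g"
  then obtain f where f: "a = cl f"
    unfolding sk_G_piece_def by (auto simp: sklyanin_simps)
  have "gsign h f - fconst (klein_char h g) * f \<in> J" for h
  proof -
    have "sk_act h (cl f) = sk_scalar \<alpha> \<beta> \<gamma> (klein_char h g) \<otimes>\<^bsub>A\<^esub> cl f"
      using a unfolding sk_G_piece_def f by blast
    then show ?thesis
      by (simp only: sk_act_class sk_scalar_def sklyanin_simps sk_class_eq_iff)
  qed
  \<comment> \<open>Averaging the eigenvalue congruences over the group shows that \<open>f\<close>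
    agrees with its own component modulo \<open>J\<close>.\<close>
  then have "(\<Sum>h\<in>UNIV. fconst (klein_char h g) * (gsign h f - fconst (klein_char h g) * f)) \<in> J"
    by (intro ideal_gen_sum ideal_gen_lmult)
  also have "(\<Sum>h\<in>UNIV. fconst (klein_char h g) * (gsign h f - fconst (klein_char h g) * f))
      = fconst 4 * (gpart g f - f)"
  proof -
    have 4: "fconst 4 = 1 + 1 + 1 + (1 :: 'k free_alg)" by (simp flip: fconst_1 fconst_add)
    have "(\<Sum>h\<in>(UNIV :: klein4 set). f) = fconst 4 * f" by (simp only: sum_klein4 4 distrib_right mult_1)
    then show ?thesis
      by (simp add: right_diff_distrib sum_subtractf fconst_mult_mult klein_char_square flip: gpart_eq_average)
  qed
  finally have "gpart g f - f \<in> J" by (rule in_J_cancel[OF four_neq_0])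
  then show "\<exists>f. a = cl (gpart g f)"
    unfolding f by (metis sk_class_eq_iff)
next
  assume "\<exists>f. a = cl (gpart g f)"
  then show "a \<in> sk_G_piece \<alpha> \<beta> \<gamma> g"
    by (auto simp: sk_G_piece_def sk_act_class sk_scalar_def sklyanin_simps gsign_gpart)
qed

lemma finsum_class: "finite S \<Longrightarrow> (\<Oplus>\<^bsub>A\<^esub>i\<in>S. cl (F i)) = cl (\<Sum>i\<in>S. F i)"
proof (induction S rule: finite_induct)
  interpret ring A by (rule ring_sklyanin)
  case empty
  show ?case by (simp add: sklyanin_simps)
next
  interpret ring A by (rule ring_sklyanin)
  case (insert i S)
  then show ?case
    by (subst finsum_insert) (auto simp: sklyanin_simps)
qed

lemma sk_G_part_class: "sk_G_part \<alpha> \<beta> \<gamma> (cl f) = (\<lambda>g. cl (gpart g f))"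
  unfolding sk_G_part_def
proof (rule the_equality)
  show "(\<forall>g. cl (gpart g f) \<in> sk_G_piece \<alpha> \<beta> \<gamma> g) \<and> cl f = (\<Oplus>\<^bsub>A\<^esub>g\<in>UNIV. cl (gpart g f))"
    by (auto simp: sk_G_piece_iff finsum_class gpart_sum)
  fix c assume c: "(\<forall>g. c g \<in> sk_G_piece \<alpha> \<beta> \<gamma> g) \<and> cl f = (\<Oplus>\<^bsub>A\<^esub>g\<in>UNIV. c g)"
  then have "\<forall>g. \<exists>F. c g = cl (gpart g F)" by (simp add: sk_G_piece_iff)
  then obtain F where F: "\<And>g. c g = cl (gpart g (F g))" by metis
  have "cl f = cl (\<Sum>g\<in>UNIV. gpart g (F g))"
    using c unfolding F by (simp add: finsum_class)
  then have "gpart h (f - (\<Sum>g\<in>UNIV. gpart g (F g))) \<in> J" for h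
    by (intro gpart_J) (simp add: sk_class_eq_iff)
  then have "cl (gpart h f) = cl (gpart h (F h))" for h
    by (simp add: sk_class_eq_iff gpart_linear gpart_idem)
  then show "c = (\<lambda>g. cl (gpart g f))"
    using F by auto
qed

section \<open>The twisted product on representatives\<close>

definition tw :: "'k free_alg \<Rightarrow> 'k free_alg \<Rightarrow> 'k free_alg" where
  "tw f f' = (\<Sum>g\<in>UNIV. \<Sum>h\<in>UNIV. fconst (klein_cocycle g h) * (gpart g f * gpart h f'))"

abbreviation "B \<equiv> sklyanin_twist \<alpha> \<beta> \<gamma>"

lemma twist_simps:
  "carrier B = range cl" "cl f \<oplus>\<^bsub>B\<^esub> cl f' = cl (f + f')" "cl f \<otimes>\<^bsub>B\<^esub> cl f' = cl (tw f f')"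
  "\<one>\<^bsub>B\<^esub> = cl 1" "\<zero>\<^bsub>B\<^esub> = cl 0" "\<ominus>\<^bsub>B\<^esub> cl f = cl (- f)"
proof -
  have "twist_mult \<alpha> \<beta> \<gamma> (cl f) (cl f') = cl (tw f f')"
    by (simp add: twist_mult_def tw_def sk_G_part_class sk_scalar_def sklyanin_simps finsum_class)
  then show "cl f \<otimes>\<^bsub>B\<^esub> cl f' = cl (tw f f')"
    by (simp add: sklyanin_twist_def)
  have "\<ominus>\<^bsub>B\<^esub> cl f = \<ominus>\<^bsub>A\<^esub> cl f"
    by (simp add: sklyanin_twist_def a_inv_def m_inv_def)
  then show "\<ominus>\<^bsub>B\<^esub> cl f = cl (- f)" by (simp add: a_inv_sklyanin)
qed (simp_all add: sklyanin_twist_def sklyanin_simps)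

lemma klein_cocycle_0 [simp]: "klein_cocycle 0 g = 1" "klein_cocycle g 0 = 1"
  by (cases g; simp add: zero_prod_def bsign_def)+

text \<open>The cocycle is 1 as soon as one argument is trivial. Polynomials in the two quadrics can
  therefore be computed in the Sklyanin algebra.\<close>

lemma tw_gpart_0:
  assumes "gpart 0 f = f"
  shows "tw f x = f * x" "tw x f = x * f"
proof -
  have f: "gpart g f = (if g = 0 then f else 0)" for g
    using gpart_idem[of g 0 f] assms by auto
  have "tw f x = (\<Sum>g\<in>(UNIV :: klein4 set). if g = 0 then \<Sum>h\<in>UNIV. f * gpart h x else 0)"
    unfolding tw_def f by (intro sum.cong refl) simp
  then show "tw f x = f * x"
    by (simp add: gpart_sum flip: sum_distrib_left)
  have "tw x f = (\<Sum>g\<in>UNIV. \<Sum>h\<in>(UNIV :: klein4 set). if h = 0 then gpart g x * f else 0)"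
    unfolding tw_def f by (intro sum.cong refl) simp
  then show "tw x f = x * f"
    by (simp add: gpart_sum flip: sum_distrib_right)
qed

lemma gpart_fgen: "gpart g (fgen i) = (if g = gdeg i then fgen i else 0)"
  by (auto simp: gpart_def fgen_def diag_op_single)

lemma tw_fgen:
  "tw f (fgen i) = (\<Sum>g\<in>UNIV. fconst (klein_cocycle g (gdeg i)) * (gpart g f * fgen i))"
  "tw (fgen i) f = (\<Sum>g\<in>UNIV. fconst (klein_cocycle (gdeg i) g) * (fgen i * gpart g f))"
proof -
  have "(\<Sum>h\<in>UNIV. fconst (klein_cocycle g h) * (gpart g f * gpart h (fgen i)))
    = (\<Sum>h\<in>UNIV. if h = gdeg i then fconst (klein_cocycle g h) * (gpart g f * fgen i) else 0)" for g
    by (intro sum.cong refl) (simp add: gpart_fgen)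
  then show "tw f (fgen i) = (\<Sum>g\<in>UNIV. fconst (klein_cocycle g (gdeg i)) * (gpart g f * fgen i))"
    by (simp add: tw_def)
  have "(\<Sum>h\<in>UNIV. fconst (klein_cocycle g h) * (gpart g (fgen i) * gpart h f))
    = (if g = gdeg i then \<Sum>h\<in>UNIV. fconst (klein_cocycle (gdeg i) h) * (fgen i * gpart h f) else 0)" for g
    by (simp add: gpart_fgen)
  then show "tw (fgen i) f = (\<Sum>g\<in>UNIV. fconst (klein_cocycle (gdeg i) g) * (fgen i * gpart g f))"
    by (simp add: tw_def)
qed

text \<open>The source of the signs in normality: the commutator pairing of the cocycle is the
  pairing that identifies G with its characters. Since all values are signs, a quotient of two of
  them is their product.\<close>

lemma klein_cocycle_gen_sign:
  "klein_cocycle g (gdeg i) * klein_cocycle (gdeg i) g = (gen_sign g i :: 'k)"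
  "klein_cocycle g (gdeg i) * klein_cocycle g (gdeg i) = (1 :: 'k)"
  by (cases g rule: klein4_cases; cases i; simp add: bsign_def)+

text \<open>Commutation with a generator in the twist means that each homogeneous component commutes with it
  in the Sklyanin algebra up to a sign.\<close>

lemma central_component:
  assumes "tw f (fgen i) - tw (fgen i) f \<in> J"
  shows "len_part n (gpart g f) * fgen i - fconst (gen_sign g i) * (fgen i * len_part n (gpart g f)) \<in> J"
proof -
  let ?z = "len_part n (gpart g f)"
  let ?d = "gdeg i"
  have gp: "gpart (g + ?d) (gpart h x * fgen i) = (if h = g then gpart g x * fgen i else 0)"
    "gpart (g + ?d) (fgen i * gpart h x) = (if h = g then fgen i * gpart g x else 0)" for h x
    using gpart_mult_fgen[of g i "gpart h x"] by (auto simp: gpart_idem)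
  have "gpart (g + ?d) (tw f (fgen i) - tw (fgen i) f)
     = fconst (klein_cocycle g ?d) * (gpart g f * fgen i) - fconst (klein_cocycle ?d g) * (fgen i * gpart g f)"
    unfolding tw_fgen gpart_linear gp by (simp add: if_distrib[of "\<lambda>x. _ * x"] cong: if_cong)
  then have "len_part (Suc n) (fconst (klein_cocycle g ?d) * (gpart g f * fgen i)
      - fconst (klein_cocycle ?d g) * (fgen i * gpart g f)) \<in> J"
    using len_part_J[OF gpart_J[OF assms]] by metis
  then have "fconst (klein_cocycle g ?d) * (?z * fgen i) - fconst (klein_cocycle ?d g) * (fgen i * ?z) \<in> J"
    by (simp add: len_part_diff len_part_fconst_mult len_part_mult_left[OF hom_alg_fgen] len_part_mult_right[OF hom_alg_fgen])
  then have "fconst (klein_cocycle g ?d) * (fconst (klein_cocycle g ?d) * (?z * fgen i)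
     - fconst (klein_cocycle ?d g) * (fgen i * ?z)) \<in> J"
    by (rule ideal_gen_lmult)
  then show ?thesis
    by (simp add: right_diff_distrib fconst_mult_mult klein_cocycle_gen_sign)
qed

section \<open>The centre of the twist\<close>

text \<open>Here the products are those of the free algebra. The cocycle is -1 on (g1 g2, g1 g2), so
  the twisted square of v3 is -x3^2; this accounts for the sign of the last term compared with
  \<open>Theta1\<close>, and likewise in \<open>\<theta>2\<close>.\<close>

definition \<theta>1 :: "'k free_alg" where
  "\<theta>1 = - (fgen X0 * fgen X0) + fgen X1 * fgen X1 + fgen X2 * fgen X2 + fgen X3 * fgen X3"

definition \<theta>2 :: "'k free_alg" where
  "\<theta>2 = fgen X1 * fgen X1 + fconst ((1 + \<alpha>) / (1 - \<beta>)) * (fgen X2 * fgen X2)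
     + fconst ((1 - \<alpha>) / (1 + \<gamma>)) * (fgen X3 * fgen X3)"

lemma gpart_fgen_square: "gpart 0 (fgen i * fgen i) = fgen i * fgen i"
proof -
  have "gdeg i + gdeg i = 0" by (cases i) (simp_all add: zero_prod_def)
  then show ?thesis
    using gpart_mult_fgen(1)[of "gdeg i" i "fgen i"] by (simp add: gpart_fgen)
qed

lemma gpart_0_closed:
  "gpart 0 f = f \<Longrightarrow> gpart 0 f' = f' \<Longrightarrow> gpart 0 (f * f') = f * f'"
  "gpart 0 (fconst c) = fconst c"
proof -
  show "gpart 0 (fconst c) = fconst c"
    by (simp add: gpart_def fconst_single diag_op_single)
  assume f: "gpart 0 f = f" "gpart 0 f' = f'"
  have "gpart 0 (gpart 0 f * f') = gpart 0 f * gpart 0 f'"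
    unfolding gpart_def by (rule diag_op_mult_left) (auto simp: keys_diag_op split: if_splits)
  then show "gpart 0 (f * f') = f * f'" by (simp add: f)
qed

lemma gpart_\<theta>: "gpart 0 \<theta>1 = \<theta>1" "gpart 0 \<theta>2 = \<theta>2"
proof -
  have "gpart 0 (- f) = - gpart 0 f" for f :: "'k free_alg"
    using gpart_linear(2)[of 0 0 f] by (simp add: gpart_def)
  then show "gpart 0 \<theta>1 = \<theta>1" "gpart 0 \<theta>2 = \<theta>2"
    by (simp_all add: \<theta>1_def \<theta>2_def gpart_linear gpart_fgen_square)
qed

lemma tw_fgen_fgen: "tw (fgen i) (fgen j) = fconst (klein_cocycle (gdeg i) (gdeg j)) * (fgen i * fgen j)"
  unfolding tw_fgen(1) gpart_fgen by (simp add: if_distrib[of "\<lambda>x. _ * (x * _)"] cong: if_cong)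

lemma Theta_eq: "Theta1 \<alpha> \<beta> \<gamma> = cl \<theta>1" "Theta2 \<alpha> \<beta> \<gamma> = cl \<theta>2"
proof -
  have square: "cl (fgen i) [^]\<^bsub>B\<^esub> (2::nat) = cl (fconst (klein_cocycle (gdeg i) (gdeg i)) * (fgen i * fgen i))" for i
    using gpart_0_closed(2)[of "1 :: 'k"]
    by (simp add: numeral_2_eq_2 nat_pow_def twist_simps tw_gpart_0 tw_fgen_fgen)
  have scalar: "tw (fconst c) f = fconst c * f" for c f
    by (simp add: tw_gpart_0 gpart_0_closed(2))
  have minus: "cl f \<ominus>\<^bsub>B\<^esub> cl f' = cl (f - f')" for f f'
    by (simp add: a_minus_def twist_simps)
  note eqs = Let_def sk_gen_def sk_scalar_def square scalar minus twist_simps bsign_def fconst_uminus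
  show "Theta1 \<alpha> \<beta> \<gamma> = cl \<theta>1" "Theta2 \<alpha> \<beta> \<gamma> = cl \<theta>2"
    unfolding Theta1_def Theta2_def \<theta>1_def \<theta>2_def by (simp_all add: eqs)
qed

lemma \<theta>_hom [simp]: "\<theta>1 \<in> hom_alg 2" "\<theta>2 \<in> hom_alg 2"
  unfolding \<theta>1_def \<theta>2_def
  by (intro hom_alg_add hom_alg_uminus hom_alg_fconst_mult e_mult_hom hom_alg_fgen)+

text \<open>Both coefficients of \<open>\<theta>2\<close> and \<alpha> itself are expressed through
  1/\<nu> and (1 - \<alpha>)/(1 + \<gamma>), so that the comparison with \<open>W2\<close> becomes a
  polynomial identity.\<close>

lemma \<theta>_coeffs:
  "(1 + \<alpha>) / (1 - \<beta>) = \<alpha> + (1 - \<alpha>) / (1 + \<gamma>)"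
  "\<alpha> = 1 + 2 * (1 / \<nu>) - 2 * ((1 - \<alpha>) / (1 + \<gamma>))"
proof -
  have "(1 - \<alpha>) * (1 - \<beta>) = (1 + \<alpha> * \<beta>) * (1 + \<gamma>) - (\<alpha> + \<beta> + \<gamma> + \<alpha> * \<beta> * \<gamma>)"
    by (simp add: algebra_simps)
  then have c3: "(1 - \<alpha>) / (1 + \<gamma>) = (1 + \<alpha> * \<beta>) / (1 - \<beta>)"
    using \<beta>_neq \<gamma>_neq by (simp add: params divide_simps)
  show "(1 + \<alpha>) / (1 - \<beta>) = \<alpha> + (1 - \<alpha>) / (1 + \<gamma>)"
    unfolding c3 using \<beta>_neq by (simp add: divide_simps) (simp add: algebra_simps)
  have "2 * (1 / \<nu>) = \<nu> * ((1 + \<alpha>) * (1 + \<beta>)) / (1 - \<beta>) * (1 / \<nu>)"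
    unfolding \<nu>_eq nonzero_mult_div_cancel_right[OF \<beta>_neq(2)] ..
  also have "\<dots> = (1 + \<alpha>) * (1 + \<beta>) / (1 - \<beta>)"
    using \<nu>_neq by simp
  finally show "\<alpha> = 1 + 2 * (1 / \<nu>) - 2 * ((1 - \<alpha>) / (1 + \<gamma>))"
    unfolding c3 using \<beta>_neq by (simp only:) (simp add: divide_simps, simp add: algebra_simps)
qed

lemma W1_\<theta>: "fconst 2 * (W1 + \<theta>1) = r3"
proof (rule quad_ext)
  show "fconst 2 * (W1 + \<theta>1) \<in> hom_alg 2" "r3 \<in> hom_alg 2"
    by (intro hom_alg_add hom_alg_diff hom_alg_fconst_mult e_mult_hom e_hom W_hom \<theta>_hom)+
  show "quad_val y y' (fconst 2 * (W1 + \<theta>1)) = quad_val y y' r3" for y y'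
    by (simp add: W1_def \<theta>1_def rel_vals quad_val_e lin_val_e i_simps)
qed

lemma W2_\<theta>: "fconst 2 * (W2 - fconst 2 * \<theta>2 - fconst (1 + 1 / \<nu>) * W1) = - (r3 + r4)"
proof (rule quad_ext)
  show "fconst 2 * (W2 - fconst 2 * \<theta>2 - fconst (1 + 1 / \<nu>) * W1) \<in> hom_alg 2" "- (r3 + r4) \<in> hom_alg 2"
    by (intro hom_alg_add hom_alg_diff hom_alg_uminus hom_alg_fconst_mult e_mult_hom e_hom W_hom \<theta>_hom)+
  fix y y'
  define n c where "n = 1 / \<nu>" and "c = (1 - \<alpha>) / (1 + \<gamma>)"
  have a: "\<alpha> = 1 + 2 * n - 2 * c" and c2: "(1 + \<alpha>) / (1 - \<beta>) = \<alpha> + c"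
    using \<theta>_coeffs unfolding n_def c_def by blast+
  \<comment> \<open>Writing \<open>a\<close> for \<alpha> allows its replacement by the expression
    in \<open>n\<close> and \<open>c\<close> after the evaluation.\<close>
  have l: "quad_val y y' (fconst 2 * (W2 - fconst 2 * \<theta>2 - fconst (1 + 1 / \<nu>) * W1)) =
      2 * ((y X0 + \<iota> * y X1) * (y' X0 - \<iota> * y' X1) + a * ((y X2 + \<iota> * y X3) * (y' X2 + \<iota> * y' X3))
        + n * ((y X0 + \<iota> * y X1) * (y' X0 + \<iota> * y' X1) - (y X2 + \<iota> * y X3) * (\<iota> * y' X3 - y' X2))
        - 2 * (y X1 * y' X1 + (a + c) * (y X2 * y' X2) + c * (y X3 * y' X3))
        - (1 + n) * ((y X0 + \<iota> * y X1) * (y' X0 + \<iota> * y' X1) + (\<iota> * y X3 - y X2) * (y' X2 + \<iota> * y' X3)))"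
    if "a = \<alpha>" for a
    unfolding W2_def W1_def \<theta>2_def c2 n_def[symmetric] c_def[symmetric] that
    by (simp add: rel_vals quad_val_e lin_val_e)
  have r: "quad_val y y' (- (r3 + r4)) =
      - ((y X0 + \<iota> * y X1) * (y' X0 + \<iota> * y' X1) + (\<iota> * y X3 - y X2) * (y' X2 + \<iota> * y' X3)
        - (y X2 + \<iota> * y X3) * (\<iota> * y' X3 - y' X2) - (y X0 - \<iota> * y X1) * (y' X0 - \<iota> * y' X1)
        + ((y X0 - \<iota> * y X1) * (y' X0 + \<iota> * y' X1) - (y X0 + \<iota> * y X1) * (y' X0 - \<iota> * y' X1)
        - a * ((y X2 + \<iota> * y X3) * (y' X2 + \<iota> * y' X3) - (\<iota> * y X3 - y X2) * (\<iota> * y' X3 - y' X2))))"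
    if "a = \<alpha>" for a
    unfolding that by (simp add: rel_vals quad_val_e lin_val_e)
  show "quad_val y y' (fconst 2 * (W2 - fconst 2 * \<theta>2 - fconst (1 + 1 / \<nu>) * W1)) = quad_val y y' (- (r3 + r4))"
    unfolding l[OF a[symmetric]] r[OF a[symmetric]] by (simp add: i_simps)
qed

lemma cl_W: "cl W1 = cl (- \<theta>1)" "cl W2 = cl (fconst 2 * \<theta>2 + fconst (1 + 1 / \<nu>) * W1)"
proof -
  have "fconst 2 * (W1 + \<theta>1) \<in> J"
    unfolding W1_\<theta> by (rule rel_3)
  then have "W1 + \<theta>1 \<in> J" by (rule in_J_cancel[OF two_neq_0])
  then show "cl W1 = cl (- \<theta>1)" by (simp add: sk_class_eq_iff)
  have "fconst 2 * (W2 - fconst 2 * \<theta>2 - fconst (1 + 1 / \<nu>) * W1) \<in> J"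
    unfolding W2_\<theta> by (intro ideal_gen_uminus ideal_gen_add rel_3 rel_4)
  then have "W2 - fconst 2 * \<theta>2 - fconst (1 + 1 / \<nu>) * W1 \<in> J" by (rule in_J_cancel[OF two_neq_0])
  then show "cl W2 = cl (fconst 2 * \<theta>2 + fconst (1 + 1 / \<nu>) * W1)"
    by (simp add: sk_class_eq_iff diff_diff_eq)
qed

text \<open>In degree e the two products agree, so centrality in the Sklyanin algebra passes to the
  twist. Closure under the ring operations then puts the subalgebra of the two quadrics into the
  centre.\<close>

definition central0 :: "'k free_alg set" where
  "central0 = {f. gpart 0 f = f \<and> (\<forall>x. commJ f x)}"

lemma commJ_cong: "f - g \<in> J \<Longrightarrow> commJ g x \<Longrightarrow> commJ f x"
proof -
  assume fg: "f - g \<in> J" and "commJ g x"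
  then have "(f - g) * x + (g * x - x * g) - x * (f - g) \<in> J"
    unfolding commJ_def
    by (rule ideal_gen_diff[OF ideal_gen_add[OF ideal_gen_rmult] ideal_gen_lmult[OF fg]])
  then show ?thesis unfolding commJ_def by (simp add: algebra_simps)
qed

lemma central0_closed:
  "fconst c \<in> central0" "f \<in> central0 \<Longrightarrow> g \<in> central0 \<Longrightarrow> f + g \<in> central0"
  "f \<in> central0 \<Longrightarrow> g \<in> central0 \<Longrightarrow> f * g \<in> central0"
  by (auto simp: central0_def gpart_0_closed gpart_linear intro: commJ_fconst commJ_add_left commJ_mult_left)

lemma central0_uminus: "f \<in> central0 \<Longrightarrow> - f \<in> central0"
  using central0_closed(3)[OF central0_closed(1)[of "- 1"], of f] by (simp add: fconst_uminus)

lemma \<theta>_central0: "\<theta>1 \<in> central0" "\<theta>2 \<in> central0"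
proof -
  have W: "commJ W1 x" "commJ W2 x" for x
    using commJ_W1 commJ_W2 commJ_sym by blast+
  have "- \<theta>1 - W1 \<in> J" "fconst 2 * \<theta>2 - (W2 - fconst (1 + 1 / \<nu>) * W1) \<in> J"
    using cl_W[symmetric] by (simp_all add: sk_class_eq_iff diff_diff_eq2)
  moreover have "commJ (W2 - fconst c * W1) x" for c x
    using commJ_add_left[OF W(2) commJ_fconst_left[OF W(1), where c = "- c"]] by (simp add: fconst_uminus)
  ultimately have "commJ (- \<theta>1) x" "commJ (fconst 2 * \<theta>2) x" for x
    using commJ_cong W(1) by blast+
  then have "commJ (fconst (- 1) * - \<theta>1) x" "commJ (fconst (1 / 2) * (fconst 2 * \<theta>2)) x" for x
    using commJ_fconst_left by blast+
  then have "commJ \<theta>1 x" "commJ \<theta>2 x" for x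
    using two_neq_0 by (auto simp: fconst_uminus fconst_mult_mult)
  then show "\<theta>1 \<in> central0" "\<theta>2 \<in> central0"
    by (auto simp: central0_def gpart_\<theta>)
qed

abbreviation "T \<equiv> twist_subalgebra_gen \<alpha> \<beta> \<gamma> {Theta1 \<alpha> \<beta> \<gamma>, Theta2 \<alpha> \<beta> \<gamma>}"

lemma T_closed:
  "cl (fconst c) \<in> T" "cl f \<in> T \<Longrightarrow> cl g \<in> T \<Longrightarrow> cl (f + g) \<in> T"
  "f \<in> central0 \<Longrightarrow> cl f \<in> T \<Longrightarrow> cl g \<in> T \<Longrightarrow> cl (f * g) \<in> T"
proof -
  show "cl (fconst c) \<in> T"
    unfolding twist_subalgebra_gen_def by (rule generate_ring.incl) (simp add: sk_scalar_def)
  show "cl (f + g) \<in> T" if "cl f \<in> T" "cl g \<in> T"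
    using generate_ring.eng_add[of "cl f" B _ "cl g"] that
    unfolding twist_subalgebra_gen_def by (simp add: twist_simps)
  show "cl (f * g) \<in> T" if "f \<in> central0" "cl f \<in> T" "cl g \<in> T"
    using generate_ring.eng_mult[of "cl f" B _ "cl g"] that
    unfolding twist_subalgebra_gen_def by (simp add: twist_simps central0_def tw_gpart_0)
qed

lemma T_sum: "(\<And>i. i \<in> S \<Longrightarrow> cl (F i) \<in> T) \<Longrightarrow> cl (\<Sum>i\<in>S. F i) \<in> T"
  by (induction S rule: infinite_finite_induct) (use T_closed(1)[of 0] in \<open>auto intro: T_closed(2)\<close>)

lemma T_subset: "T \<subseteq> cl ` central0"
proof
  fix x assume "x \<in> T"
  then show "x \<in> cl ` central0"
    unfolding twist_subalgebra_gen_def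
  proof (induction rule: generate_ring.induct)
    case one
    show ?case using central0_closed(1)[of 1] by (auto simp: twist_simps)
  next
    case (incl h)
    then show ?case
      using central0_closed(1) \<theta>_central0 by (auto simp: sk_scalar_def Theta_eq)
  next
    case (a_inv h)
    then show ?case by (auto simp: twist_simps intro!: imageI central0_uminus)
  next
    case (eng_add h1 h2)
    then show ?case by (auto simp: twist_simps intro!: imageI central0_closed)
  next
    case (eng_mult h1 h2)
    then obtain f g where "h1 = cl f" "h2 = cl g" "f \<in> central0" "g \<in> central0" by blast
    then show ?case
      using central0_closed(3)[of f g] by (auto simp: twist_simps central0_def tw_gpart_0)
  qed
qed

text \<open>As elements of the free algebra \<open>W1\<close> and \<open>W2\<close> mix degrees of
  G: \<open>eA * eA\<close> contains products of x0 and x1. Only their classes have degree e, so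
  representatives are built from \<open>\<theta>1\<close> and \<open>\<theta>2\<close>.\<close>

lemma W_central0: "\<exists>w\<in>central0. cl w = cl W1 \<and> cl w \<in> T" "\<exists>w\<in>central0. cl w = cl W2 \<and> cl w \<in> T"
proof -
  have \<theta>: "cl \<theta>1 \<in> T" "cl \<theta>2 \<in> T"
    unfolding twist_subalgebra_gen_def Theta_eq by (rule generate_ring.incl, simp)+
  let ?w1 = "fconst (- 1) * \<theta>1"
  let ?w2 = "fconst 2 * \<theta>2 + fconst (1 + 1 / \<nu>) * ?w1"
  have "cl ?w1 = cl W1" by (simp only: cl_W fconst_uminus fconst_1 mult_minus1)
  moreover have "?w1 \<in> central0" "cl ?w1 \<in> T"
    by (intro central0_closed T_closed \<theta> \<theta>_central0)+
  ultimately have 1: "?w1 \<in> central0" "cl ?w1 \<in> T" "cl ?w1 = cl W1"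
    by blast+
  have "?w2 \<in> central0" "cl ?w2 \<in> T"
    by (intro central0_closed T_closed \<theta> \<theta>_central0 1)+
  moreover have "cl ?w2 = cl W2"
  proof -
    have "fconst (1 + 1 / \<nu>) * (?w1 - W1) \<in> J"
      by (rule ideal_gen_lmult) (use 1(3) in \<open>simp add: sk_class_eq_iff\<close>)
    then show ?thesis unfolding cl_W(2) by (simp add: sk_class_eq_iff right_diff_distrib)
  qed
  ultimately show "\<exists>w\<in>central0. cl w = cl W1 \<and> cl w \<in> T" "\<exists>w\<in>central0. cl w = cl W2 \<and> cl w \<in> T"
    using 1 by blast+
qed

lemma T_W_mult: "W \<in> {W1, W2} \<Longrightarrow> cl f \<in> T \<Longrightarrow> cl (W ^ k * f) \<in> T"
proof (induction k)
  case (Suc k)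
  obtain w where w: "w \<in> central0" "cl w = cl W" "cl w \<in> T"
    using W_central0 Suc.prems(1) by blast
  have "cl (w * (W ^ k * f)) \<in> T"
    by (rule T_closed(3)[OF w(1,3)]) (rule Suc.IH[OF Suc.prems])
  also have "cl (w * (W ^ k * f)) = cl (W ^ Suc k * f)"
  proof -
    have "(w - W) * (W ^ k * f) \<in> J"
      by (rule ideal_gen_rmult) (use w(2) in \<open>simp add: sk_class_eq_iff\<close>)
    then show ?thesis by (simp add: sk_class_eq_iff left_diff_distrib mult.assoc)
  qed
  finally show ?case .
qed simp

theorem centre_twist:
  assumes "associated_automorphism \<alpha> \<beta> \<gamma> \<sigma>" "infinite_order_on (sk_curve \<alpha> \<beta> \<gamma>) \<sigma>"
  shows "ring_centre B = T"
proof (intro equalityI subsetI)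
  fix z assume "z \<in> T"
  then obtain f where f: "z = cl f" "f \<in> central0" using T_subset by blast
  then show "z \<in> ring_centre B"
    by (auto simp: ring_centre_def twist_simps central0_def tw_gpart_0 sk_class_eq_iff commJ_def)
next
  fix z assume z: "z \<in> ring_centre B"
  then obtain f where f: "z = cl f"
    by (auto simp: ring_centre_def twist_simps)
  have comm: "tw f (fgen i) - tw (fgen i) f \<in> J" for i
    using z by (auto simp: ring_centre_def f twist_simps sk_class_eq_iff)
  have part: "cl (len_part n (gpart g f)) \<in> T" for n g
  proof -
    \<comment> \<open>A component homogeneous for both gradings commutes with the generators up to
      the signs of \<open>g\<close>, hence is a polynomial in the central quadrics.\<close>
    obtain r c where "len_part n (gpart g f) - (\<Sum>k\<le>r. W1 ^ k * (W2 ^ (r - k) * fconst (c k))) \<in> J"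
      using normal_element_polynomial[OF ae_orb_neq[OF assms] len_part_in central_component[OF comm]] by blast
    then have "cl (len_part n (gpart g f)) = cl (\<Sum>k\<le>r. W1 ^ k * (W2 ^ (r - k) * fconst (c k)))"
      by (simp add: sk_class_eq_iff)
    then show ?thesis
      by (simp only:) (intro T_sum T_W_mult T_closed(1), simp_all)
  qed
  obtain N where N: "\<And>w. w \<in> Poly_Mapping.keys f \<Longrightarrow> length (letters w) \<le> N"
    using finite_nat_set_iff_bounded_le[of "(\<lambda>w. length (letters w)) ` Poly_Mapping.keys f"] by auto
  have "gpart g f = (\<Sum>n\<le>N. len_part n (gpart g f))" for g
    by (rule len_part_sum_all) (use N in \<open>auto simp: gpart_def keys_diag_op\<close>)
  then have "cl (gpart g f) \<in> T" for g
    using T_sum[of "{..N}" "\<lambda>n. len_part n (gpart g f)"] part by simp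
  then have "cl (\<Sum>g\<in>UNIV. gpart g f) \<in> T" by (intro T_sum) simp
  then show "z \<in> T" by (simp add: gpart_sum f)
qed

end

theorem corollary5p1p11:
  fixes \<alpha> \<beta> \<gamma> :: "'k::alg_closed_field"
    and \<sigma> :: "(gen \<Rightarrow> 'k) set \<Rightarrow> (gen \<Rightarrow> 'k) set"
  assumes "CHAR('k) \<noteq> 2"
    and "sklyanin_params \<alpha> \<beta> \<gamma>"
    and "associated_automorphism \<alpha> \<beta> \<gamma> \<sigma>"
    and "infinite_order_on (sk_curve \<alpha> \<beta> \<gamma>) \<sigma>"
  shows "ring_centre (sklyanin_twist \<alpha> \<beta> \<gamma>) =
    twist_subalgebra_gen \<alpha> \<beta> \<gamma> {Theta1 \<alpha> \<beta> \<gamma>, Theta2 \<alpha> \<beta> \<gamma>}"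
proof -
  have "of_nat 2 \<noteq> (0 :: 'k)"
  proof
    assume "of_nat 2 = (0 :: 'k)"
    then have "CHAR('k) dvd 2" by (rule of_nat_eq_0_iff_char_dvd[THEN iffD1])
    then have "CHAR('k) \<le> 2" by (rule dvd_imp_le) simp
    with assms(1) consider "CHAR('k) = 0" | "CHAR('k) = 1" by linarith
    then show False using \<open>CHAR('k) dvd 2\<close> by cases auto
  qed
  then have two: "(2 :: 'k) \<noteq> 0" by simp
  obtain \<iota> :: 'k where \<iota>: "\<iota> * \<iota> = - 1"
    using alg_closed[of 2 "\<lambda>n. if n = 0 then 1 else if n = 2 then 1 else 0"]
    by (auto simp: numeral_2_eq_2 eq_neg_iff_add_eq_0 add.commute)
  have neq: "x \<noteq> 0 \<and> 1 - x \<noteq> 0 \<and> 1 + x \<noteq> 0" if "x \<in> {\<alpha>, \<beta>, \<gamma>}" for x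
    using assms(2) that unfolding sklyanin_params_def
    by (metis IntI add.commute empty_iff eq_iff_diff_eq_0 eq_neg_iff_add_eq_0 insert_iff)
  have p: "\<alpha> + \<beta> + \<gamma> + \<alpha> * \<beta> * \<gamma> = 0"
    using assms(2) by (simp add: sklyanin_params_def)
  interpret sklyanin_setup \<alpha> \<beta> \<gamma> "2 * (1 - \<beta>) / ((1 + \<alpha>) * (1 + \<beta>))" \<iota>
    by unfold_locales (use two \<iota> p neq in auto)
  show ?thesis by (rule centre_twist[OF assms(3,4)])
qed

end
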